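(* Let $G=(V,E)$ be a clique star with $V=C_1\sqcup\dots\sqcup C_k\sqcup S$, let $(d_v)_{v\in V}$ be the numbers of states, and let $r\ge1$. Then $$\dim\big(\mathrm{Mixt}^r(\mathcal{M}_G)\big)=\min\Big\{d_S\cdot\dim\Big(\mathcal{T}^{(r)}_{d_{C_1}\times\cdots\times d_{C_k}}\Big)-1,\ \prod_{v\in V}d_v-1\Big\},$$ where $\mathcal{T}^{(r)}_{d_{C_1}\times\cdots\times d_{C_k}}$ is the set of $d_{C_1}\times\cdots\times d_{C_k}$ tensors of rank at most $r$.
   Context: $G=(V,E)$ is a finite simple undirected graph; each $v\in V$ carries a positive integer $d_v$ (number of states). Write $[n]=\{1,\dots,n\}$; for $A\subseteq V$ let $\mathcal{R}_A=\prod_{v\in A}[d_v]$, $d_A=\prod_{v\in A}d_v$ (so $d_\emptyset=1$), $\mathcal{R}=\mathcal{R}_V$; for $i\in\mathcal{R}$, $i_A$ is its restriction to $A$. A clique is a (possibly empty) set of pairwise adjacent vertices; $\mathcal{C}(G)$ is the set of (inclusion-)maximal cliques. Clique star: $G$ is a clique star if it is a union of its maximal cliques $\widetilde C_1,\dots,\widetilde C_k$ and there is a (possibly empty) clique $S$ with $\widetilde C_i\cap\widetilde C_j=S$ for all $i\ne j$. Put $C_i=\widetilde C_i\setminus S$, so $V=C_1\sqcup\dots\sqcup C_k\sqcup S$. $\Delta_n=\{p\in\mathbb{R}^n : p_i>0,\ p_1+\dots+p_n=1\}$. With $m=\sum_{C\in\mathcal{C}(G)}d_C$, the monomial map $\phi^G:\mathbb{C}^m\to\mathbb{C}^{|\mathcal{R}|}$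 is $\phi^G_i(\theta)=\prod_{C\in\mathcal{C}(G)}\theta^{(C)}_{i_C}$, and $\mathcal{M}_G=\phi^G(\mathbb{C}^m)\cap\Delta_{|\mathcal{R}|}$. The $r$-th mixture model is $$\mathrm{Mixt}^r(\mathcal{M}_G)=\{\pi_1p^1+\dots+\pi_rp^r : (\pi_1,\dots,\pi_r)\in\Delta_r,\ p^1,\dots,p^r\in\mathcal{M}_G\}.$$ Dimension means the dimension of the Zariski closure; tensors are complex, and $\dim\mathcal{T}^{(r)}$ is the affine dimension (as a subset of $\mathbb{C}^{d_{C_1}\cdots d_{C_k}}$, not projectivized). *)

theory Defs
  imports "HOL-Analysis.Analysis"
begin

section \<open>Affine space and the Zariski topology\<close>

text \<open>The affine space of complex vectors with coordinates indexed by \<open>I\<close>; as usual for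
  \<^const>\<open>PiE\<close>, vectors take the value \<^const>\<open>undefined\<close> outside of \<open>I\<close>.\<close>

definition cspace :: "'i set \<Rightarrow> ('i \<Rightarrow> complex) set" where
  "cspace I = (I \<rightarrow>\<^sub>E UNIV)"

inductive_set poly_funs :: "'i set \<Rightarrow> (('i \<Rightarrow> complex) \<Rightarrow> complex) set" for I where
  const: "(\<lambda>x. c) \<in> poly_funs I"
| coord: "i \<in> I \<Longrightarrow> (\<lambda>x. x i) \<in> poly_funs I"
| add: "f \<in> poly_funs I \<Longrightarrow> g \<in> poly_funs I \<Longrightarrow> (\<lambda>x. f x + g x) \<in> poly_funs I"
| mult: "f \<in> poly_funs I \<Longrightarrow> g \<in> poly_funs I \<Longrightarrow> (\<lambda>x. f x * g x) \<in> poly_funs I"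

definition zero_locus :: "'i set \<Rightarrow> (('i \<Rightarrow> complex) \<Rightarrow> complex) set \<Rightarrow> ('i \<Rightarrow> complex) set" where
  "zero_locus I F = {x \<in> cspace I. \<forall>f\<in>F. f x = 0}"

definition zariski :: "'i set \<Rightarrow> ('i \<Rightarrow> complex) topology" where
  "zariski I = topology (\<lambda>U. \<exists>F \<subseteq> poly_funs I. U = cspace I - zero_locus I F)"

lemma istopology_zariski:
  "istopology (\<lambda>U. \<exists>F \<subseteq> poly_funs I. U = cspace I - zero_locus I F)"
  unfolding istopology_def
proof (intro conjI allI impI)
  fix U W
  assume U: "\<exists>F \<subseteq> poly_funs I. U = cspace I - zero_locus I F"
    and W: "\<exists>F \<subseteq> poly_funs I. W = cspace I - zero_locus I F"
  from U obtain F where F: "F \<subseteq> poly_funs I" "U = cspace I - zero_locus I F"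
    by (elim exE conjE)
  from W obtain G where G: "G \<subseteq> poly_funs I" "W = cspace I - zero_locus I G"
    by (elim exE conjE)
  define H where "H = (\<lambda>(f, g). \<lambda>x. f x * g x) ` (F \<times> G)"
  have "H \<subseteq> poly_funs I"
  proof
    fix h assume "h \<in> H"
    then obtain f g where fg: "f \<in> F" "g \<in> G" "h = (\<lambda>x. f x * g x)"
      by (auto simp: H_def)
    show "h \<in> poly_funs I"
      unfolding fg(3) by (rule poly_funs.mult[OF subsetD[OF F(1) fg(1)] subsetD[OF G(1) fg(2)]])
  qed
  moreover have "U \<inter> W = cspace I - zero_locus I H"
  proof (rule set_eqI)
    fix x
    have "(\<forall>h\<in>H. h x = 0) \<longleftrightarrow> (\<forall>f\<in>F. \<forall>g\<in>G. f x * g x = 0)"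
      by (simp add: H_def)
    also have "\<dots> \<longleftrightarrow> (\<forall>f\<in>F. f x = 0) \<or> (\<forall>g\<in>G. g x = 0)"
      unfolding mult_eq_0_iff by blast
    finally have *: "(\<forall>h\<in>H. h x = 0) \<longleftrightarrow> (\<forall>f\<in>F. f x = 0) \<or> (\<forall>g\<in>G. g x = 0)" .
    show "x \<in> U \<inter> W \<longleftrightarrow> x \<in> cspace I - zero_locus I H"
      unfolding F(2) G(2) zero_locus_def Diff_iff Int_iff mem_Collect_eq * by iprover
  qed
  ultimately show "\<exists>F \<subseteq> poly_funs I. U \<inter> W = cspace I - zero_locus I F"
    by (intro exI[of _ H] conjI)
next
  fix K
  assume "\<forall>U\<in>K. \<exists>F \<subseteq> poly_funs I. U = cspace I - zero_locus I F"
  from bchoice[OF this] obtain F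
    where F: "\<forall>U\<in>K. F U \<subseteq> poly_funs I \<and> U = cspace I - zero_locus I (F U)" ..
  define H where "H = (\<Union>U\<in>K. F U)"
  have "H \<subseteq> poly_funs I"
    unfolding H_def using F by (intro UN_least) simp
  moreover have "\<Union>K = cspace I - zero_locus I H"
  proof -
    have "\<Union>K = (\<Union>U\<in>K. cspace I - zero_locus I (F U))"
      using F by (metis (no_types, lifting) SUP_cong image_ident)
    also have "\<dots> = cspace I - zero_locus I H"
      by (auto simp: zero_locus_def H_def)
    finally show ?thesis .
  qed
  ultimately show "\<exists>F \<subseteq> poly_funs I. \<Union>K = cspace I - zero_locus I F"
    by (intro exI[of _ H] conjI)
qed

lemma openin_zariski:
  "openin (zariski I) U \<longleftrightarrow> (\<exists>F \<subseteq> poly_funs I. U = cspace I - zero_locus I F)"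
  unfolding zariski_def topology_inverse'[OF istopology_zariski] ..

lemma topspace_zariski [simp]: "topspace (zariski I) = cspace I"
proof (rule antisym)
  have "openin (zariski I) (topspace (zariski I))" by (rule openin_topspace)
  then show "topspace (zariski I) \<subseteq> cspace I"
    unfolding openin_zariski by (elim exE conjE) simp
  have "{\<lambda>x. 1} \<subseteq> poly_funs I" by (simp add: poly_funs.const)
  moreover have "cspace I = cspace I - zero_locus I {\<lambda>x. 1}"
    by (simp add: zero_locus_def)
  ultimately have "openin (zariski I) (cspace I)"
    unfolding openin_zariski by (intro exI[of _ "{\<lambda>x. 1}"] conjI)
  then show "cspace I \<subseteq> topspace (zariski I)" by (rule openin_subset)
qed

lemma closedin_zariski:
  "closedin (zariski I) Z \<longleftrightarrow> (\<exists>F \<subseteq> poly_funs I. Z = zero_locus I F)"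
proof -
  have sub: "zero_locus I F \<subseteq> cspace I" for F
    by (simp add: zero_locus_def)
  have eq: "Z \<subseteq> cspace I \<and> cspace I - Z = cspace I - zero_locus I F \<longleftrightarrow> Z = zero_locus I F" for F
    using sub[of F] by auto
  then show ?thesis
    unfolding closedin_def openin_zariski topspace_zariski eq[symmetric] by iprover
qed


section \<open>Dimension\<close>

definition irreducible_in :: "'a topology \<Rightarrow> 'a set \<Rightarrow> bool" where
  "irreducible_in X Z \<longleftrightarrow> Z \<subseteq> topspace X \<and> Z \<noteq> {} \<and>
     (\<forall>A B. closedin X A \<and> closedin X B \<and> Z \<subseteq> A \<union> B \<longrightarrow> Z \<subseteq> A \<or> Z \<subseteq> B)"

text \<open>Krull dimension: the supremum of the lengths \<open>n\<close> of chains
  \<open>Z\<^sub>0 \<subset> Z\<^sub>1 \<subset> \<dots> \<subset> Z\<^sub>n\<close> of irreducible closed subsets. It is \<open>- \<infinity>\<close> for the empty space.\<close>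

definition krull_dim :: "'a topology \<Rightarrow> ereal" where
  "krull_dim X = (SUP n \<in> {n :: nat. \<exists>Z :: nat \<Rightarrow> 'a set.
     (\<forall>i\<le>n. closedin X (Z i) \<and> irreducible_in X (Z i)) \<and> (\<forall>i<n. Z i \<subset> Z (Suc i))}. ereal (real n))"

definition zariski_dim :: "'i set \<Rightarrow> ('i \<Rightarrow> complex) set \<Rightarrow> ereal" where
  "zariski_dim I X = krull_dim (subtopology (zariski I) (zariski I closure_of X))"


section \<open>Graphs and clique stars\<close>

definition simple_graph :: "'v set \<Rightarrow> 'v set set \<Rightarrow> bool" where
  "simple_graph V E \<longleftrightarrow> finite V \<and> (\<forall>e\<in>E. e \<subseteq> V \<and> card e = 2)"

definition clique :: "'v set \<Rightarrow> 'v set set \<Rightarrow> 'v set \<Rightarrow> bool" where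
  "clique V E K \<longleftrightarrow> K \<subseteq> V \<and> (\<forall>u\<in>K. \<forall>v\<in>K. u \<noteq> v \<longrightarrow> {u, v} \<in> E)"

definition maximal_cliques :: "'v set \<Rightarrow> 'v set set \<Rightarrow> 'v set set" where
  "maximal_cliques V E = {K. clique V E K \<and> (\<forall>L. clique V E L \<and> K \<subseteq> L \<longrightarrow> L = K)}"

text \<open>\<open>K 1, \<dots>, K k\<close> enumerate the maximal cliques without repetition. Every graph is the union
  of all its maximal cliques, so this need not be required separately.\<close>

definition clique_star :: "'v set \<Rightarrow> 'v set set \<Rightarrow> nat \<Rightarrow> (nat \<Rightarrow> 'v set) \<Rightarrow> 'v set \<Rightarrow> bool" where
  "clique_star V E k K S \<longleftrightarrow>
     bij_betw K {1..k} (maximal_cliques V E) \<and>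
     clique V E S \<and>
     (\<forall>i\<in>{1..k}. \<forall>j\<in>{1..k}. i \<noteq> j \<longrightarrow> K i \<inter> K j = S)"


section \<open>Graphical models and their mixtures\<close>

definition states :: "('v \<Rightarrow> nat) \<Rightarrow> 'v set \<Rightarrow> ('v \<Rightarrow> nat) set" where
  "states d A = (\<Pi>\<^sub>E v\<in>A. {1..d v})"

definition num_states :: "('v \<Rightarrow> nat) \<Rightarrow> 'v set \<Rightarrow> nat" where
  "num_states d A = (\<Prod>v\<in>A. d v)"

text \<open>The open probability simplex, as a set of complex vectors with real coordinates.\<close>

definition open_simplex :: "'i set \<Rightarrow> ('i \<Rightarrow> complex) set" where
  "open_simplex I = {p \<in> cspace I. (\<forall>i\<in>I. p i \<in> \<real> \<and> 0 < Re (p i)) \<and> (\<Sum>i\<in>I. p i) = 1}"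

text \<open>A parameter vector has one coordinate for each pair of a maximal clique \<open>C\<close> and a joint
  state of \<open>C\<close>.\<close>

definition param_index :: "'v set \<Rightarrow> 'v set set \<Rightarrow> ('v \<Rightarrow> nat) \<Rightarrow> ('v set \<times> ('v \<Rightarrow> nat)) set" where
  "param_index V E d = (SIGMA C : maximal_cliques V E. states d C)"

definition monomial_map ::
  "'v set \<Rightarrow> 'v set set \<Rightarrow> ('v \<Rightarrow> nat) \<Rightarrow> ('v set \<times> ('v \<Rightarrow> nat) \<Rightarrow> complex) \<Rightarrow> ('v \<Rightarrow> nat) \<Rightarrow> complex" where
  "monomial_map V E d \<theta> = (\<lambda>i\<in>states d V. \<Prod>C\<in>maximal_cliques V E. \<theta> (C, restrict i C))"

definition graphical_model ::
  "'v set \<Rightarrow> 'v set set \<Rightarrow> ('v \<Rightarrow> nat) \<Rightarrow> (('v \<Rightarrow> nat) \<Rightarrow> complex) set" where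
  "graphical_model V E d =
     monomial_map V E d ` cspace (param_index V E d) \<inter> open_simplex (states d V)"

definition mixture :: "nat \<Rightarrow> 'i set \<Rightarrow> ('i \<Rightarrow> complex) set \<Rightarrow> ('i \<Rightarrow> complex) set" where
  "mixture r I M = {(\<lambda>i\<in>I. \<Sum>l=1..r. \<pi> l * p l i) | \<pi> p.
     \<pi> \<in> open_simplex {1..r} \<and> (\<forall>l\<in>{1..r}. p l \<in> M)}"


section \<open>Tensors of bounded rank\<close>

text \<open>Tensors of format \<open>n 1 \<times> \<dots> \<times> n k\<close> are the elements of \<open>cspace (tensor_index k n)\<close>.\<close>

definition tensor_index :: "nat \<Rightarrow> (nat \<Rightarrow> nat) \<Rightarrow> (nat \<Rightarrow> nat) set" where
  "tensor_index k n = (\<Pi>\<^sub>E j\<in>{1..k}. {1..n j})"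

definition outer_product :: "nat \<Rightarrow> (nat \<Rightarrow> nat) \<Rightarrow> (nat \<Rightarrow> nat \<Rightarrow> complex) \<Rightarrow> (nat \<Rightarrow> nat) \<Rightarrow> complex" where
  "outer_product k n a = (\<lambda>x\<in>tensor_index k n. \<Prod>j=1..k. a j (x j))"

definition tensor_rank :: "nat \<Rightarrow> (nat \<Rightarrow> nat) \<Rightarrow> ((nat \<Rightarrow> nat) \<Rightarrow> complex) \<Rightarrow> nat" where
  "tensor_rank k n T = (LEAST s. \<exists>a :: nat \<Rightarrow> nat \<Rightarrow> nat \<Rightarrow> complex.
     (\<forall>l\<in>{1..s}. \<forall>j\<in>{1..k}. a l j \<in> cspace {1..n j}) \<and>
     T = (\<lambda>x\<in>tensor_index k n. \<Sum>l=1..s. outer_product k n (a l) x))"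

definition tensors_rank_le :: "nat \<Rightarrow> (nat \<Rightarrow> nat) \<Rightarrow> nat \<Rightarrow> ((nat \<Rightarrow> nat) \<Rightarrow> complex) set" where
  "tensors_rank_le k n r = {T \<in> cspace (tensor_index k n). tensor_rank k n T \<le> r}"

end

theory Submission
  imports Defs "HOL-Library.Function_Algebras"
begin

text \<open>
  Why the formula holds. Fix a state of the centre \<open>S\<close>. A positive product over the maximal
  cliques then splits into one factor for each arm \<open>K j - S\<close>, that is, it is a positive tensor of
  rank one; and the tensors that belong to different states of \<open>S\<close> are unrelated. Hence a point of
  the mixture model is, up to normalisation, a family of \<open>d\<^sub>S\<close> independent tensors, each a sum of
  \<open>r\<close> positive tensors of rank one. The mixture weights are absorbed by the first factors. So the
  model is the section by a hyperplane of a cone that is Zariski dense in the \<open>d\<^sub>S\<close>-th power of the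
  variety of tensors of rank at most \<open>r\<close>, and its dimension is \<open>d\<^sub>S\<close> times the dimension of that
  variety, minus one. As the dimension of that variety is at most the number of entries of a tensor,
  the minimum is always attained by its first term.

  How dimensions are computed. The Krull dimension of the closure of a set \<open>X\<close> is compared with
  \<open>coord_rank\<close>, the largest number of coordinates between which no polynomial relation holds on
  \<open>X\<close>. For this number the three reductions above are elementary: it is the same for a dense
  subset, it is additive for powers (\<open>coord_rank_product\<close>), and it drops by one when a cone is cut
  by the hyperplane where the coordinates have sum one (\<open>coord_rank_normalize\<close>). That it equals the
  dimension (\<open>zariski_dim_eq_coord_rank\<close>) has two halves.

  No chain of irreducible closed sets is longer, since \<open>coord_rank\<close> increases strictly along such
  a chain: a polynomial that vanishes on the smaller set but not on the larger one is algebraically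
  independent, on the larger one, of coordinates that are independent on the smaller one
  (\<open>adjoin_vanishing_independent\<close>).

  A chain of that length is constructed for the image of the positive orthant under rational
  functions. After some parameters have been fixed at a suitable point, the others are algebraic
  over the coordinates of the image. Freeing them one after the other gives affine slices of the
  orthant of dimensions \<open>0, 1, 2, \<dots>\<close>, and the closures of their images are irreducible and grow
  strictly (\<open>zariski_dim_ge_independent\<close>).

  Both halves rest on the invariance of the transcendence degree, which is obtained by counting.
  The monomials of degree at most \<open>n\<close> in \<open>a\<close> functions span a space of dimension \<open>O(n\<^sup>a)\<close>; adjoining
  functions algebraic over them preserves this bound, up to multiplication by the \<open>n\<close>-th power of a
  fixed nonzero function that clears denominators; but \<open>b\<close> independent functions have at least
  \<open>(n + 1)\<^sup>b\<close> linearly independent monomials of degree at most \<open>b n\<close>. Hence \<open>b \<le> a\<close>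
  (\<open>growth_independent_card_le\<close>).
\<close>

section \<open>Polynomial functions\<close>

lemma poly_funs_sum:
  assumes "finite A" "\<And>a. a \<in> A \<Longrightarrow> f a \<in> poly_funs I"
  shows "(\<lambda>x. \<Sum>a\<in>A. f a x) \<in> poly_funs I"
  using assms by (induction A rule: finite_induct) (auto intro: poly_funs.intros)

lemma poly_funs_prod:
  assumes "finite A" "\<And>a. a \<in> A \<Longrightarrow> f a \<in> poly_funs I"
  shows "(\<lambda>x. \<Prod>a\<in>A. f a x) \<in> poly_funs I"
  using assms by (induction A rule: finite_induct) (auto intro: poly_funs.intros)

lemma poly_funs_mono: "P \<in> poly_funs I \<Longrightarrow> I \<subseteq> J \<Longrightarrow> P \<in> poly_funs J"
  by (induction rule: poly_funs.induct) (auto intro: poly_funs.intros)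

lemma poly_funs_cong:
  "P \<in> poly_funs I \<Longrightarrow> (\<And>i. i \<in> I \<Longrightarrow> x i = y i) \<Longrightarrow> P x = P y"
  by (induction rule: poly_funs.induct) auto

lemma poly_funs_subst:
  assumes "P \<in> poly_funs I" "\<And>i. i \<in> I \<Longrightarrow> h i \<in> poly_funs J"
  shows "(\<lambda>y. P (\<lambda>i. h i y)) \<in> poly_funs J"
  using assms by (induction rule: poly_funs.induct) (auto intro: poly_funs.intros)

text \<open>A polynomial function is regarded as a univariate polynomial in one chosen variable. Taking the
  values of the coefficients at a point to be an element of \<^typ>\<open>complex poly\<close> makes degrees, roots
  and products of the library available.\<close>

lemma poly_funs_expand:
  assumes "P \<in> poly_funs (insert i A)"
  obtains q :: "('i \<Rightarrow> complex) \<Rightarrow> complex poly" and n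
  where "\<And>m. (\<lambda>x. coeff (q x) m) \<in> poly_funs A" "\<And>x. degree (q x) \<le> n"
    "\<And>x. P x = poly (q x) (x i)"
proof -
  have "\<exists>q n. (\<forall>m. (\<lambda>x. coeff (q x) m) \<in> poly_funs A) \<and> (\<forall>x. degree (q x :: complex poly) \<le> n) \<and>
    (\<forall>x. P x = poly (q x) (x i))" (is "\<exists>q n. ?Q P q n")
    using assms
  proof (induction rule: poly_funs.induct)
    case (const c)
    have "(\<lambda>x. coeff [:c:] m) \<in> poly_funs A" for m by (rule poly_funs.const)
    then show ?case by (intro exI[of _ "\<lambda>_. [:c:]"] exI[of _ 0]) auto
  next
    case (coord j)
    show ?case
    proof (cases "j = i")
      case True
      then show ?thesis
        by (intro exI[of _ "\<lambda>_. [:0,1:]"] exI[of _ 1]) (auto intro: poly_funs.const)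
    next
      case False
      with coord have "j \<in> A" by auto
      then have "(\<lambda>x::'i \<Rightarrow> complex. if m = 0 then x j else 0) \<in> poly_funs A" for m :: nat
        by (cases "m = 0") (auto intro: poly_funs.intros)
      moreover have "(\<lambda>x::'i \<Rightarrow> complex. coeff [:x j:] m) = (\<lambda>x. if m = 0 then x j else 0)" for m
        by (cases m) auto
      ultimately have "(\<lambda>x::'i \<Rightarrow> complex. coeff [:x j:] m) \<in> poly_funs A" for m
        by simp
      then show ?thesis
        by (intro exI[of _ "\<lambda>x. [:x j:]"] exI[of _ 0]) auto
    qed
  next
    case (add f g)
    then obtain q n q' n' where q: "?Q f q n" "?Q g q' n'" by blast
    have "?Q (\<lambda>x. f x + g x) (\<lambda>x. q x + q' x) (max n n')"
      using q by (auto intro: poly_funs.intros intro!: degree_add_le intro: max.coboundedI1 max.coboundedI2)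
    then show ?case by (intro exI[of _ "\<lambda>x. q x + q' x"] exI[of _ "max n n'"])
  next
    case (mult f g)
    then obtain q n q' n' where q: "?Q f q n" "?Q g q' n'" by blast
    have "?Q (\<lambda>x. f x * g x) (\<lambda>x. q x * q' x) (n + n')"
    proof (intro conjI allI)
      fix x
      have "degree (q x * q' x) \<le> degree (q x) + degree (q' x)" by (rule degree_mult_le)
      also have "\<dots> \<le> n + n'" using q by (intro add_mono) auto
      finally show "degree (q x * q' x) \<le> n + n'" .
    qed (use q in \<open>auto simp: coeff_mult intro!: poly_funs_sum poly_funs.mult\<close>)
    then show ?case by (intro exI[of _ "\<lambda>x. q x * q' x"] exI[of _ "n + n'"])
  qed
  then show ?thesis using that by blast
qed

text \<open>Induction on the variables: for fixed values of the others, a polynomial in the last variable with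
  infinitely many roots is zero, so its coefficients vanish on the smaller box.\<close>

lemma poly_funs_eq_0_on_infinite_box:
  assumes "finite I" "infinite S" "P \<in> poly_funs I" "\<And>x. (\<And>i. x i \<in> S) \<Longrightarrow> P x = 0"
  shows "P x = 0"
  using assms(1,3,4)
proof (induction I arbitrary: P x rule: finite_induct)
  case empty
  obtain s where "s \<in> S" using assms(2) infinite_imp_nonempty by blast
  then have "P (\<lambda>_. s) = 0" using empty.prems by auto
  then show ?case using poly_funs_cong[OF empty.prems(1), of x "\<lambda>_. s"] by simp
next
  case (insert i A)
  obtain q n where
    q: "\<And>m. (\<lambda>x. coeff (q x) m) \<in> poly_funs A" "\<And>x. degree (q x) \<le> n"
    and P: "\<And>x. P x = poly (q x) (x i)"
    by (rule poly_funs_expand[OF insert.prems(1)]) rule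
  have "coeff (q x) m = 0" for m x
  proof (rule insert.IH[OF q(1)])
    fix y :: "'a \<Rightarrow> complex" assume y: "\<And>j. y j \<in> S"
    have "poly (q y) s = 0" if "s \<in> S" for s
    proof -
      have "q (y(i := s)) = q y"
        by (rule poly_eqI, rule poly_funs_cong[OF q(1)]) (use insert.hyps in auto)
      moreover have "P (y(i := s)) = 0" using y that by (intro insert.prems(2)) auto
      ultimately show ?thesis using P[of "y(i:=s)"] by simp
    qed
    then have "S \<subseteq> {s. poly (q y) s = 0}" by auto
    then have "q y = 0" using assms(2) poly_roots_finite finite_subset by metis
    then show "coeff (q y) m = 0" by simp
  qed
  then have "q x = 0" by (intro poly_eqI) simp
  then show ?case by (simp add: P)
qed

definition monom_fun :: "'i set \<Rightarrow> ('i \<Rightarrow> nat) \<Rightarrow> ('i \<Rightarrow> complex) \<Rightarrow> complex" where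
  "monom_fun B \<alpha> x = (\<Prod>i\<in>B. x i ^ \<alpha> i)"

text \<open>The exponents are bounded separately in each variable, so that the monomials are indexed by a
  product set, whose cardinality is a power, and the induction on the variables is immediate.\<close>

lemma monom_funs_independent:
  assumes "finite B" "\<And>x. (\<Sum>\<alpha>\<in>B \<rightarrow>\<^sub>E {..N}. c \<alpha> * monom_fun B \<alpha> x) = 0" "\<alpha> \<in> B \<rightarrow>\<^sub>E {..N}"
  shows "c \<alpha> = 0"
  using assms
proof (induction B arbitrary: c \<alpha> rule: finite_induct)
  case empty
  then show ?case by (auto simp: monom_fun_def)
next
  case (insert i A)
  have split: "(\<Sum>\<alpha>\<in>insert i A \<rightarrow>\<^sub>E {..N}. c \<alpha> * monom_fun (insert i A) \<alpha> x) =
      (\<Sum>m\<le>N. (\<Sum>\<alpha>\<in>A \<rightarrow>\<^sub>E {..N}. c (\<alpha>(i := m)) * monom_fun A \<alpha> x) * x i ^ m)" for x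
  proof -
    have "(\<Prod>j\<in>A. x j ^ (if j = i then m else \<alpha> j)) = (\<Prod>j\<in>A. x j ^ \<alpha> j)" for m \<alpha>
      using insert.hyps by (intro prod.cong) auto
    then have mf: "monom_fun (insert i A) (\<alpha>(i := m)) x = monom_fun A \<alpha> x * x i ^ m" for m \<alpha>
      using insert.hyps by (simp add: monom_fun_def mult.commute)
    show ?thesis
      unfolding PiE_insert_eq
      by (subst sum.reindex[OF inj_combinator[OF insert.hyps(2)]])
        (simp add: sum.cartesian_product case_prod_unfold mf sum_distrib_right mult.assoc)
  qed
  have inner: "(\<Sum>\<alpha>\<in>A \<rightarrow>\<^sub>E {..N}. c (\<alpha>(i := m)) * monom_fun A \<alpha> x) = 0" if "m \<le> N" for m x
  proof -
    have "(\<Sum>m\<le>N. (\<Sum>\<alpha>\<in>A \<rightarrow>\<^sub>E {..N}. c (\<alpha>(i := m)) * monom_fun A \<alpha> x) * z ^ m) = 0" for z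
    proof -
      have "monom_fun A \<alpha> (x(i := z)) = monom_fun A \<alpha> x" for \<alpha>
        unfolding monom_fun_def using insert.hyps by (intro prod.cong) auto
      then show ?thesis using split[of "x(i := z)"] insert.prems(1)[of "x(i := z)"] by simp
    qed
    then show ?thesis
      using polyfun_eq_0[of "\<lambda>m. \<Sum>\<alpha>\<in>A \<rightarrow>\<^sub>E {..N}. c (\<alpha>(i := m)) * monom_fun A \<alpha> x" N] that by blast
  qed
  obtain \<beta> m where ab: "\<alpha> = \<beta>(i := m)" "\<beta> \<in> A \<rightarrow>\<^sub>E {..N}" "m \<le> N"
    using insert.prems(2) unfolding PiE_insert_eq by auto
  have "(c (\<beta>(i := m))) = 0"
    by (rule insert.IH[of "\<lambda>\<beta>. c (\<beta>(i := m))"]) (use inner ab in auto)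
  then show ?case unfolding ab(1) .
qed

section \<open>Algebras generated by functions\<close>

text \<open>Polynomials of degree at most \<open>n\<close> in the functions of \<open>U\<close>. Multiplication is allowed only by one
  generator at a time, so that an induction over this predicate raises the degree in steps of one;
  \<open>algebraic_over_reduce\<close> depends on this. Closure under arbitrary products is
  \<open>degree_le_mult\<close>.\<close>

inductive degree_le :: "('w \<Rightarrow> complex) set \<Rightarrow> nat \<Rightarrow> ('w \<Rightarrow> complex) \<Rightarrow> bool" for U where
  const: "degree_le U n (\<lambda>w. c)"
| add: "degree_le U n f \<Longrightarrow> degree_le U n g \<Longrightarrow> degree_le U n (\<lambda>w. f w + g w)"
| step: "u \<in> U \<Longrightarrow> degree_le U n f \<Longrightarrow> degree_le U (Suc n) (\<lambda>w. u w * f w)"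

definition generated :: "('w \<Rightarrow> complex) set \<Rightarrow> ('w \<Rightarrow> complex) set" where
  "generated U = {f. \<exists>n. degree_le U n f}"

lemma degree_le_mono: "degree_le U m f \<Longrightarrow> m \<le> n \<Longrightarrow> degree_le U n f"
proof (induction arbitrary: n rule: degree_le.induct)
  case (step u m f n)
  then obtain n' where "n = Suc n'" "m \<le> n'" by (cases n) auto
  with step show ?case by (auto intro: degree_le.step)
qed (auto intro: degree_le.const degree_le.add)

lemma degree_le_mult: "degree_le U m f \<Longrightarrow> degree_le U n g \<Longrightarrow> degree_le U (m + n) (\<lambda>w. f w * g w)"
proof (induction rule: degree_le.induct)
  case (const m c)
  from const.prems have "degree_le U n (\<lambda>w. c * g w)"
  proof (induction rule: degree_le.induct)
    case (const n c')
    show ?case by (rule degree_le.const)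
  next
    case (add n f g)
    from degree_le.add[OF add.IH] show ?case by (simp add: algebra_simps)
  next
    case (step u n f)
    from degree_le.step[OF step.hyps(1) step.IH] show ?case by (simp add: algebra_simps)
  qed
  then show ?case by (rule degree_le_mono) simp
next
  case (add m f f')
  from degree_le.add[OF add.IH[OF add.prems]] show ?case by (simp add: algebra_simps)
next
  case (step u m f)
  from degree_le.step[OF step.hyps(1) step.IH[OF step.prems]] show ?case by (simp add: algebra_simps)
qed

lemma degree_le_minus: "degree_le U n f \<Longrightarrow> degree_le U n (\<lambda>w. - f w)"
  using degree_le_mult[OF degree_le.const[of U 0 "-1"], of n f] by simp

lemma degree_le_power: "degree_le U m f \<Longrightarrow> degree_le U (m * n) (\<lambda>w. f w ^ n)"
proof (induction n)
  case 0
  show ?case by (simp add: degree_le.const)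
next
  case (Suc n)
  from degree_le_mult[OF Suc.prems Suc.IH[OF Suc.prems]] show ?case by simp
qed

lemma degree_le_gen: "u \<in> U \<Longrightarrow> degree_le U 1 u"
  using degree_le.step[OF _ degree_le.const[of U 0 1]] by simp

lemma degree_le_subset: "degree_le U n f \<Longrightarrow> U \<subseteq> U' \<Longrightarrow> degree_le U' n f"
  by (induction rule: degree_le.induct) (auto intro: degree_le.intros)

lemma degree_le_monom_fun:
  assumes "finite B" "u ` B \<subseteq> U" "\<alpha> \<in> B \<rightarrow>\<^sub>E {..N}"
  shows "degree_le U (card B * N) (\<lambda>w. monom_fun B \<alpha> (\<lambda>i. u i w))"
proof -
  have "degree_le U (card C * N) (\<lambda>w. \<Prod>i\<in>C. u i w ^ \<alpha> i)" if "C \<subseteq> B" for C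
    using finite_subset[OF that assms(1)] that
  proof (induction C rule: finite_induct)
    case empty
    show ?case by (simp add: degree_le.const)
  next
    case (insert i C)
    have "degree_le U (1 * \<alpha> i) (\<lambda>w. u i w ^ \<alpha> i)"
      using insert.prems assms(2) by (intro degree_le_power degree_le_gen) auto
    moreover have "\<alpha> i \<le> N" using insert.prems assms(3) by auto
    ultimately have "degree_le U N (\<lambda>w. u i w ^ \<alpha> i)" by (auto intro: degree_le_mono)
    from degree_le_mult[OF this insert.IH] insert show ?case by simp
  qed
  then show ?thesis by (simp add: monom_fun_def)
qed

lemma generated_const: "(\<lambda>w. c) \<in> generated U"
  by (auto simp: generated_def intro: degree_le.const)

lemma generated_add: "f \<in> generated U \<Longrightarrow> g \<in> generated U \<Longrightarrow> (\<lambda>w. f w + g w) \<in> generated U"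
proof -
  assume "f \<in> generated U" "g \<in> generated U"
  then obtain m n where "degree_le U m f" "degree_le U n g" by (auto simp: generated_def)
  then have "degree_le U (max m n) (\<lambda>w. f w + g w)"
    by (intro degree_le.add) (auto intro: degree_le_mono)
  then show ?thesis by (auto simp: generated_def)
qed

lemma generated_mult: "f \<in> generated U \<Longrightarrow> g \<in> generated U \<Longrightarrow> (\<lambda>w. f w * g w) \<in> generated U"
  unfolding generated_def by (auto intro: degree_le_mult)

lemma generated_sum:
  "finite A \<Longrightarrow> (\<And>a. a \<in> A \<Longrightarrow> f a \<in> generated U) \<Longrightarrow> (\<lambda>w. \<Sum>a\<in>A. f a w) \<in> generated U"
  by (induction A rule: finite_induct) (auto intro: generated_const generated_add)

lemma generated_gen: "u \<in> U \<Longrightarrow> u \<in> generated U"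
  unfolding generated_def by (auto intro: degree_le_gen)

lemma generated_mono: "U \<subseteq> U' \<Longrightarrow> generated U \<subseteq> generated U'"
  unfolding generated_def by (auto intro: degree_le_subset)

lemma generated_poly_funs: "P \<in> poly_funs B \<Longrightarrow> (\<lambda>w. P (\<lambda>i. u i w)) \<in> generated (u ` B)"
proof (induction rule: poly_funs.induct)
  case (coord i)
  then show ?case using generated_gen[of "u i" "u ` B"] by simp
qed (auto intro: generated_const generated_add generated_mult)

section \<open>Algebraic independence and algebraic dependence\<close>

text \<open>The functions \<open>u i\<close>, restricted to \<open>\<Omega>\<close>, satisfy no polynomial relation. They are given as a family,
  so that a repeated function counts as a relation.\<close>

definition alg_independent :: "'w set \<Rightarrow> ('i \<Rightarrow> 'w \<Rightarrow> complex) \<Rightarrow> 'i set \<Rightarrow> bool" where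
  "alg_independent \<Omega> u B \<longleftrightarrow>
     (\<forall>P\<in>poly_funs B. (\<forall>w\<in>\<Omega>. P (\<lambda>i. u i w) = 0) \<longrightarrow> (\<forall>x. P x = 0))"

lemma alg_independent_mono: "alg_independent \<Omega> u B \<Longrightarrow> A \<subseteq> B \<Longrightarrow> alg_independent \<Omega> u A"
  unfolding alg_independent_def using poly_funs_mono by blast

lemma alg_independentI:
  assumes "\<And>P x. P \<in> poly_funs B \<Longrightarrow> (\<And>w. w \<in> \<Omega> \<Longrightarrow> P (\<lambda>i. u i w) = 0) \<Longrightarrow> P x = 0"
  shows "alg_independent \<Omega> u B"
  unfolding alg_independent_def
proof (intro ballI impI allI)
  fix P x assume "P \<in> poly_funs B" "\<forall>w\<in>\<Omega>. P (\<lambda>i. u i w) = 0"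
  then show "P x = 0" using assms[of P x] by simp
qed

lemma alg_independentD:
  assumes "alg_independent \<Omega> u B" "P \<in> poly_funs B" "\<And>w. w \<in> \<Omega> \<Longrightarrow> P (\<lambda>i. u i w) = 0"
  shows "P x = 0"
  using bspec[OF assms(1)[unfolded alg_independent_def] assms(2)] assms(3) by simp

lemma alg_independent_mono_set:
  assumes "alg_independent X u J" "X \<subseteq> Y"
  shows "alg_independent Y u J"
proof (rule alg_independentI)
  fix P x assume P: "P \<in> poly_funs J" "\<And>w. w \<in> Y \<Longrightarrow> P (\<lambda>i. u i w) = 0"
  show "P x = 0" by (rule alg_independentD[OF assms(1) P(1)]) (use P(2) assms(2) in auto)
qed

lemma alg_independent_empty:
  fixes u :: "'i \<Rightarrow> 'w \<Rightarrow> complex"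
  assumes "\<Omega> \<noteq> {}"
  shows "alg_independent \<Omega> u {}"
  unfolding alg_independent_def
proof (intro ballI impI allI)
  fix P :: "('i \<Rightarrow> complex) \<Rightarrow> complex" and x
  assume P: "P \<in> poly_funs {}" "\<forall>w\<in>\<Omega>. P (\<lambda>i. u i w) = 0"
  obtain w where "w \<in> \<Omega>" using assms by auto
  with P poly_funs_cong[OF P(1), of x "\<lambda>i. u i w"] show "P x = 0" by auto
qed

lemma alg_independent_reindex:
  assumes "inj_on h J" "\<And>j w. j \<in> J \<Longrightarrow> w \<in> \<Omega> \<Longrightarrow> u (h j) w = v j w" "alg_independent \<Omega> v J"
  shows "alg_independent \<Omega> u (h ` J)"
proof (rule alg_independentI)
  fix P x assume P: "P \<in> poly_funs (h ` J)" "\<And>w. w \<in> \<Omega> \<Longrightarrow> P (\<lambda>i. u i w) = 0"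
  define P' where "P' y = P (\<lambda>s. y (inv_into J h s))" for y
  have "(\<lambda>y. P (\<lambda>s. y (inv_into J h s))) \<in> poly_funs J"
    by (rule poly_funs_subst[OF P(1)]) (auto intro!: poly_funs.coord simp: inv_into_f_f[OF assms(1)])
  then have P': "P' \<in> poly_funs J" by (simp add: P'_def[abs_def])
  have "P' (\<lambda>j. x (h j)) = 0"
  proof (rule alg_independentD[OF assms(3) P'])
    fix w assume w: "w \<in> \<Omega>"
    have "P' (\<lambda>j. v j w) = P (\<lambda>i. u i w)" unfolding P'_def
      using assms(2) w by (intro poly_funs_cong[OF P(1)]) (auto simp: inv_into_f_f[OF assms(1)])
    then show "P' (\<lambda>j. v j w) = 0" using P(2)[OF w] by simp
  qed
  moreover have "P' (\<lambda>j. x (h j)) = P x" unfolding P'_def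
    by (intro poly_funs_cong[OF P(1)]) (auto simp: inv_into_f_f[OF assms(1)])
  ultimately show "P x = 0" by simp
qed

text \<open>The relation may be trivial on a part of \<open>\<Omega>\<close>; its leading coefficient is only required to be
  nonzero somewhere, which on an irreducible set means nonzero in the ring of functions.\<close>

definition algebraic_over :: "'w set \<Rightarrow> ('w \<Rightarrow> complex) set \<Rightarrow> ('w \<Rightarrow> complex) \<Rightarrow> bool" where
  "algebraic_over \<Omega> U f \<longleftrightarrow> (\<exists>e\<ge>1. \<exists>C. (\<forall>m\<le>e. C m \<in> generated U) \<and> (\<exists>w\<in>\<Omega>. C e w \<noteq> 0) \<and>
      (\<forall>w\<in>\<Omega>. (\<Sum>m\<le>e. C m w * f w ^ m) = 0))"

lemma algebraic_over_mono: "algebraic_over \<Omega> U f \<Longrightarrow> U \<subseteq> U' \<Longrightarrow> algebraic_over \<Omega> U' f"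
  unfolding algebraic_over_def using subsetD[OF generated_mono, of U U'] by blast

text \<open>The relation is the linear one, \<open>b f - a = 0\<close>.\<close>

lemma algebraic_over_quotient:
  assumes "a \<in> generated U" "b \<in> generated U" "w0 \<in> \<Omega>" "b w0 \<noteq> 0" "\<And>w. w \<in> \<Omega> \<Longrightarrow> b w * f w = a w"
  shows "algebraic_over \<Omega> U f"
  unfolding algebraic_over_def
proof (intro exI conjI)
  let ?C = "\<lambda>m::nat. if m = 0 then (\<lambda>w. - 1 * a w) else b"
  show "\<forall>m\<le>1. ?C m \<in> generated U"
    using assms generated_mult[OF generated_const[of "-1"] assms(1)] by auto
  show "\<exists>w\<in>\<Omega>. ?C 1 w \<noteq> 0" using assms by auto
  show "\<forall>w\<in>\<Omega>. (\<Sum>m\<le>1. ?C m w * f w ^ m) = 0" using assms by simp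
qed simp

lemma algebraic_over_generated:
  assumes "\<Omega> \<noteq> {}" "g \<in> generated U" "\<And>w. w \<in> \<Omega> \<Longrightarrow> f w = g w"
  shows "algebraic_over \<Omega> U f"
proof -
  obtain w0 where "w0 \<in> \<Omega>" using assms(1) by auto
  then show ?thesis
    by (intro algebraic_over_quotient[OF assms(2) generated_const[of 1], of w0]) (auto simp: assms(3))
qed

text \<open>Expand the relation in powers of \<open>u i\<close>. Its leading coefficient is a nonzero polynomial in the
  independent functions, so it does not vanish identically on \<open>\<Omega>\<close>; for the same reason the degree in
  \<open>u i\<close> is positive.\<close>

lemma dependent_imp_algebraic_over:
  assumes "alg_independent \<Omega> u J" "\<not> alg_independent \<Omega> u (insert i J)"
  shows "algebraic_over \<Omega> (u ` J) (u i)"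
proof -
  from assms(2) obtain P where P: "P \<in> poly_funs (insert i J)" "\<And>w. w \<in> \<Omega> \<Longrightarrow> P (\<lambda>i. u i w) = 0"
    and nz: "\<not> (\<forall>x. P x = 0)" unfolding alg_independent_def by auto
  obtain q n where
    q: "\<And>m. (\<lambda>x. coeff (q x) m) \<in> poly_funs J" "\<And>x. degree (q x) \<le> n"
       "\<And>x. P x = poly (q x) (x i)" by (rule poly_funs_expand[OF P(1)]) rule
  \<comment> \<open>the degree in \<open>u i\<close> as a polynomial; the degree at a single point may be smaller\<close>
  define e where "e = Max {m. m \<le> n \<and> (\<exists>x. coeff (q x) m \<noteq> 0)}"
  let ?M = "{m. m \<le> n \<and> (\<exists>x. coeff (q x) m \<noteq> 0)}"
  have fin: "finite ?M" by simp
  from nz obtain x where "P x \<noteq> 0" by auto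
  then have "q x \<noteq> 0" using q(3)[of x] by auto
  then have "degree (q x) \<in> ?M" using q(2) leading_coeff_0_iff by blast
  then have "?M \<noteq> {}" by blast
  from Max_in[OF fin this] have e: "e \<le> n" "\<exists>x. coeff (q x) e \<noteq> 0" by (auto simp: e_def)
  have deg: "degree (q x) \<le> e" for x
  proof (rule degree_le, intro allI impI)
    fix m assume "m > e"
    show "coeff (q x) m = 0"
    proof (rule ccontr)
      assume *: "coeff (q x) m \<noteq> 0"
      then have "m \<le> degree (q x)" by (rule le_degree)
      then have "m \<in> ?M" using * q(2)[of x] by auto
      then have "m \<le> e" unfolding e_def by (intro Max_ge[OF fin])
      then show False using \<open>m > e\<close> by simp
    qed
  qed
  have rep: "P x = (\<Sum>m\<le>e. coeff (q x) m * x i ^ m)" for x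
  proof -
    have "(\<Sum>m\<le>e. coeff (q x) m * x i ^ m) = (\<Sum>m\<le>degree (q x). coeff (q x) m * x i ^ m)"
      using deg[of x] by (intro sum.mono_neutral_right) (auto simp: coeff_eq_0)
    then show ?thesis by (simp add: q(3) poly_altdef)
  qed
  let ?C = "\<lambda>m w. coeff (q (\<lambda>i. u i w)) m"
  have ex: "\<exists>w\<in>\<Omega>. ?C e w \<noteq> 0"
  proof (rule ccontr)
    assume "\<not> ?thesis"
    then have "\<forall>x. coeff (q x) e = 0"
      using bspec[OF assms(1)[unfolded alg_independent_def] q(1)[of e]] by simp
    with e(2) show False by simp
  qed
  have "e \<noteq> 0"
  proof
    assume "e = 0"
    then have "?C e w = 0" if "w \<in> \<Omega>" for w using P(2)[OF that] rep by simp
    with ex show False by auto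
  qed
  moreover have "?C m \<in> generated (u ` J)" for m by (rule generated_poly_funs[OF q(1)])
  ultimately show ?thesis unfolding algebraic_over_def
    by (intro exI[of _ e] conjI exI[of _ ?C]) (use ex P(2) rep in auto)
qed

section \<open>Spans of functions\<close>

interpretation cfun: vector_space "\<lambda>(c::complex) (f :: 'w \<Rightarrow> complex) w. c * f w"
  by unfold_locales (auto simp: fun_eq_iff algebra_simps)

lemma span_mult_fun:
  assumes "f \<in> cfun.span X" "\<And>x. x \<in> X \<Longrightarrow> (\<lambda>w. g w * x w) \<in> cfun.span Y"
  shows "(\<lambda>w. g w * f w) \<in> cfun.span Y"
proof (rule cfun.span_induct[OF assms(1), where P = "\<lambda>f. (\<lambda>w. g w * f w) \<in> cfun.span Y"])
  show "cfun.subspace {f. (\<lambda>w. g w * f w) \<in> cfun.span Y}"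
  proof (rule cfun.subspaceI)
    show "0 \<in> {f. (\<lambda>w. g w * f w) \<in> cfun.span Y}"
      using cfun.span_zero by (simp add: zero_fun_def)
  next
    fix x y assume "x \<in> {f. (\<lambda>w. g w * f w) \<in> cfun.span Y}" "y \<in> {f. (\<lambda>w. g w * f w) \<in> cfun.span Y}"
    then have "(\<lambda>w. g w * x w) + (\<lambda>w. g w * y w) \<in> cfun.span Y"
      by (auto intro: cfun.span_add)
    then show "x + y \<in> {f. (\<lambda>w. g w * f w) \<in> cfun.span Y}"
      by (simp add: plus_fun_def algebra_simps)
  next
    fix c x assume "x \<in> {f. (\<lambda>w. g w * f w) \<in> cfun.span Y}"
    then have "(\<lambda>w. c * (g w * x w)) \<in> cfun.span Y" by (auto intro: cfun.span_scale)
    then show "(\<lambda>w. c * x w) \<in> {f. (\<lambda>w. g w * f w) \<in> cfun.span Y}"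
      by (simp add: algebra_simps)
  qed
qed (use assms(2) in auto)

lemma span_add_fun:
  "f \<in> cfun.span X \<Longrightarrow> g \<in> cfun.span X \<Longrightarrow> (\<lambda>w. f w + g w) \<in> cfun.span X"
  using cfun.span_add[of f X g] by (simp add: plus_fun_def)

lemma span_sum_fun:
  assumes "finite A" "\<And>a. a \<in> A \<Longrightarrow> f a \<in> cfun.span X"
  shows "(\<lambda>w. \<Sum>a\<in>A. f a w) \<in> cfun.span X"
  using assms
proof (induction A rule: finite_induct)
  case empty
  then show ?case using cfun.span_zero by (simp add: zero_fun_def)
next
  case (insert a A)
  then show ?case using span_add_fun[of "f a" X "\<lambda>w. \<Sum>a\<in>A. f a w"] by simp
qed

lemma degree_le_imp_span_monom_funs:
  assumes "finite U" "degree_le U n f"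
  shows "f \<in> cfun.span ((\<lambda>\<alpha> w. monom_fun U \<alpha> (\<lambda>v. v w)) ` (U \<rightarrow>\<^sub>E {..n}))"
  using assms(2)
proof (induction rule: degree_le.induct)
  case (const n c)
  have "(\<lambda>w. monom_fun U (\<lambda>v\<in>U. 0) (\<lambda>v. v w)) \<in>
      cfun.span ((\<lambda>\<alpha> w. monom_fun U \<alpha> (\<lambda>v. v w)) ` (U \<rightarrow>\<^sub>E {..n}))"
    by (intro cfun.span_base imageI) auto
  from cfun.span_scale[OF this, of c] show ?case by (simp add: monom_fun_def)
next
  case (add n f g)
  then show ?case by (intro span_add_fun)
next
  case (step u n f)
  show ?case
  proof (rule span_mult_fun[OF step.IH])
    fix x assume "x \<in> (\<lambda>\<alpha> w. monom_fun U \<alpha> (\<lambda>v. v w)) ` (U \<rightarrow>\<^sub>E {..n})"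
    then obtain \<alpha> where \<alpha>: "\<alpha> \<in> U \<rightarrow>\<^sub>E {..n}" and x: "x = (\<lambda>w. monom_fun U \<alpha> (\<lambda>v. v w))" by auto
    have "(\<Prod>v\<in>U - {u}. v w ^ (\<alpha>(u := Suc (\<alpha> u))) v) = (\<Prod>v\<in>U - {u}. v w ^ \<alpha> v)" for w
      by (intro prod.cong) auto
    then have "u w * x w = monom_fun U (\<alpha>(u := Suc (\<alpha> u))) (\<lambda>v. v w)" for w
      unfolding x monom_fun_def
      using prod.remove[OF assms(1) step.hyps(1), of "\<lambda>v. v w ^ \<alpha> v"]
        prod.remove[OF assms(1) step.hyps(1), of "\<lambda>v. v w ^ (\<alpha>(u := Suc (\<alpha> u))) v"] by simp
    moreover have "\<alpha>(u := Suc (\<alpha> u)) \<in> U \<rightarrow>\<^sub>E {..Suc n}"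
      using \<alpha> step.hyps(1) by (auto simp: PiE_iff extensional_def le_SucI)
    ultimately show "(\<lambda>w. u w * x w) \<in> cfun.span ((\<lambda>\<alpha> w. monom_fun U \<alpha> (\<lambda>v. v w)) ` (U \<rightarrow>\<^sub>E {..Suc n}))"
      by (intro cfun.span_base) auto
  qed
qed

text \<open>The library bound for independent sets is transferred to families: independence of the family
  forces it to be injective, so passing to its image loses no vectors.\<close>

lemma family_in_span_card_le:
  fixes h :: "'a \<Rightarrow> 'w \<Rightarrow> complex"
  assumes "finite K" "finite X" "\<And>k. k \<in> K \<Longrightarrow> h k \<in> cfun.span X"
    and indep: "\<And>c. (\<And>w. (\<Sum>k\<in>K. c k * h k w) = 0) \<Longrightarrow> (\<forall>k\<in>K. c k = 0)"
  shows "card K \<le> card X"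
proof -
  have inj: "inj_on h K"
  proof (rule inj_onI, rule ccontr)
    fix a b assume ab: "a \<in> K" "b \<in> K" "h a = h b" "a \<noteq> b"
    let ?c = "\<lambda>k. if k = a then 1 else if k = b then - 1 else (0::complex)"
    have "(\<Sum>k\<in>K. ?c k * h k w) = 0" for w
    proof -
      have "(\<Sum>k\<in>K. ?c k * h k w) = (\<Sum>k\<in>{a,b}. ?c k * h k w)"
        using ab assms(1) by (intro sum.mono_neutral_right) auto
      then show ?thesis using ab by simp
    qed
    from indep[of ?c, OF this] ab show False by auto
  qed
  have "\<not> cfun.dependent (h ` K)"
  proof
    assume "cfun.dependent (h ` K)"
    then obtain v where v: "\<exists>g\<in>h ` K. v g \<noteq> 0" "(\<Sum>g\<in>h ` K. (\<lambda>w. v g * g w)) = 0"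
      using cfun.dependent_finite[of "h ` K"] assms(1) by auto
    have "(\<Sum>k\<in>K. v (h k) * h k w) = 0" for w
    proof -
      have "(\<Sum>k\<in>K. (\<lambda>w. v (h k) * h k w)) = 0"
        using v(2) by (simp add: sum.reindex[OF inj])
      then have "(\<Sum>k\<in>K. (\<lambda>w. v (h k) * h k w)) w = 0" by (simp add: zero_fun_def)
      moreover have "(\<Sum>k\<in>K. (\<lambda>w. v (h k) * h k w)) w = (\<Sum>k\<in>K. v (h k) * h k w)"
        using assms(1) by (induction K rule: finite_induct) (auto simp: zero_fun_def plus_fun_def)
      ultimately show ?thesis by simp
    qed
    from indep[of "\<lambda>k. v (h k)", OF this] v(1) show False by auto
  qed
  from cfun.independent_span_bound[OF assms(2) this] assms(3)
  have "card (h ` K) \<le> card X" by auto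
  then show ?thesis by (simp add: card_image[OF inj])
qed

section \<open>Transcendence degree by counting\<close>

text \<open>The ring of functions \<open>R\<close> has no zero divisors when restricted to \<open>\<Omega>\<close>. For polynomial functions
  this is irreducibility of \<open>\<Omega>\<close>. Comparing functions on \<open>\<Omega>\<close> only takes
  the place of passing to a quotient ring.\<close>

locale function_domain =
  fixes \<Omega> :: "'w set" and R :: "('w \<Rightarrow> complex) set"
  assumes const: "(\<lambda>w. c) \<in> R"
    and add: "f \<in> R \<Longrightarrow> g \<in> R \<Longrightarrow> (\<lambda>w. f w + g w) \<in> R"
    and mult: "f \<in> R \<Longrightarrow> g \<in> R \<Longrightarrow> (\<lambda>w. f w * g w) \<in> R"
    and nonempty: "\<Omega> \<noteq> {}"
    and no_zero_divisors: "f \<in> R \<Longrightarrow> g \<in> R \<Longrightarrow> (\<And>w. w \<in> \<Omega> \<Longrightarrow> f w * g w = 0) \<Longrightarrow>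
      (\<forall>w\<in>\<Omega>. f w = 0) \<or> (\<forall>w\<in>\<Omega>. g w = 0)"
begin

lemma degree_le_in_R: "degree_le U n f \<Longrightarrow> U \<subseteq> R \<Longrightarrow> f \<in> R"
  by (induction rule: degree_le.induct) (auto intro: const add mult)

lemma generated_subset_R: "U \<subseteq> R \<Longrightarrow> generated U \<subseteq> R"
  unfolding generated_def using degree_le_in_R by blast

lemma poly_funs_in_R: "P \<in> poly_funs B \<Longrightarrow> u ` B \<subseteq> R \<Longrightarrow> (\<lambda>w. P (\<lambda>i. u i w)) \<in> R"
  using generated_poly_funs generated_subset_R by blast

lemma sum_in_R: "finite A \<Longrightarrow> (\<And>a. a \<in> A \<Longrightarrow> f a \<in> R) \<Longrightarrow> (\<lambda>w. \<Sum>a\<in>A. f a w) \<in> R"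
  by (induction A rule: finite_induct) (auto intro: const add)

lemma power: "f \<in> R \<Longrightarrow> (\<lambda>w. f w ^ n) \<in> R"
  by (induction n) (auto intro: const mult)

lemma power_nonzero: "f \<in> R \<Longrightarrow> \<exists>w\<in>\<Omega>. f w \<noteq> 0 \<Longrightarrow> \<exists>w\<in>\<Omega>. f w ^ n \<noteq> 0"
  by auto

lemma mult_nonzero:
  "f \<in> R \<Longrightarrow> g \<in> R \<Longrightarrow> \<exists>w\<in>\<Omega>. f w \<noteq> 0 \<Longrightarrow> \<exists>w\<in>\<Omega>. g w \<noteq> 0 \<Longrightarrow> \<exists>w\<in>\<Omega>. f w * g w \<noteq> 0"
  using no_zero_divisors by blast

lemma common_nonzero:
  assumes "finite B" "\<And>b. b \<in> B \<Longrightarrow> f b \<in> R \<and> (\<exists>w\<in>\<Omega>. f b w \<noteq> 0)"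
  obtains w where "w \<in> \<Omega>" "\<And>b. b \<in> B \<Longrightarrow> f b w \<noteq> 0"
proof -
  have "(\<lambda>w. \<Prod>b\<in>B. f b w) \<in> R \<and> (\<exists>w\<in>\<Omega>. (\<Prod>b\<in>B. f b w) \<noteq> 0)"
    using assms
  proof (induction B rule: finite_induct)
    case empty
    then show ?case using nonempty by (auto intro: const)
  next
    case (insert b B)
    then show ?case using mult_nonzero[of "f b" "\<lambda>w. \<Prod>b\<in>B. f b w"] by (auto intro: mult)
  qed
  then show ?thesis using that assms(1) by auto
qed

text \<open>A bound for the Hilbert function: the polynomials of degree at most \<open>n\<close> in \<open>U\<close> lie in a space of
  dimension \<open>O(n\<^sup>a)\<close>, after multiplication by \<open>c\<^sup>n\<close>. The common denominator \<open>c\<close> must not depend on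
  \<open>n\<close>; since there are no zero divisors, multiplication by its powers preserves linear independence.\<close>

definition growth :: "nat \<Rightarrow> ('w \<Rightarrow> complex) set \<Rightarrow> bool" where
  "growth a U \<longleftrightarrow> (\<exists>c\<in>R. (\<exists>w\<in>\<Omega>. c w \<noteq> 0) \<and> (\<exists>E W. \<forall>n. finite (W n) \<and> card (W n) \<le> E * (n + 1) ^ a \<and>
     (\<forall>f. degree_le U n f \<longrightarrow> (\<exists>h\<in>cfun.span (W n). \<forall>w\<in>\<Omega>. c w ^ n * f w = h w))))"

lemma growthE:
  assumes "growth a U"
  obtains c E W where "c \<in> R" "\<exists>w\<in>\<Omega>. c w \<noteq> 0" "\<And>n. finite (W n)" "\<And>n. card (W n) \<le> E * (n + 1) ^ a"
    "\<And>n f. degree_le U n f \<Longrightarrow> \<exists>h\<in>cfun.span (W n). \<forall>w\<in>\<Omega>. c w ^ n * f w = h w"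
  using assms unfolding growth_def by blast

lemma growthI:
  assumes "c \<in> R" "\<exists>w\<in>\<Omega>. c w \<noteq> 0" "\<And>n. finite (W n)" "\<And>n. card (W n) \<le> E * (n + 1) ^ a"
    "\<And>n f. degree_le U n f \<Longrightarrow> \<exists>h\<in>cfun.span (W n). \<forall>w\<in>\<Omega>. c w ^ n * f w = h w"
  shows "growth a U"
  unfolding growth_def
proof (rule bexI[of _ c], intro conjI exI[of _ E] exI[of _ W] allI impI)
  show "\<exists>h\<in>cfun.span (W n). \<forall>w\<in>\<Omega>. c w ^ n * f w = h w" if "degree_le U n f" for n f
    using that by (rule assms(5))
qed (fact assms)+

lemma growth_subset:
  assumes "growth a U" "U' \<subseteq> U"
  shows "growth a U'"
proof -
  obtain c E W where *: "c \<in> R" "\<exists>w\<in>\<Omega>. c w \<noteq> 0" "\<And>n. finite (W n)" "\<And>n. card (W n) \<le> E * (n + 1) ^ a"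
    "\<And>n f. degree_le U n f \<Longrightarrow> \<exists>h\<in>cfun.span (W n). \<forall>w\<in>\<Omega>. c w ^ n * f w = h w"
    by (rule growthE[OF assms(1)]) rule
  show ?thesis
    by (rule growthI[OF *(1-4)]) (auto intro!: *(5) degree_le_subset[OF _ assms(2)])
qed

lemma growth_finite:
  assumes "finite U" "card U \<le> a"
  shows "growth a U"
proof -
  define W where "W n = (\<lambda>\<alpha> w. monom_fun U \<alpha> (\<lambda>v. v w)) ` (U \<rightarrow>\<^sub>E {..n})" for n
  have "card (W n) \<le> 1 * (n + 1) ^ a" for n
  proof -
    have "card (W n) \<le> card (U \<rightarrow>\<^sub>E {..n})"
      unfolding W_def using assms by (intro card_image_le finite_PiE) auto
    also have "\<dots> = (n + 1) ^ card U" using assms(1) by (simp add: card_PiE)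
    also have "\<dots> \<le> (n + 1) ^ a" using assms(2) by (intro power_increasing) auto
    finally show ?thesis by simp
  qed
  moreover have "finite (W n)" for n unfolding W_def using assms by (auto intro: finite_PiE)
  moreover have "\<exists>h\<in>cfun.span (W n). \<forall>w\<in>\<Omega>. 1 ^ n * f w = h w" if "degree_le U n f" for f n
    using degree_le_imp_span_monom_funs[OF assms(1) that] unfolding W_def by auto
  ultimately show ?thesis unfolding growth_def
    using nonempty by (intro bexI[of _ "\<lambda>_. 1"] conjI exI[of _ 1] exI[of _ W] const) auto
qed

text \<open>Division by the relation for \<open>f\<close>, without inverting its leading coefficient: each factor \<open>f\<close> that
  is multiplied on costs one factor \<open>C e\<close>, and replaces \<open>C e f\<^sup>e\<close> by lower powers of \<open>f\<close>. The degrees of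
  the coefficients therefore grow linearly in \<open>n\<close>, which is all that matters for \<^const>\<open>growth\<close>.\<close>

lemma algebraic_over_reduce:
  assumes e: "e \<ge> 1" and C: "\<And>m. m \<le> e \<Longrightarrow> degree_le U D (C m)"
    and rel: "\<And>w. w \<in> \<Omega> \<Longrightarrow> (\<Sum>m\<le>e. C m w * f w ^ m) = 0"
    and h: "degree_le (insert f U) n h"
  shows "\<exists>Q. (\<forall>m<e. degree_le U ((D + 1) * n) (Q m)) \<and>
     (\<forall>w\<in>\<Omega>. C e w ^ n * h w = (\<Sum>m<e. Q m w * f w ^ m))"
  using h
proof (induction rule: degree_le.induct)
  case (const n c)
  define Q where "Q m = (if m = 0 then (\<lambda>w. C e w ^ n * c) else (\<lambda>w. 0))" for m :: nat
  have "degree_le U (D * n + 0) (\<lambda>w. C e w ^ n * c)"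
    by (intro degree_le_mult degree_le_power C degree_le.const) simp
  then have "degree_le U ((D + 1) * n) (Q m)" for m
    by (auto simp: Q_def intro: degree_le.const degree_le_mono)
  moreover have "(\<Sum>m<e. Q m w * f w ^ m) = C e w ^ n * c" for w
  proof -
    have "(\<Sum>m<e. Q m w * f w ^ m) = (\<Sum>m\<in>{0}. Q m w * f w ^ m)"
      using e by (intro sum.mono_neutral_right) (auto simp: Q_def)
    then show ?thesis by (simp add: Q_def)
  qed
  ultimately show ?case by (intro exI[of _ Q]) auto
next
  case (add n g h)
  then obtain Q Q' where Q: "\<forall>m<e. degree_le U ((D + 1) * n) (Q m)"
      "\<forall>w\<in>\<Omega>. C e w ^ n * g w = (\<Sum>m<e. Q m w * f w ^ m)"
      "\<forall>m<e. degree_le U ((D + 1) * n) (Q' m)"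
      "\<forall>w\<in>\<Omega>. C e w ^ n * h w = (\<Sum>m<e. Q' m w * f w ^ m)" by blast
  then show ?case
    by (intro exI[of _ "\<lambda>m w. Q m w + Q' m w"])
      (auto simp: ring_distribs sum.distrib intro: degree_le.add)
next
  case (step u n h)
  then obtain Q where Q: "\<And>m. m < e \<Longrightarrow> degree_le U ((D + 1) * n) (Q m)"
      "\<And>w. w \<in> \<Omega> \<Longrightarrow> C e w ^ n * h w = (\<Sum>m<e. Q m w * f w ^ m)" by blast
  show ?case
  proof (cases "u \<in> U")
    case True
    define Q' where "Q' m = (\<lambda>w. C e w * (u w * Q m w))" for m
    have "degree_le U (D + (1 + (D + 1) * n)) (Q' m)" if "m < e" for m
      unfolding Q'_def using that True by (intro degree_le_mult C degree_le_gen Q(1)) auto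
    moreover have "D + (1 + (D + 1) * n) = (D + 1) * Suc n" by simp
    moreover have "C e w ^ Suc n * (u w * h w) = (\<Sum>m<e. Q' m w * f w ^ m)" if "w \<in> \<Omega>" for w
    proof -
      have "C e w ^ Suc n * (u w * h w) = C e w * u w * (C e w ^ n * h w)" by (simp add: mult_ac)
      also have "\<dots> = (\<Sum>m<e. Q' m w * f w ^ m)"
        unfolding Q(2)[OF that] Q'_def by (simp add: sum_distrib_left mult_ac)
      finally show ?thesis .
    qed
    ultimately show ?thesis by (intro exI[of _ Q']) auto
  next
    case False
    with step.hyps have u: "u = f" by simp
    obtain e' where e': "e = Suc e'" using e by (cases e) auto
    \<comment> \<open>multiplication by \<open>f\<close> shifts the coefficients; the overflow \<open>Q e' f\<^sup>e\<close> is replaced by lower powers\<close>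
    define Q' where "Q' m = (\<lambda>w. (if m = 0 then 0 else C e w * Q (m - 1) w) + - (Q e' w * C m w))" for m
    have "degree_le U ((D + 1) * Suc n) (Q' m)" if "m < e" for m
    proof -
      have *: "degree_le U (D + (D + 1) * n) (\<lambda>w. C e w * Q (m - 1) w)"
        using that by (intro degree_le_mult C Q(1)) auto
      have "degree_le U ((D + 1) * n + D) (\<lambda>w. - (Q e' w * C m w))"
        using that by (intro degree_le_minus degree_le_mult C Q(1)) (auto simp: e')
      then have "degree_le U ((D + 1) * Suc n) (\<lambda>w. - (Q e' w * C m w))"
        by (rule degree_le_mono) simp
      moreover from * have "degree_le U ((D + 1) * Suc n) (\<lambda>w. if m = 0 then 0 else C e w * Q (m - 1) w)"
        by (cases "m = 0") (auto intro: degree_le.const degree_le_mono)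
      ultimately show ?thesis unfolding Q'_def by (intro degree_le.add)
    qed
    moreover have "C e w ^ Suc n * (u w * h w) = (\<Sum>m<e. Q' m w * f w ^ m)" if w: "w \<in> \<Omega>" for w
    proof -
      have top: "C e w * f w ^ e = - (\<Sum>m<e. C m w * f w ^ m)"
        using rel[OF w] unfolding lessThan_Suc_atMost[symmetric] by (simp add: eq_neg_iff_add_eq_0 add.commute)
      have "C e w ^ Suc n * (u w * h w) = C e w * f w * (C e w ^ n * h w)" by (simp add: mult_ac u)
      also have "\<dots> = (\<Sum>m<e. C e w * Q m w * f w ^ Suc m)"
        unfolding Q(2)[OF w] by (simp add: sum_distrib_left mult_ac)
      also have "\<dots> = (\<Sum>m<e'. C e w * Q m w * f w ^ Suc m) + Q e' w * (C e w * f w ^ e)"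
        unfolding e' by (simp add: mult_ac)
      also have "(\<Sum>m<e'. C e w * Q m w * f w ^ Suc m) =
          (\<Sum>m<e. (if m = 0 then 0 else C e w * Q (m - 1) w) * f w ^ m)"
        unfolding e' by (subst sum.lessThan_Suc_shift) simp
      also have "Q e' w * (C e w * f w ^ e) = (\<Sum>m<e. - (Q e' w * C m w) * f w ^ m)"
        unfolding top by (simp add: sum_distrib_left sum_negf mult_ac)
      also have "(\<Sum>m<e. (if m = 0 then 0 else C e w * Q (m - 1) w) * f w ^ m) + \<dots> =
          (\<Sum>m<e. Q' m w * f w ^ m)"
        unfolding Q'_def by (simp only: sum.distrib[symmetric] ring_distribs)
      finally show ?thesis .
    qed
    ultimately show ?thesis by (intro exI[of _ Q']) auto
  qed
qed

text \<open>The new spaces are spanned by the products of \<open>1, f, \<dots>, f\<^bsup>e-1\<^esup>\<close> with the old space for degree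
  \<open>(D + 1) n\<close>. Their dimension changes by a constant factor only, so the exponent \<open>a\<close> is kept.\<close>

lemma growth_insert_algebraic:
  assumes "growth a U" "U \<subseteq> R" "algebraic_over \<Omega> U f"
  shows "growth a (insert f U)"
proof -
  from assms(3) obtain e C where e: "e \<ge> 1" and C: "\<And>m. m \<le> e \<Longrightarrow> C m \<in> generated U"
    and nz: "\<exists>w\<in>\<Omega>. C e w \<noteq> 0" and rel: "\<And>w. w \<in> \<Omega> \<Longrightarrow> (\<Sum>m\<le>e. C m w * f w ^ m) = 0"
    unfolding algebraic_over_def by blast
  from C have "\<forall>m\<in>{..e}. \<exists>n. degree_le U n (C m)" unfolding generated_def by blast
  from bchoice[OF this] obtain N where N: "\<forall>m\<in>{..e}. degree_le U (N m) (C m)" by blast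
  define D where "D = Max (N ` {..e})"
  have D: "degree_le U D (C m)" if "m \<le> e" for m
  proof (rule degree_le_mono)
    show "degree_le U (N m) (C m)" using N that by auto
    show "N m \<le> D" unfolding D_def using that by (intro Max_ge) auto
  qed
  obtain c E W where c: "c \<in> R" "\<exists>w\<in>\<Omega>. c w \<noteq> 0"
    and W: "\<And>n. finite (W n)" "\<And>n. card (W n) \<le> E * (n + 1) ^ a"
    and sp: "\<And>n f. degree_le U n f \<Longrightarrow> \<exists>h\<in>cfun.span (W n). \<forall>w\<in>\<Omega>. c w ^ n * f w = h w"
    by (rule growthE[OF assms(1)]) rule
  \<comment> \<open>one factor \<open>C e\<close> per degree for the reduction, and \<open>D + 1\<close> factors \<open>c\<close> since the coefficients
    that it produces have degree \<open>(D + 1) n\<close>\<close>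
  define c' where "c' = (\<lambda>w. C e w * c w ^ (D + 1))"
  define W' where "W' n = (\<lambda>(m, x). (\<lambda>w. f w ^ m * x w)) ` ({..<e} \<times> W ((D + 1) * n))" for n
  have CeR: "C e \<in> R" using C[of e] generated_subset_R[OF assms(2)] by auto
  have "c' \<in> R" unfolding c'_def by (intro mult power CeR c)
  moreover have "\<exists>w\<in>\<Omega>. c' w \<noteq> 0"
    unfolding c'_def by (intro mult_nonzero power CeR c power_nonzero nz)
  moreover have "finite (W' n)" for n unfolding W'_def using W by auto
  moreover have "card (W' n) \<le> (e * E * (D + 1) ^ a) * (n + 1) ^ a" for n
  proof -
    have "card (W' n) \<le> card ({..<e} \<times> W ((D + 1) * n))"
      unfolding W'_def using W by (intro card_image_le) auto
    also have "\<dots> = e * card (W ((D + 1) * n))" by (simp add: card_cartesian_product)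
    also have "\<dots> \<le> e * (E * ((D + 1) * n + 1) ^ a)" by (intro mult_left_mono W) auto
    also have "\<dots> \<le> e * (E * ((D + 1) * (n + 1)) ^ a)" by (intro mult_left_mono power_mono) auto
    also have "\<dots> = (e * E * (D + 1) ^ a) * (n + 1) ^ a" by (simp only: power_mult_distrib mult_ac)
    finally show ?thesis .
  qed
  moreover have "\<exists>k\<in>cfun.span (W' n). \<forall>w\<in>\<Omega>. c' w ^ n * h w = k w" if h: "degree_le (insert f U) n h" for n h
  proof -
    obtain Q where Q: "\<And>m. m < e \<Longrightarrow> degree_le U ((D + 1) * n) (Q m)"
      "\<And>w. w \<in> \<Omega> \<Longrightarrow> C e w ^ n * h w = (\<Sum>m<e. Q m w * f w ^ m)"
      using algebraic_over_reduce[OF e D rel h] by blast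
    from Q(1) sp have "\<forall>m\<in>{..<e}. \<exists>k. k \<in> cfun.span (W ((D + 1) * n)) \<and>
        (\<forall>w\<in>\<Omega>. c w ^ ((D + 1) * n) * Q m w = k w)" by blast
    from bchoice[OF this] obtain k where k: "\<And>m. m < e \<Longrightarrow> k m \<in> cfun.span (W ((D + 1) * n))"
      "\<And>m w. m < e \<Longrightarrow> w \<in> \<Omega> \<Longrightarrow> c w ^ ((D + 1) * n) * Q m w = k m w" by blast
    have "(\<lambda>w. \<Sum>m<e. f w ^ m * k m w) \<in> cfun.span (W' n)"
    proof (intro span_sum_fun)
      fix m assume m: "m \<in> {..<e}"
      show "(\<lambda>w. f w ^ m * k m w) \<in> cfun.span (W' n)"
      proof (rule span_mult_fun[OF k(1)])
        fix x assume "x \<in> W ((D + 1) * n)"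
        with m show "(\<lambda>w. f w ^ m * x w) \<in> cfun.span (W' n)"
          unfolding W'_def by (intro cfun.span_base) force
      qed (use m in auto)
    qed simp
    moreover have "c' w ^ n * h w = (\<Sum>m<e. f w ^ m * k m w)" if "w \<in> \<Omega>" for w
    proof -
      have "c' w ^ n * h w = c w ^ ((D + 1) * n) * (C e w ^ n * h w)"
        unfolding c'_def power_mult_distrib power_mult[symmetric] by (simp only: mult_ac)
      also have "\<dots> = (\<Sum>m<e. f w ^ m * (c w ^ ((D + 1) * n) * Q m w))"
        unfolding Q(2)[OF that] sum_distrib_left by (intro sum.cong) (simp_all only: mult_ac)
      also have "\<dots> = (\<Sum>m<e. f w ^ m * k m w)"
        using k(2) that by (intro sum.cong) auto
      finally show ?thesis .
    qed
    ultimately show ?thesis by (intro bexI[of _ "\<lambda>w. \<Sum>m<e. f w ^ m * k m w"]) auto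
  qed
  ultimately show ?thesis by (intro growthI[of c' W' "e * E * (D + 1) ^ a"])
qed

lemma growth_algebraic:
  assumes "finite B" "growth a U" "U \<subseteq> R" "B \<subseteq> R" "\<And>f. f \<in> B \<Longrightarrow> algebraic_over \<Omega> U f"
  shows "growth a (U \<union> B)"
  using assms(1,4,5)
proof (induction B rule: finite_induct)
  case empty
  then show ?case using assms(2) by simp
next
  case (insert f B)
  have "growth a (insert f (U \<union> B))"
    using insert assms(3) algebraic_over_mono[of \<Omega> U f "U \<union> B"] by (intro growth_insert_algebraic) auto
  then show ?case by simp
qed

text \<open>The monomials with exponents at most \<open>N\<close> in \<open>b\<close> independent functions give \<open>(N + 1)\<^sup>b\<close> linearly
  independent functions of degree at most \<open>b N\<close>. If \<open>b > a\<close>, this exceeds the bound \<open>O(N\<^sup>a)\<close> for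
  large \<open>N\<close>.\<close>

lemma growth_independent_card_le:
  assumes gr: "growth a U" and fin: "finite B" and u: "u ` B \<subseteq> U" "U \<subseteq> R" and ind: "alg_independent \<Omega> u B"
  shows "card B \<le> a"
proof (rule ccontr)
  assume "\<not> card B \<le> a"
  then have b: "a + 1 \<le> card B" by simp
  obtain c E W where c: "c \<in> R" "\<exists>w\<in>\<Omega>. c w \<noteq> 0"
    and W: "\<And>n. finite (W n)" "\<And>n. card (W n) \<le> E * (n + 1) ^ a"
    and sp: "\<And>n f. degree_le U n f \<Longrightarrow> \<exists>h\<in>cfun.span (W n). \<forall>w\<in>\<Omega>. c w ^ n * f w = h w"
    by (rule growthE[OF gr]) rule
  have key: "(N + 1) ^ card B \<le> E * (card B * N + 1) ^ a" for N
  proof -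
    let ?K = "B \<rightarrow>\<^sub>E {..N}" and ?n = "card B * N"
    have "\<forall>\<alpha>\<in>?K. \<exists>h. h \<in> cfun.span (W ?n) \<and> (\<forall>w\<in>\<Omega>. c w ^ ?n * monom_fun B \<alpha> (\<lambda>i. u i w) = h w)"
      using sp degree_le_monom_fun[OF fin u(1)] by blast
    from bchoice[OF this] obtain h where h: "\<And>\<alpha>. \<alpha> \<in> ?K \<Longrightarrow> h \<alpha> \<in> cfun.span (W ?n)"
      "\<And>\<alpha> w. \<alpha> \<in> ?K \<Longrightarrow> w \<in> \<Omega> \<Longrightarrow> c w ^ ?n * monom_fun B \<alpha> (\<lambda>i. u i w) = h \<alpha> w" by blast
    have "card ?K \<le> card (W ?n)"
    proof (rule family_in_span_card_le[of _ _ h])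
      fix \<gamma> assume \<gamma>: "\<And>w. (\<Sum>\<alpha>\<in>?K. \<gamma> \<alpha> * h \<alpha> w) = 0"
      define P where "P x = (\<Sum>\<alpha>\<in>?K. \<gamma> \<alpha> * monom_fun B \<alpha> x)" for x
      have "(\<lambda>x. x i ^ n) \<in> poly_funs B" if "i \<in> B" for i n
        using that by (induction n) (auto intro: poly_funs.intros)
      then have "monom_fun B \<alpha> \<in> poly_funs B" for \<alpha>
        unfolding monom_fun_def by (intro poly_funs_prod fin)
      then have P: "P \<in> poly_funs B"
        unfolding P_def by (intro poly_funs_sum poly_funs.mult poly_funs.const finite_PiE fin) auto
      have "c w ^ ?n * P (\<lambda>i. u i w) = 0" if "w \<in> \<Omega>" for w
      proof -
        have "c w ^ ?n * P (\<lambda>i. u i w) = (\<Sum>\<alpha>\<in>?K. \<gamma> \<alpha> * (c w ^ ?n * monom_fun B \<alpha> (\<lambda>i. u i w)))"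
          unfolding P_def by (simp only: sum_distrib_left mult_ac)
        also have "\<dots> = (\<Sum>\<alpha>\<in>?K. \<gamma> \<alpha> * h \<alpha> w)"
          using h(2) that by (intro sum.cong) auto
        finally show ?thesis using \<gamma> by simp
      qed
      moreover have "\<exists>w\<in>\<Omega>. c w ^ ?n \<noteq> 0" by (intro power_nonzero c)
      ultimately have "\<forall>w\<in>\<Omega>. P (\<lambda>i. u i w) = 0"
        using no_zero_divisors[OF power[OF c(1)] poly_funs_in_R[OF P, of u]] u by blast
      with ind P have "P x = 0" for x unfolding alg_independent_def by blast
      then show "\<forall>\<alpha>\<in>?K. \<gamma> \<alpha> = 0"
        using monom_funs_independent[OF fin, of \<gamma> N] unfolding P_def by blast
    qed (use fin W h in \<open>auto intro: finite_PiE\<close>)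
    also have "\<dots> \<le> E * (?n + 1) ^ a" by (rule W)
    finally show ?thesis using fin by (simp add: card_PiE)
  qed
  define M where "M = E * (card B + 1) ^ a"
  have "(N + 1) * (N + 1) ^ a \<le> M * (N + 1) ^ a" for N
  proof -
    have "(N + 1) * (N + 1) ^ a = (N + 1) ^ (a + 1)" by simp
    also have "\<dots> \<le> (N + 1) ^ card B" using b by (intro power_increasing) auto
    also have "\<dots> \<le> E * (card B * N + 1) ^ a" by (rule key)
    also have "\<dots> \<le> E * ((card B + 1) * (N + 1)) ^ a" by (intro mult_left_mono power_mono) auto
    also have "\<dots> = M * (N + 1) ^ a" unfolding M_def by (simp only: power_mult_distrib mult_ac)
    finally show ?thesis .
  qed
  from this[of M] show False by simp
qed

lemma max_independent_growth:
  assumes fin: "finite I" and J: "J \<subseteq> I" "alg_independent \<Omega> u J"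
    and max: "\<And>i. i \<in> I - J \<Longrightarrow> \<not> alg_independent \<Omega> u (insert i J)" and u: "u ` I \<subseteq> R"
  shows "growth (card J) (u ` I)"
proof -
  have finJ: "finite J" using fin J finite_subset by blast
  have "growth (card J) (u ` J \<union> u ` (I - J))"
  proof (rule growth_algebraic)
    show "growth (card J) (u ` J)" using finJ by (intro growth_finite card_image_le) auto
    fix f assume "f \<in> u ` (I - J)"
    then show "algebraic_over \<Omega> (u ` J) f"
      using dependent_imp_algebraic_over[OF J(2)] max by blast
  qed (use fin u J in auto)
  then show ?thesis by (rule growth_subset) auto
qed

lemma extend_independent:
  assumes "finite I" "J \<subseteq> I" "alg_independent \<Omega> u J"
  obtains J' where "J \<subseteq> J'" "J' \<subseteq> I" "alg_independent \<Omega> u J'"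
    "\<And>i. i \<in> I - J' \<Longrightarrow> \<not> alg_independent \<Omega> u (insert i J')"
proof -
  let ?S = "{J'. J \<subseteq> J' \<and> J' \<subseteq> I \<and> alg_independent \<Omega> u J'}"
  have "finite ?S" using assms(1) by simp
  moreover have "J \<in> ?S" using assms by auto
  ultimately have "\<exists>M\<in>?S. J \<subseteq> M \<and> (\<forall>b\<in>?S. M \<subseteq> b \<longrightarrow> M = b)" by (rule finite_has_maximal2)
  then obtain M where M: "M \<in> ?S" "\<forall>b\<in>?S. M \<subseteq> b \<longrightarrow> M = b" by (elim bexE conjE)
  show ?thesis
  proof (rule that[of M])
    fix i assume "i \<in> I - M"
    then show "\<not> alg_independent \<Omega> u (insert i M)" using M(1) bspec[OF M(2), of "insert i M"] by auto
  qed (use M in auto)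
qed

end

section \<open>Independent coordinates and chains of irreducible sets\<close>

text \<open>For irreducible \<open>X\<close> this is the transcendence degree of the function field of the closure. The
  definition by coordinates is convenient since it makes sense for every nonempty set and depends on
  the vanishing polynomials alone.\<close>

definition coord_rank :: "'i set \<Rightarrow> ('i \<Rightarrow> complex) set \<Rightarrow> nat" where
  "coord_rank I X = Max (card ` {J. J \<subseteq> I \<and> alg_independent X (\<lambda>i x. x i) J})"

lemma coord_rank_ge: "finite I \<Longrightarrow> J \<subseteq> I \<Longrightarrow> alg_independent X (\<lambda>i x. x i) J \<Longrightarrow> card J \<le> coord_rank I X"
  unfolding coord_rank_def by (intro Max_ge) auto

lemma coord_rank_obtain:
  assumes "finite I" "X \<noteq> {}"
  obtains J where "J \<subseteq> I" "alg_independent X (\<lambda>i x. x i) J" "card J = coord_rank I X"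
proof -
  have "coord_rank I X \<in> card ` {J. J \<subseteq> I \<and> alg_independent X (\<lambda>i x. x i) J}"
    unfolding coord_rank_def
    using assms alg_independent_empty[OF assms(2)] by (intro Max_in) auto
  then show ?thesis using that by auto
qed

lemma coord_rank_mono:
  assumes "finite I" "X \<noteq> {}" "X \<subseteq> Y"
  shows "coord_rank I X \<le> coord_rank I Y"
proof -
  obtain J where J: "J \<subseteq> I" "alg_independent X (\<lambda>i x. x i) J" "card J = coord_rank I X"
    by (rule coord_rank_obtain[OF assms(1,2)])
  from coord_rank_ge[OF assms(1) J(1) alg_independent_mono_set[OF J(2) assms(3)]] J(3)
  show ?thesis by simp
qed

definition param_image :: "'i set \<Rightarrow> ('i \<Rightarrow> 'w \<Rightarrow> complex) \<Rightarrow> 'w set \<Rightarrow> ('i \<Rightarrow> complex) set" where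
  "param_image I \<phi> \<Omega> = (\<lambda>w. \<lambda>i\<in>I. \<phi> i w) ` \<Omega>"

lemma param_image_cspace: "param_image I \<phi> \<Omega> \<subseteq> cspace I"
  by (auto simp: param_image_def cspace_def)

lemma alg_independent_param_image:
  assumes "J \<subseteq> I"
  shows "alg_independent (param_image I \<phi> \<Omega>) (\<lambda>i x. x i) J \<longleftrightarrow> alg_independent \<Omega> \<phi> J"
proof -
  have ev: "P (\<lambda>i\<in>I. \<phi> i w) = P (\<lambda>i. \<phi> i w)" if "P \<in> poly_funs J" for P w
    using assms by (intro poly_funs_cong[OF that]) auto
  show ?thesis unfolding alg_independent_def param_image_def
    by (intro ball_cong refl) (simp add: ev)
qed

lemma (in function_domain) growth_coord_rank:
  assumes "finite I" "\<phi> ` I \<subseteq> R"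
  shows "growth (coord_rank I (param_image I \<phi> \<Omega>)) (\<phi> ` I)"
proof -
  have "param_image I \<phi> \<Omega> \<noteq> {}" using nonempty by (simp add: param_image_def)
  then obtain J where J: "J \<subseteq> I" "alg_independent (param_image I \<phi> \<Omega>) (\<lambda>i x. x i) J"
    "card J = coord_rank I (param_image I \<phi> \<Omega>)" by (rule coord_rank_obtain[OF assms(1)])
  have J': "alg_independent \<Omega> \<phi> J" using J(2) alg_independent_param_image[OF J(1)] by auto
  have "growth (card J) (\<phi> ` I)"
  proof (rule max_independent_growth[OF assms(1) J(1) J' _ assms(2)])
    fix i assume i: "i \<in> I - J"
    show "\<not> alg_independent \<Omega> \<phi> (insert i J)"
    proof
      assume "alg_independent \<Omega> \<phi> (insert i J)"
      then have "card (insert i J) \<le> coord_rank I (param_image I \<phi> \<Omega>)"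
        using i J(1) by (intro coord_rank_ge assms) (auto simp: alg_independent_param_image)
      with i J(3) show False using finite_subset[OF J(1) assms(1)] by simp
    qed
  qed
  with J(3) show ?thesis by simp
qed

lemma vanishes_on_zariski_closure:
  assumes "X \<subseteq> cspace I" "P \<in> poly_funs I" "\<And>x. x \<in> X \<Longrightarrow> P x = 0" "x \<in> zariski I closure_of X"
  shows "P x = 0"
proof -
  have "closedin (zariski I) (zero_locus I {P})"
    unfolding closedin_zariski using assms(2) by auto
  moreover have "X \<subseteq> zero_locus I {P}" using assms unfolding zero_locus_def by auto
  ultimately have "zariski I closure_of X \<subseteq> zero_locus I {P}" by (intro closure_of_minimal)
  with assms(4) show ?thesis unfolding zero_locus_def by auto
qed

lemma alg_independent_closure:
  assumes "X \<subseteq> cspace I" "J \<subseteq> I" "alg_independent (zariski I closure_of X) (\<lambda>i x. x i) J"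
  shows "alg_independent X (\<lambda>i x. x i) J"
  unfolding alg_independent_def
proof (intro ballI impI)
  fix P :: "('a \<Rightarrow> complex) \<Rightarrow> complex" assume P: "P \<in> poly_funs J" "\<forall>w\<in>X. P (\<lambda>i. w i) = 0"
  have "P x = 0" if "x \<in> zariski I closure_of X" for x
    using vanishes_on_zariski_closure[OF assms(1) poly_funs_mono[OF P(1) assms(2)] _ that] P(2) by simp
  with assms(3) P(1) show "\<forall>x. P x = 0" unfolding alg_independent_def by simp
qed

lemma coord_rank_closure:
  assumes "finite I" "X \<subseteq> cspace I" "X \<noteq> {}"
  shows "coord_rank I (zariski I closure_of X) = coord_rank I X"
proof (rule antisym)
  have sub: "X \<subseteq> zariski I closure_of X" using assms(2) by (intro closure_of_subset) simp
  show "coord_rank I X \<le> coord_rank I (zariski I closure_of X)"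
    by (rule coord_rank_mono[OF assms(1,3) sub])
  have "zariski I closure_of X \<noteq> {}" using sub assms(3) by auto
  then obtain J where J: "J \<subseteq> I" "alg_independent (zariski I closure_of X) (\<lambda>i x. x i) J"
    "card J = coord_rank I (zariski I closure_of X)" by (rule coord_rank_obtain[OF assms(1)])
  from coord_rank_ge[OF assms(1) J(1) alg_independent_closure[OF assms(2) J(1,2)]] J(3)
  show "coord_rank I (zariski I closure_of X) \<le> coord_rank I X" by simp
qed

lemma irreducible_imp_function_domain:
  assumes "irreducible_in (zariski I) Y"
  shows "function_domain Y (poly_funs I)"
proof
  show "Y \<noteq> {}" using assms by (simp add: irreducible_in_def)
  fix f g assume fg: "f \<in> poly_funs I" "g \<in> poly_funs I" "\<And>w. w \<in> Y \<Longrightarrow> f w * g w = 0"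
  have sub: "Y \<subseteq> cspace I" using assms by (simp add: irreducible_in_def)
  have cl: "closedin (zariski I) (zero_locus I {f})" "closedin (zariski I) (zero_locus I {g})"
    unfolding closedin_zariski using fg by auto
  have "Y \<subseteq> zero_locus I {f} \<union> zero_locus I {g}"
    using sub fg(3) by (auto simp: zero_locus_def)
  with assms cl have "Y \<subseteq> zero_locus I {f} \<or> Y \<subseteq> zero_locus I {g}"
    unfolding irreducible_in_def by blast
  then show "(\<forall>w\<in>Y. f w = 0) \<or> (\<forall>w\<in>Y. g w = 0)" by (auto simp: zero_locus_def)
qed (auto intro: poly_funs.intros)

text \<open>If two closed sets cover the image but neither contains it, then each has an equation that is
  nonzero at some parameter value, while the product of the two equations vanishes for all of them.\<close>

lemma irreducible_closure_param_image:
  assumes "function_domain \<Omega> R" "\<And>i. i \<in> I \<Longrightarrow> \<phi> i \<in> R"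
  shows "irreducible_in (zariski I) (zariski I closure_of (param_image I \<phi> \<Omega>))"
proof -
  interpret function_domain \<Omega> R by fact
  let ?X = "param_image I \<phi> \<Omega>"
  have sub: "?X \<subseteq> zariski I closure_of ?X"
    by (intro closure_of_subset) (simp add: param_image_cspace)
  have ev: "P (\<lambda>i\<in>I. \<phi> i w) = P (\<lambda>i. \<phi> i w)" if "P \<in> poly_funs I" for P w
    by (intro poly_funs_cong[OF that]) auto
  show ?thesis unfolding irreducible_in_def
  proof (intro conjI allI impI)
    show "zariski I closure_of ?X \<subseteq> topspace (zariski I)" by (rule closure_of_subset_topspace)
    show "zariski I closure_of ?X \<noteq> {}" using sub nonempty by (auto simp: param_image_def)
    fix A B assume *: "closedin (zariski I) A \<and> closedin (zariski I) B \<and> zariski I closure_of ?X \<subseteq> A \<union> B"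
    then obtain F G where F: "F \<subseteq> poly_funs I" "A = zero_locus I F"
      and G: "G \<subseteq> poly_funs I" "B = zero_locus I G" unfolding closedin_zariski by auto
    have "?X \<subseteq> A \<or> ?X \<subseteq> B"
    proof (rule ccontr)
      assume "\<not> ?thesis"
      then obtain x y where xy: "x \<in> ?X" "x \<notin> A" "y \<in> ?X" "y \<notin> B" by blast
      with param_image_cspace[of I \<phi> \<Omega>] obtain f g where f: "f \<in> F" "f x \<noteq> 0" and g: "g \<in> G" "g y \<noteq> 0"
        unfolding F G zero_locus_def by blast
      have fg: "f \<in> poly_funs I" "g \<in> poly_funs I" using f g F G by auto
      have R: "(\<lambda>w. f (\<lambda>i. \<phi> i w)) \<in> R" "(\<lambda>w. g (\<lambda>i. \<phi> i w)) \<in> R"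
        using assms(2) by (intro poly_funs_in_R[OF fg(1)] poly_funs_in_R[OF fg(2)]; auto)+
      have "f (\<lambda>i. \<phi> i w) * g (\<lambda>i. \<phi> i w) = 0" if "w \<in> \<Omega>" for w
      proof -
        have "(\<lambda>i\<in>I. \<phi> i w) \<in> A \<union> B" using that sub * by (auto simp: param_image_def)
        then have "f (\<lambda>i\<in>I. \<phi> i w) = 0 \<or> g (\<lambda>i\<in>I. \<phi> i w) = 0"
          using f g by (auto simp: F G zero_locus_def)
        then show ?thesis using ev[OF fg(1), of w] ev[OF fg(2), of w] by auto
      qed
      from no_zero_divisors[OF R this]
      have "(\<forall>w\<in>\<Omega>. f (\<lambda>i. \<phi> i w) = 0) \<or> (\<forall>w\<in>\<Omega>. g (\<lambda>i. \<phi> i w) = 0)" .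
      moreover obtain w w' where "w \<in> \<Omega>"  "x = (\<lambda>i\<in>I. \<phi> i w)" "w' \<in> \<Omega>" "y = (\<lambda>i\<in>I. \<phi> i w')"
        using xy by (auto simp: param_image_def)
      then have "f (\<lambda>i. \<phi> i w) \<noteq> 0" "g (\<lambda>i. \<phi> i w') \<noteq> 0"
        using f g ev[OF fg(1), of w] ev[OF fg(2), of w'] by simp_all
      ultimately show False using \<open>w \<in> \<Omega>\<close> \<open>w' \<in> \<Omega>\<close> by blast
    qed
    then show "zariski I closure_of ?X \<subseteq> A \<or> zariski I closure_of ?X \<subseteq> B"
      using * closure_of_minimal[of ?X A "zariski I"] closure_of_minimal[of ?X B "zariski I"] by auto
  qed
qed

text \<open>In a relation between \<open>f\<close> and the \<open>u i\<close> on \<open>Y'\<close>, consider the lowest power of \<open>f\<close> with a nonzero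
  coefficient. That power can be cancelled on \<open>Y'\<close>; afterwards, restriction to \<open>Y\<close>, where \<open>f\<close>
  vanishes, shows that the coefficient is a relation between the \<open>u i\<close> on \<open>Y\<close>.\<close>

lemma adjoin_vanishing_independent:
  assumes dom: "function_domain Y' R" and u: "u ` J \<subseteq> R" and f: "f \<in> R" "\<exists>w\<in>Y'. f w \<noteq> 0"
    and Y: "Y \<subseteq> Y'" "\<And>w. w \<in> Y \<Longrightarrow> f w = 0" and ind: "alg_independent Y u J"
  shows "alg_independent Y' (case_option f u) (insert None (Some ` J))"
  unfolding alg_independent_def
proof (intro ballI impI allI)
  interpret function_domain Y' R by fact
  let ?u = "case_option f u"
  fix P and x :: "'b option \<Rightarrow> complex"
  assume P: "P \<in> poly_funs (insert None (Some ` J))" "\<forall>w\<in>Y'. P (\<lambda>i. ?u i w) = 0"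
  obtain q n where q: "\<And>m. (\<lambda>x. coeff (q x) m) \<in> poly_funs (Some ` J)" "\<And>x. degree (q x) \<le> n"
      "\<And>x. P x = poly (q x) (x None)" by (rule poly_funs_expand[OF P(1)]) rule
  have uR: "?u ` Some ` J \<subseteq> R" using u by auto
  have "coeff (q x) m = 0" for m x
  proof (induction m arbitrary: x rule: less_induct)
    case (less m)
    let ?G = "\<lambda>j w. coeff (q (\<lambda>i. ?u i w)) j"
    let ?g = "\<lambda>w. \<Sum>j\<le>n. ?G (m + j) w * f w ^ j"
    have "?G j \<in> R" for j by (rule poly_funs_in_R[OF q(1) uR])
    then have gR: "?g \<in> R" by (intro sum_in_R mult power f) auto
    have "f w ^ m * ?g w = 0" if w: "w \<in> Y'" for w
    proof -
      have "0 = poly (q (\<lambda>i. ?u i w)) (f w)" using P(2) w q(3)[of "\<lambda>i. ?u i w"] by simp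
      also have "\<dots> = (\<Sum>j\<le>m + n. ?G j w * f w ^ j)"
        unfolding poly_altdef using q(2)[of "\<lambda>i. ?u i w"]
        by (intro sum.mono_neutral_left) (auto simp: coeff_eq_0)
      also have "\<dots> = (\<Sum>j\<in>{0+m..n+m}. ?G j w * f w ^ j)"
        using less.IH by (intro sum.mono_neutral_right) auto
      also have "\<dots> = (\<Sum>j\<in>{0..n}. ?G (j + m) w * f w ^ (j + m))"
        by (rule sum.shift_bounds_cl_nat_ivl)
      also have "\<dots> = f w ^ m * ?g w"
        by (simp add: sum_distrib_left power_add mult_ac atLeast0AtMost add.commute)
      finally show ?thesis by simp
    qed
    from no_zero_divisors[OF power[OF f(1)] gR this] power_nonzero[OF f]
    have g0: "\<forall>w\<in>Y'. ?g w = 0" by blast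
    have G0: "?G m w = 0" if "w \<in> Y" for w
    proof -
      have "?g w = (\<Sum>j\<in>{0}. ?G (m + j) w * f w ^ j)"
        using Y(2)[OF that] by (intro sum.mono_neutral_right) auto
      then show ?thesis using g0 that Y(1) by auto
    qed
    \<comment> \<open>the \<open>m\<close>-th coefficient as a polynomial in the variables \<open>J\<close>; the variable \<open>None\<close> does not
      occur in it, so its value \<open>0\<close> is arbitrary\<close>
    define G' where "G' y = coeff (q (case_option 0 y)) m" for y
    have "(\<lambda>y. coeff (q (\<lambda>i. case_option 0 y i)) m) \<in> poly_funs J"
      by (rule poly_funs_subst[OF q(1)]) (auto intro: poly_funs.intros)
    then have "G' \<in> poly_funs J" by (simp add: G'_def[abs_def])
    moreover have "G' (\<lambda>i. u i w) = 0" if "w \<in> Y" for w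
    proof -
      have "G' (\<lambda>i. u i w) = ?G m w" unfolding G'_def by (rule poly_funs_cong[OF q(1)]) auto
      with G0[OF that] show ?thesis by simp
    qed
    ultimately have "G' (\<lambda>i. x (Some i)) = 0" using ind unfolding alg_independent_def by blast
    moreover have "G' (\<lambda>i. x (Some i)) = coeff (q x) m"
      unfolding G'_def by (rule poly_funs_cong[OF q(1)]) auto
    ultimately show ?case by simp
  qed
  then have "q x = 0" by (intro poly_eqI) simp
  then show "P x = 0" by (simp add: q(3))
qed

text \<open>An equation \<open>f\<close> of \<open>Y\<close> that does not hold on \<open>Y'\<close> can be adjoined to the independent coordinates of
  \<open>Y\<close>. It is a polynomial in the coordinates, so the number of functions obtained is bounded by
  the rank of \<open>Y'\<close>.\<close>

lemma coord_rank_strict_mono: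
  assumes fin: "finite I" and Y: "closedin (zariski I) Y" "Y \<noteq> {}"
    and Y': "irreducible_in (zariski I) Y'" and sub: "Y \<subset> Y'"
  shows "coord_rank I Y < coord_rank I Y'"
proof -
  interpret function_domain Y' "poly_funs I" by (rule irreducible_imp_function_domain[OF Y'])
  have Y'_cspace: "Y' \<subseteq> cspace I" using Y' by (simp add: irreducible_in_def)
  obtain J where J: "J \<subseteq> I" "alg_independent Y (\<lambda>i x. x i) J" "card J = coord_rank I Y"
    by (rule coord_rank_obtain[OF fin Y(2)])
  have finJ: "finite J" using J(1) fin by (rule finite_subset)
  obtain F where F: "F \<subseteq> poly_funs I" "Y = zero_locus I F" using Y(1) closedin_zariski by blast
  obtain y where y: "y \<in> Y'" "y \<notin> Y" using sub by blast
  have "y \<in> cspace I" using y(1) Y'_cspace by blast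
  with y(2) obtain f where f: "f \<in> F" "f y \<noteq> 0" unfolding F zero_locus_def by auto
  have fI: "f \<in> poly_funs I" using f F by auto
  have coords: "(\<lambda>i x. x i) ` I \<subseteq> poly_funs I" by (auto intro: poly_funs.coord)
  have "restrict x I = x" if "x \<in> Y'" for x
    using Y'_cspace that by (auto simp: cspace_def intro: PiE_restrict)
  then have "param_image I (\<lambda>i x. x i) Y' = Y'" by (auto simp: param_image_def image_iff)
  with growth_coord_rank[OF fin coords] have gr: "growth (coord_rank I Y') ((\<lambda>i x. x i) ` I)" by simp
  have "algebraic_over Y' ((\<lambda>i x. x i) ` I) f"
    by (rule algebraic_over_generated[OF nonempty generated_poly_funs[OF fI]]) simp
  from growth_insert_algebraic[OF gr coords this]
  have gr': "growth (coord_rank I Y') (insert f ((\<lambda>i x. x i) ` I))" .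
  have "alg_independent Y' (case_option f (\<lambda>i x. x i)) (insert None (Some ` J))"
    using f y sub J(1) coords
    by (intro adjoin_vanishing_independent[OF function_domain_axioms _ fI _ _ _ J(2)])
      (auto simp: F zero_locus_def)
  moreover have "case_option f (\<lambda>i x. x i) ` (insert None (Some ` J)) \<subseteq> insert f ((\<lambda>i x. x i) ` I)"
    using image_mono[OF J(1), of "\<lambda>i x. x i"] by (auto simp: image_image)
  ultimately have "card (insert None (Some ` J)) \<le> coord_rank I Y'"
    using finJ coords fI by (intro growth_independent_card_le[OF gr']) auto
  then show ?thesis using finJ J(3) by (simp add: card_image)
qed

lemma irreducible_in_subtopology:
  assumes "closedin X C" "irreducible_in (subtopology X C) Z"
  shows "irreducible_in X Z"
  unfolding irreducible_in_def
proof (intro conjI allI impI)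
  have Z: "Z \<subseteq> C" "Z \<subseteq> topspace X" using assms(2) by (auto simp: irreducible_in_def)
  then show "Z \<subseteq> topspace X" by simp
  show "Z \<noteq> {}" using assms(2) by (auto simp: irreducible_in_def)
  fix A B assume *: "closedin X A \<and> closedin X B \<and> Z \<subseteq> A \<union> B"
  have "closedin (subtopology X C) (A \<inter> C)" "closedin (subtopology X C) (B \<inter> C)"
    using * by (auto simp: closedin_subtopology)
  moreover have "Z \<subseteq> (A \<inter> C) \<union> (B \<inter> C)" using * Z by auto
  ultimately have "Z \<subseteq> A \<inter> C \<or> Z \<subseteq> B \<inter> C" using assms(2) unfolding irreducible_in_def by blast
  then show "Z \<subseteq> A \<or> Z \<subseteq> B" by auto
qed

lemma irreducible_in_subtopologyI:
  assumes "closedin X C" "Z \<subseteq> C" "irreducible_in X Z"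
  shows "irreducible_in (subtopology X C) Z"
  using assms unfolding irreducible_in_def closedin_closed_subtopology[OF assms(1)] by auto

lemma zariski_dim_le_coord_rank:
  assumes fin: "finite I" and X: "X \<subseteq> cspace I" "X \<noteq> {}"
  shows "zariski_dim I X \<le> ereal (real (coord_rank I X))"
  unfolding zariski_dim_def krull_dim_def
proof (rule SUP_least, clarify)
  let ?C = "zariski I closure_of X" and ?T = "subtopology (zariski I) (zariski I closure_of X)"
  fix n and Z :: "nat \<Rightarrow> ('a \<Rightarrow> complex) set"
  assume Z: "\<forall>i\<le>n. closedin ?T (Z i) \<and> irreducible_in ?T (Z i)" "\<forall>i<n. Z i \<subset> Z (Suc i)"
  have C: "closedin (zariski I) ?C" by simp
  have Zc: "closedin (zariski I) (Z i)" "Z i \<subseteq> ?C" "irreducible_in (zariski I) (Z i)" "Z i \<noteq> {}"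
    if "i \<le> n" for i
    using Z(1) that closedin_closed_subtopology[OF C] irreducible_in_subtopology[OF C]
    by (auto simp: irreducible_in_def)
  have "i \<le> coord_rank I (Z i)" if "i \<le> n" for i
    using that
  proof (induction i)
    case (Suc i)
    then have "coord_rank I (Z i) < coord_rank I (Z (Suc i))"
      using Z(2) Zc by (intro coord_rank_strict_mono[OF fin]) auto
    with Suc show ?case by simp
  qed simp
  then have "n \<le> coord_rank I (Z n)" by simp
  also have "\<dots> \<le> coord_rank I ?C" using Zc by (intro coord_rank_mono fin) auto
  finally show "ereal (real n) \<le> ereal (real (coord_rank I X))"
    using coord_rank_closure[OF fin X] by simp
qed

lemma zariski_dim_ge_chain:
  assumes "\<And>i. i \<le> n \<Longrightarrow> closedin (zariski I) (Z i) \<and> irreducible_in (zariski I) (Z i) \<and>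
      Z i \<subseteq> zariski I closure_of X"
    and "\<And>i. i < n \<Longrightarrow> Z i \<subset> Z (Suc i)"
  shows "ereal (real n) \<le> zariski_dim I X"
  unfolding zariski_dim_def krull_dim_def
proof (rule SUP_upper, clarify, intro exI conjI allI impI)
  let ?C = "zariski I closure_of X" and ?T = "subtopology (zariski I) (zariski I closure_of X)"
  have C: "closedin (zariski I) ?C" by simp
  show "closedin ?T (Z i)" "irreducible_in ?T (Z i)" if "i \<le> n" for i
    using assms(1)[OF that] irreducible_in_subtopologyI[OF C] closedin_closed_subtopology[OF C] by auto
  show "Z i \<subset> Z (Suc i)" if "i < n" for i using assms(2)[OF that] .
qed

section \<open>Rational functions on the positive orthant\<close>

text \<open>A set of complex numbers, since parameters and coordinates are complex throughout.\<close>

definition positive_reals :: "complex set" where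
  "positive_reals = {z. z \<in> \<real> \<and> 0 < Re z}"

definition positive_orthant :: "('a \<Rightarrow> complex) set" where
  "positive_orthant = {\<theta>. \<forall>a. \<theta> a \<in> positive_reals}"

definition orthant_slice :: "'a set \<Rightarrow> ('a \<Rightarrow> complex) \<Rightarrow> ('a \<Rightarrow> complex) set" where
  "orthant_slice B p = {\<theta> \<in> positive_orthant. \<forall>a. a \<notin> B \<longrightarrow> \<theta> a = p a}"

definition regular_funs :: "'a set \<Rightarrow> (('a \<Rightarrow> complex) \<Rightarrow> complex) set" where
  "regular_funs A = {g. \<exists>P\<in>poly_funs A. \<exists>Q\<in>poly_funs A. \<forall>\<theta>\<in>positive_orthant. Q \<theta> \<noteq> 0 \<and> Q \<theta> * g \<theta> = P \<theta>}"

lemma positive_reals_iff: "z \<in> positive_reals \<longleftrightarrow> (\<exists>x>0. z = complex_of_real x)"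
  unfolding positive_reals_def by (auto simp: Reals_def)

lemma positive_reals_norm: "z \<in> positive_reals \<Longrightarrow> complex_of_real (norm z) = z"
  by (auto simp: positive_reals_iff)

lemma positive_reals_add: "a \<in> positive_reals \<Longrightarrow> b \<in> positive_reals \<Longrightarrow> a + b \<in> positive_reals"
  by (auto simp: positive_reals_def)

lemma positive_reals_mult: "a \<in> positive_reals \<Longrightarrow> b \<in> positive_reals \<Longrightarrow> a * b \<in> positive_reals"
  unfolding positive_reals_iff by (metis mult_pos_pos of_real_mult)

lemma positive_reals_inverse: "a \<in> positive_reals \<Longrightarrow> inverse a \<in> positive_reals"
  unfolding positive_reals_iff by (metis of_real_inverse positive_imp_inverse_positive)

lemma positive_reals_nonzero: "a \<in> positive_reals \<Longrightarrow> a \<noteq> 0"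
  by (auto simp: positive_reals_def)

lemma positive_reals_one: "1 \<in> positive_reals"
  by (simp add: positive_reals_def)

lemma positive_reals_divide: "a \<in> positive_reals \<Longrightarrow> b \<in> positive_reals \<Longrightarrow> a / b \<in> positive_reals"
  unfolding divide_inverse by (intro positive_reals_mult positive_reals_inverse)

lemma positive_reals_sum:
  "finite A \<Longrightarrow> A \<noteq> {} \<Longrightarrow> (\<And>a. a \<in> A \<Longrightarrow> f a \<in> positive_reals) \<Longrightarrow> sum f A \<in> positive_reals"
  by (induction A rule: finite_ne_induct) (auto intro: positive_reals_add)

lemma positive_reals_prod:
  "finite A \<Longrightarrow> (\<And>a. a \<in> A \<Longrightarrow> f a \<in> positive_reals) \<Longrightarrow> prod f A \<in> positive_reals"
  by (induction A rule: finite_induct) (auto intro: positive_reals_mult positive_reals_one)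

lemma infinite_positive_reals: "infinite positive_reals"
proof -
  have "complex_of_real ` {0<..} \<subseteq> positive_reals" by (auto simp: positive_reals_def)
  moreover have "infinite (complex_of_real ` {0<..})"
    by (subst finite_image_iff) (auto simp: inj_on_def infinite_Ioi)
  ultimately show ?thesis using finite_subset by blast
qed

lemma one_in_positive_orthant: "(\<lambda>_. 1) \<in> positive_orthant"
  by (simp add: positive_orthant_def positive_reals_one)

lemma orthant_slice_subset: "orthant_slice B p \<subseteq> positive_orthant"
  by (auto simp: orthant_slice_def)

lemma orthant_slice_UNIV: "orthant_slice UNIV p = positive_orthant"
  by (auto simp: orthant_slice_def)

lemma base_in_orthant_slice: "p \<in> positive_orthant \<Longrightarrow> p \<in> orthant_slice B p"
  by (auto simp: orthant_slice_def)

lemma poly_funs_eq_0_on_positive_orthant: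
  assumes "finite A" "P \<in> poly_funs A" "\<And>\<theta>. \<theta> \<in> positive_orthant \<Longrightarrow> P \<theta> = 0"
  shows "P x = 0"
  by (rule poly_funs_eq_0_on_infinite_box[OF assms(1) infinite_positive_reals assms(2)])
    (rule assms(3), simp add: positive_orthant_def)

lemma poly_funs_on_line:
  assumes "P \<in> poly_funs A"
  shows "\<exists>q. \<forall>t. P (\<lambda>a. x a + t * (y a - x a)) = poly q t"
  using assms
proof (induction rule: poly_funs.induct)
  case (const c)
  show ?case by (rule exI[of _ "[:c:]"]) simp
next
  case (coord a)
  show ?case by (rule exI[of _ "[:x a, y a - x a:]"]) simp
next
  case (add f g)
  then obtain q q' where "\<forall>t. f (\<lambda>a. x a + t * (y a - x a)) = poly q t"
    "\<forall>t. g (\<lambda>a. x a + t * (y a - x a)) = poly q' t" by auto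
  then show ?case by (intro exI[of _ "q + q'"]) simp
next
  case (mult f g)
  then obtain q q' where "\<forall>t. f (\<lambda>a. x a + t * (y a - x a)) = poly q t"
    "\<forall>t. g (\<lambda>a. x a + t * (y a - x a)) = poly q' t" by auto
  then show ?case by (intro exI[of _ "q * q'"]) simp
qed

lemma segment_in_orthant_slice:
  assumes "x \<in> orthant_slice B p" "y \<in> orthant_slice B p" "0 < s" "s < 1"
  shows "(\<lambda>a. x a + complex_of_real s * (y a - x a)) \<in> orthant_slice B p"
proof -
  have "x a + complex_of_real s * (y a - x a) \<in> positive_reals" for a
  proof -
    have "x a \<in> positive_reals" "y a \<in> positive_reals"
      using assms by (auto simp: orthant_slice_def positive_orthant_def)
    moreover have "complex_of_real (1 - s) \<in> positive_reals" "complex_of_real s \<in> positive_reals"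
      using assms(3,4) by (simp_all add: positive_reals_def)
    ultimately have "complex_of_real (1 - s) * x a + complex_of_real s * y a \<in> positive_reals"
      by (intro positive_reals_add positive_reals_mult)
    moreover have "complex_of_real (1 - s) * x a + complex_of_real s * y a = x a + complex_of_real s * (y a - x a)"
      by (simp add: algebra_simps)
    ultimately show ?thesis by simp
  qed
  then show ?thesis using assms by (auto simp: orthant_slice_def positive_orthant_def)
qed

lemma poly_funs_regular: "P \<in> poly_funs A \<Longrightarrow> P \<in> regular_funs A"
  unfolding regular_funs_def mem_Collect_eq
  by (rule bexI[of _ P], rule bexI[of _ "\<lambda>_. 1"]) (auto intro: poly_funs.const)

text \<open>A slice is convex. Join two points at which the numerators of the two factors are nonzero: on the
  segment, both numerators are nonzero polynomials in one real variable, and their product has only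
  finitely many zeros.\<close>

lemma function_domain_orthant_slice:
  assumes p: "p \<in> positive_orthant"
  shows "function_domain (orthant_slice B p) (regular_funs A)"
proof
  show "orthant_slice B p \<noteq> {}" using base_in_orthant_slice[OF p] by auto
  show "(\<lambda>w. c) \<in> regular_funs A" for c by (intro poly_funs_regular poly_funs.const)
  fix f g :: "('a \<Rightarrow> complex) \<Rightarrow> complex" assume "f \<in> regular_funs A" "g \<in> regular_funs A"
  then obtain P Q P' Q' where P: "P \<in> poly_funs A" "Q \<in> poly_funs A" "P' \<in> poly_funs A" "Q' \<in> poly_funs A"
    and f: "\<And>\<theta>. \<theta> \<in> positive_orthant \<Longrightarrow> Q \<theta> \<noteq> 0 \<and> Q \<theta> * f \<theta> = P \<theta>"
    and g: "\<And>\<theta>. \<theta> \<in> positive_orthant \<Longrightarrow> Q' \<theta> \<noteq> 0 \<and> Q' \<theta> * g \<theta> = P' \<theta>"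
    unfolding regular_funs_def by blast
  have sum: "(\<lambda>\<theta>. P \<theta> * Q' \<theta> + P' \<theta> * Q \<theta>) \<in> poly_funs A" using P by (intro poly_funs.intros)
  have prods: "(\<lambda>\<theta>. Q \<theta> * Q' \<theta>) \<in> poly_funs A" "(\<lambda>\<theta>. P \<theta> * P' \<theta>) \<in> poly_funs A"
    using P by (auto intro: poly_funs.mult)
  have "Q \<theta> * Q' \<theta> * (f \<theta> + g \<theta>) = P \<theta> * Q' \<theta> + P' \<theta> * Q \<theta>" if "\<theta> \<in> positive_orthant" for \<theta>
    unfolding conjunct2[OF f[OF that], symmetric] conjunct2[OF g[OF that], symmetric]
    by (simp add: algebra_simps)
  then show "(\<lambda>w. f w + g w) \<in> regular_funs A"
    unfolding regular_funs_def mem_Collect_eq using f g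
    by (intro bexI[OF _ sum] bexI[OF _ prods(1)] ballI conjI) auto
  have "Q \<theta> * Q' \<theta> * (f \<theta> * g \<theta>) = P \<theta> * P' \<theta>" if "\<theta> \<in> positive_orthant" for \<theta>
    unfolding conjunct2[OF f[OF that], symmetric] conjunct2[OF g[OF that], symmetric]
    by (simp add: algebra_simps)
  then show "(\<lambda>w. f w * g w) \<in> regular_funs A"
    unfolding regular_funs_def mem_Collect_eq using f g
    by (intro bexI[OF _ prods(2)] bexI[OF _ prods(1)] ballI conjI) auto
  assume zero: "\<And>w. w \<in> orthant_slice B p \<Longrightarrow> f w * g w = 0"
  show "(\<forall>w\<in>orthant_slice B p. f w = 0) \<or> (\<forall>w\<in>orthant_slice B p. g w = 0)"
  proof (rule ccontr)
    assume "\<not> ?thesis"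
    then obtain x y where xy: "x \<in> orthant_slice B p" "f x \<noteq> 0" "y \<in> orthant_slice B p" "g y \<noteq> 0" by blast
    let ?l = "\<lambda>t a. x a + t * (y a - x a)"
    obtain q where q: "\<And>t. P (?l t) = poly q t" using poly_funs_on_line[OF P(1)] by blast
    obtain q' where q': "\<And>t. P' (?l t) = poly q' t" using poly_funs_on_line[OF P(3)] by blast
    have "x \<in> positive_orthant" "y \<in> positive_orthant" using xy orthant_slice_subset by auto
    then have "P x \<noteq> 0" "P' y \<noteq> 0" using f[of x] g[of y] xy by auto
    then have "poly q 0 \<noteq> 0" "poly q' 1 \<noteq> 0" using q[of 0] q'[of 1] by simp_all
    then have "q * q' \<noteq> 0" by auto
    moreover have "poly (q * q') (complex_of_real s) = 0" if "s \<in> {0<..<1}" for s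
    proof -
      have *: "?l (complex_of_real s) \<in> orthant_slice B p"
        using xy that by (intro segment_in_orthant_slice) auto
      with orthant_slice_subset have **: "?l (complex_of_real s) \<in> positive_orthant" by (rule subsetD)
      have "P (?l (complex_of_real s)) * P' (?l (complex_of_real s)) = 0"
        using zero[OF *]
        unfolding conjunct2[OF f[OF **], symmetric] conjunct2[OF g[OF **], symmetric] by auto
      then show ?thesis by (simp add: q q')
    qed
    then have "complex_of_real ` {0<..<1} \<subseteq> {t. poly (q * q') t = 0}"  by blast
    moreover have "infinite (complex_of_real ` {0<..<1})"
      by (subst finite_image_iff) (auto simp: inj_on_def)
    ultimately show False using poly_roots_finite finite_subset by blast
  qed
qed

lemma function_domain_orthant: "function_domain positive_orthant (regular_funs A)"
  using function_domain_orthant_slice[OF one_in_positive_orthant, of UNIV A] by (simp add: orthant_slice_UNIV)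

lemma coords_independent_on_orthant_slice:
  assumes "finite B" "p \<in> positive_orthant"
  shows "alg_independent (orthant_slice B p) (\<lambda>a \<theta>. \<theta> a) B"
proof (rule alg_independentI)
  fix P :: "('a \<Rightarrow> complex) \<Rightarrow> complex" and x
  assume P: "P \<in> poly_funs B" "\<And>w. w \<in> orthant_slice B p \<Longrightarrow> P (\<lambda>i. w i) = 0"
  show "P x = 0"
  proof (rule poly_funs_eq_0_on_positive_orthant[OF assms(1) P(1)])
    fix \<theta> :: "'a \<Rightarrow> complex" assume \<theta>: "\<theta> \<in> positive_orthant"
    let ?\<theta> = "\<lambda>a. if a \<in> B then \<theta> a else p a"
    have "?\<theta> \<in> orthant_slice B p" using \<theta> assms(2) by (auto simp: orthant_slice_def positive_orthant_def)
    then have "P (\<lambda>a. ?\<theta> a) = 0" by (rule P(2))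
    moreover have "P \<theta> = P (\<lambda>a. ?\<theta> a)" by (intro poly_funs_cong[OF P(1)]) auto
    ultimately show "P \<theta> = 0" by simp
  qed
qed

lemma regular_algebraic_over_coords:
  assumes "g \<in> regular_funs A" "\<Omega> \<subseteq> positive_orthant" "\<Omega> \<noteq> {}"
  shows "algebraic_over \<Omega> ((\<lambda>a \<theta>. \<theta> a) ` A) g"
proof -
  obtain P Q where P: "P \<in> poly_funs A" "Q \<in> poly_funs A"
    and g: "\<And>\<theta>. \<theta> \<in> positive_orthant \<Longrightarrow> Q \<theta> \<noteq> 0 \<and> Q \<theta> * g \<theta> = P \<theta>"
    using assms(1) unfolding regular_funs_def by blast
  obtain w where "w \<in> \<Omega>" using assms(3) by auto
  with g assms(2) show ?thesis
    using generated_poly_funs[OF P(1), of "\<lambda>a \<theta>. \<theta> a"] generated_poly_funs[OF P(2), of "\<lambda>a \<theta>. \<theta> a"]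
    by (intro algebraic_over_quotient[of P _ Q w]) auto
qed

section \<open>Dimension of parametrised sets\<close>

lemma rank_on_slice_le:
  assumes "finite A" "finite I" "\<phi> ` I \<subseteq> regular_funs A" "p \<in> positive_orthant" "B \<subseteq> A"
    and J: "J \<subseteq> I" "alg_independent (orthant_slice B p) \<phi> J"
  shows "card J \<le> card B"
proof -
  interpret function_domain "orthant_slice B p" "regular_funs A"
    by (rule function_domain_orthant_slice[OF assms(4)])
  let ?t = "\<lambda>a (\<theta> :: 'a \<Rightarrow> complex). \<theta> a"
  have tR: "?t ` A \<subseteq> regular_funs A" by (auto intro: poly_funs_regular poly_funs.coord)
  have tRB: "?t ` B \<subseteq> regular_funs A" using image_mono[OF assms(5), of ?t] tR by (rule order.trans)
  have finB: "finite B" using assms(1,5) finite_subset by blast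
  have "growth (card B) (?t ` B)" using finB by (intro growth_finite card_image_le) auto
  then have "growth (card B) (?t ` B \<union> ?t ` A)"
  proof (rule growth_algebraic[rotated])
    fix f assume "f \<in> ?t ` A"
    then obtain a where f: "f = ?t a" by auto
    show "algebraic_over (orthant_slice B p) (?t ` B) f"
    proof (cases "a \<in> B")
      case True
      then show ?thesis using f by (intro algebraic_over_generated[OF nonempty generated_gen]) auto
    next
      case False
      then show ?thesis using f
        by (intro algebraic_over_generated[OF nonempty generated_const[of "p a"]]) (auto simp: orthant_slice_def)
    qed
  qed (use assms(1) tR tRB in simp_all)
  then have "growth (card B) (?t ` B \<union> ?t ` A \<union> \<phi> ` I)"
  proof (rule growth_algebraic[rotated])
    fix f assume "f \<in> \<phi> ` I"
    then have "f \<in> regular_funs A" using assms(3) by auto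
    then have "algebraic_over (orthant_slice B p) (?t ` A) f"
      by (intro regular_algebraic_over_coords orthant_slice_subset nonempty)
    then show "algebraic_over (orthant_slice B p) (?t ` B \<union> ?t ` A) f"
      by (rule algebraic_over_mono) auto
  qed (use assms(1-3) tR tRB in simp_all)
  then show ?thesis
  proof (rule growth_independent_card_le[OF _ _ _ _ J(2)])
    show "finite J" using J(1) assms(2) finite_subset by blast
    show "\<phi> ` J \<subseteq> ?t ` B \<union> ?t ` A \<union> \<phi> ` I" using J(1) by blast
  qed (use assms(3) tR tRB in simp)
qed

text \<open>The leading coefficients of the relations for the free parameters \<open>\<theta> b\<close> are nonzero at \<open>p\<close>, hence the
  relations stay meaningful on the slice through \<open>p\<close>, where the parameters in \<open>T\<close> are constants. So the
  free parameters are algebraic over the \<open>\<phi> i\<close>, and they are independent.\<close>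

lemma rank_on_slice_ge:
  assumes fin: "finite A" "finite I" and \<phi>: "\<phi> ` I \<subseteq> regular_funs A" and p: "p \<in> positive_orthant"
    and B: "B \<subseteq> A" "T \<subseteq> A" "B \<inter> T = {}"
    and C: "\<And>b m. b \<in> B \<Longrightarrow> m \<le> e b \<Longrightarrow> C b m \<in> generated (\<phi> ` I \<union> (\<lambda>a \<theta>. \<theta> a) ` T)"
    and e: "\<And>b. b \<in> B \<Longrightarrow> 1 \<le> e b" "\<And>b. b \<in> B \<Longrightarrow> C b (e b) p \<noteq> 0"
    and rel: "\<And>b \<theta>. b \<in> B \<Longrightarrow> \<theta> \<in> positive_orthant \<Longrightarrow> (\<Sum>m\<le>e b. C b m \<theta> * \<theta> b ^ m) = 0"
  obtains J where "J \<subseteq> I" "alg_independent (orthant_slice B p) \<phi> J" "card B \<le> card J"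
proof -
  interpret function_domain "orthant_slice B p" "regular_funs A"
    by (rule function_domain_orthant_slice[OF p])
  let ?t = "\<lambda>a (\<theta> :: 'a \<Rightarrow> complex). \<theta> a"
  let ?S = "orthant_slice B p"
  have tR: "?t ` A \<subseteq> regular_funs A" by (auto intro: poly_funs_regular poly_funs.coord)
  have tRB: "?t ` B \<subseteq> regular_funs A" using image_mono[OF B(1), of ?t] tR by (rule order.trans)
  have tRT: "?t ` T \<subseteq> regular_funs A" using image_mono[OF B(2), of ?t] tR by (rule order.trans)
  have finBT: "finite B" "finite T" using fin(1) B(1,2) by (auto intro: finite_subset)
  have ne: "param_image I \<phi> ?S \<noteq> {}" using nonempty by (simp add: param_image_def)
  obtain J where J: "J \<subseteq> I" "alg_independent (param_image I \<phi> ?S) (\<lambda>i x. x i) J"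
    "card J = coord_rank I (param_image I \<phi> ?S)" by (rule coord_rank_obtain[OF fin(2) ne])
  have gr: "growth (card J) (\<phi> ` I)" unfolding J(3) by (rule growth_coord_rank[OF fin(2) \<phi>])
  have gr1: "growth (card J) (\<phi> ` I \<union> ?t ` T)"
  proof (rule growth_algebraic[OF _ gr])
    fix f assume "f \<in> ?t ` T"
    then obtain a where a: "a \<in> T" "f = ?t a" by auto
    then have "w a = p a" if "w \<in> ?S" for w using that B(3) by (auto simp: orthant_slice_def)
    then show "algebraic_over ?S (\<phi> ` I) f"
      unfolding a(2) by (intro algebraic_over_generated[OF nonempty generated_const[of "p a"]])
  qed (use \<phi> tRT finBT in simp_all)
  have gr2: "growth (card J) (\<phi> ` I \<union> ?t ` T \<union> ?t ` B)"
  proof (rule growth_algebraic[OF _ gr1])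
    fix f assume "f \<in> ?t ` B"
    then obtain b where b: "b \<in> B" "f = ?t b" by auto
    show "algebraic_over ?S (\<phi> ` I \<union> ?t ` T) f"
      unfolding algebraic_over_def
    proof (intro exI[of _ "e b"] exI[of _ "C b"] conjI allI impI ballI)
      show "\<exists>w\<in>?S. C b (e b) w \<noteq> 0" using e(2)[OF b(1)] base_in_orthant_slice[OF p] by blast
      show "(\<Sum>m\<le>e b. C b m w * f w ^ m) = 0" if "w \<in> ?S" for w
        using rel[OF b(1)] that orthant_slice_subset[of B p] by (auto simp: b(2))
    qed (use C e b in auto)
  qed (use \<phi> tRB tRT finBT in simp_all)
  have "card B \<le> card J"
    by (rule growth_independent_card_le[OF gr2 finBT(1) _ _ coords_independent_on_orthant_slice[OF finBT(1) p]])
      (use \<phi> tRB tRT in simp_all)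
  moreover have "alg_independent ?S \<phi> J" using J(2) alg_independent_param_image[OF J(1)] by auto
  ultimately show ?thesis using that J(1) by blast
qed

text \<open>Extend \<open>\<phi> j\<close>, \<open>j \<in> J\<close>, by parameters \<open>\<theta> a\<close>, \<open>a \<in> T\<close>, to a transcendence basis of the field of rational
  functions in all parameters.\<close>

lemma complement_transcendence_coords:
  assumes fin: "finite A" "finite I" and \<phi>: "\<phi> ` I \<subseteq> regular_funs A"
    and J: "J \<subseteq> I" "alg_independent positive_orthant \<phi> J"
  obtains T where "T \<subseteq> A" "card J \<le> card (A - T)"
    "\<And>b. b \<in> A - T \<Longrightarrow> algebraic_over positive_orthant (\<phi> ` I \<union> (\<lambda>a \<theta>. \<theta> a) ` T) (\<lambda>\<theta>. \<theta> b)"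
proof -
  interpret function_domain positive_orthant "regular_funs A" by (rule function_domain_orthant)
  let ?t = "\<lambda>a (\<theta> :: 'a \<Rightarrow> complex). \<theta> a"
  define u where "u = case_sum \<phi> ?t"
  have finJ: "finite J" using J fin finite_subset by blast
  have tR: "?t ` A \<subseteq> regular_funs A" by (auto intro: poly_funs_regular poly_funs.coord)
  have \<phi>J: "\<phi> ` J \<subseteq> regular_funs A" using image_mono[OF J(1)] \<phi> by (rule order.trans)
  have "alg_independent positive_orthant u (Inl ` J)"
    by (rule alg_independent_reindex[OF _ _ J(2)]) (auto simp: u_def)
  then obtain M where M: "Inl ` J \<subseteq> M" "M \<subseteq> Inl ` J \<union> Inr ` A" "alg_independent positive_orthant u M"
    "\<And>i. i \<in> (Inl ` J \<union> Inr ` A) - M \<Longrightarrow> \<not> alg_independent positive_orthant u (insert i M)"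
    using extend_independent[of "Inl ` J \<union> Inr ` A" "Inl ` J" u] fin finJ by blast
  define T where "T = {a \<in> A. Inr a \<in> M}"
  have MT: "M = Inl ` J \<union> Inr ` T" using M(1,2) by (auto simp: T_def)
  have TA: "T \<subseteq> A" by (auto simp: T_def)
  have finT: "finite T" using TA fin finite_subset by blast
  have cardM: "card M = card J + card T"
    unfolding MT using finJ finT by (subst card_Un_disjoint) (auto simp: card_image)
  have uM: "u ` M \<subseteq> ?t ` A \<union> \<phi> ` J"
  proof
    fix f assume "f \<in> u ` M"
    then consider j where "j \<in> J" "f = \<phi> j" | a where "a \<in> T" "f = ?t a"
      unfolding MT by (auto simp: u_def)
    then show "f \<in> ?t ` A \<union> \<phi> ` J" using TA by cases auto
  qed
  have "growth (card A) (?t ` A)" using fin by (intro growth_finite card_image_le) auto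
  then have "growth (card A) (?t ` A \<union> \<phi> ` J)"
  proof (rule growth_algebraic[rotated])
    fix f assume "f \<in> \<phi> ` J"
    then have "f \<in> regular_funs A" using \<phi>J by (rule subsetD[rotated])
    then show "algebraic_over positive_orthant (?t ` A) f"
      by (intro regular_algebraic_over_coords order.refl nonempty)
  qed (use finJ tR \<phi>J in simp_all)
  then have "card M \<le> card A"
    by (rule growth_independent_card_le[OF _ _ uM _ M(3)]) (use finJ finT tR \<phi>J MT in simp_all)
  then have "card J \<le> card (A - T)" using cardM TA finT by (simp add: card_Diff_subset)
  moreover have "algebraic_over positive_orthant (\<phi> ` I \<union> ?t ` T) (?t b)" if b: "b \<in> A - T" for b
  proof -
    have "\<not> alg_independent positive_orthant u (insert (Inr b) M)"
      using b by (intro M(4)) (auto simp: T_def)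
    from dependent_imp_algebraic_over[OF M(3) this]
    have "algebraic_over positive_orthant (u ` M) (?t b)" by (simp add: u_def)
    moreover have "u ` M \<subseteq> \<phi> ` I \<union> ?t ` T"
    proof
      fix f assume "f \<in> u ` M"
      then consider j where "j \<in> J" "f = \<phi> j" | a where "a \<in> T" "f = ?t a"
        unfolding MT by (auto simp: u_def)
      then show "f \<in> \<phi> ` I \<union> ?t ` T" using J(1) by cases auto
    qed
    ultimately show ?thesis by (rule algebraic_over_mono)
  qed
  ultimately show ?thesis using that[of T] TA by blast
qed

text \<open>Fix the parameters at a point where the leading coefficients of the finitely many relations for
  the parameters outside of \<open>T\<close> are all nonzero, and then free those parameters one by one. The
  image of a slice with \<open>m\<close> free parameters has rank exactly \<open>m\<close>, so that the closures of the images
  increase strictly.\<close>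

lemma zariski_dim_ge_independent:
  assumes fin: "finite A" "finite I" and \<phi>: "\<phi> ` I \<subseteq> regular_funs A"
    and J: "J \<subseteq> I" "alg_independent positive_orthant \<phi> J"
    and X: "param_image I \<phi> positive_orthant \<subseteq> X"
  shows "ereal (real (card J)) \<le> zariski_dim I X"
proof -
  interpret function_domain positive_orthant "regular_funs A" by (rule function_domain_orthant)
  let ?t = "\<lambda>a (\<theta> :: 'a \<Rightarrow> complex). \<theta> a"
  obtain T where T: "T \<subseteq> A" "card J \<le> card (A - T)"
    and alg: "\<And>b. b \<in> A - T \<Longrightarrow> algebraic_over positive_orthant (\<phi> ` I \<union> ?t ` T) (?t b)"
    by (rule complement_transcendence_coords[OF fin \<phi> J]) rule
  have "\<forall>b\<in>A - T. \<exists>eC. 1 \<le> fst eC \<and> (\<forall>m\<le>fst eC. snd eC m \<in> generated (\<phi> ` I \<union> ?t ` T)) \<and>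
      (\<exists>w\<in>positive_orthant. snd eC (fst eC) w \<noteq> 0) \<and>
      (\<forall>w\<in>positive_orthant. (\<Sum>m\<le>fst eC. snd eC m w * w b ^ m) = 0)"
  proof
    fix b assume "b \<in> A - T"
    from alg[OF this] obtain e C where "1 \<le> e" "\<forall>m\<le>e. C m \<in> generated (\<phi> ` I \<union> ?t ` T)"
      "\<exists>w\<in>positive_orthant. C e w \<noteq> 0" "\<forall>w\<in>positive_orthant. (\<Sum>m\<le>e. C m w * w b ^ m) = 0"
      unfolding algebraic_over_def by blast
    then show "\<exists>eC. 1 \<le> fst eC \<and> (\<forall>m\<le>fst eC. snd eC m \<in> generated (\<phi> ` I \<union> ?t ` T)) \<and>
      (\<exists>w\<in>positive_orthant. snd eC (fst eC) w \<noteq> 0) \<and>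
      (\<forall>w\<in>positive_orthant. (\<Sum>m\<le>fst eC. snd eC m w * w b ^ m) = 0)"
      by (intro exI[of _ "(e, C)"]) simp
  qed
  from bchoice[OF this] obtain eC where eC: "\<forall>b\<in>A - T. 1 \<le> fst (eC b) \<and>
      (\<forall>m\<le>fst (eC b). snd (eC b) m \<in> generated (\<phi> ` I \<union> ?t ` T)) \<and>
      (\<exists>w\<in>positive_orthant. snd (eC b) (fst (eC b)) w \<noteq> 0) \<and>
      (\<forall>w\<in>positive_orthant. (\<Sum>m\<le>fst (eC b). snd (eC b) m w * w b ^ m) = 0)" by (elim exE)
  have tR: "?t ` A \<subseteq> regular_funs A" by (auto intro: poly_funs_regular poly_funs.coord)
  have tRT: "?t ` T \<subseteq> regular_funs A" using image_mono[OF T(1), of ?t] tR by (rule order.trans)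
  have genR: "generated (\<phi> ` I \<union> ?t ` T) \<subseteq> regular_funs A"
    by (intro generated_subset_R) (use \<phi> tRT in simp)
  obtain p where p: "p \<in> positive_orthant" "\<And>b. b \<in> A - T \<Longrightarrow> snd (eC b) (fst (eC b)) p \<noteq> 0"
  proof (rule common_nonzero[of "A - T" "\<lambda>b. snd (eC b) (fst (eC b))"])
    show "snd (eC b) (fst (eC b)) \<in> regular_funs A \<and> (\<exists>w\<in>positive_orthant. snd (eC b) (fst (eC b)) w \<noteq> 0)"
      if "b \<in> A - T" for b using bspec[OF eC that] genR by auto
  qed (use fin in auto)
  obtain \<beta> where \<beta>: "bij_betw \<beta> {0..<card (A - T)} (A - T)"
    using ex_bij_betw_nat_finite[of "A - T"] fin by auto
  define B where "B m = \<beta> ` {0..<m}" for m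
  have BA: "B m \<subseteq> A - T" and Bcard: "card (B m) = m" if "m \<le> card J" for m
  proof -
    have "{0..<m} \<subseteq> {0..<card (A - T)}" using that T(2) by auto
    then show "B m \<subseteq> A - T" using \<beta> unfolding B_def bij_betw_def by auto
    have "inj_on \<beta> {0..<m}" using \<beta> \<open>{0..<m} \<subseteq> _\<close> unfolding bij_betw_def by (meson inj_on_subset)
    then show "card (B m) = m" unfolding B_def by (simp add: card_image)
  qed
  define Z where "Z m = zariski I closure_of (param_image I \<phi> (orthant_slice (B m) p))" for m
  have sub: "orthant_slice (B m) p \<subseteq> orthant_slice (B (Suc m)) p" for m
  proof -
    have "B m \<subseteq> B (Suc m)" by (auto simp: B_def)
    then show ?thesis by (auto simp: orthant_slice_def)
  qed
  show ?thesis
  proof (rule zariski_dim_ge_chain)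
    fix m assume m: "m \<le> card J"
    have "irreducible_in (zariski I) (Z m)"
      unfolding Z_def using \<phi>
      by (intro irreducible_closure_param_image[OF function_domain_orthant_slice[OF p(1)]]) auto
    moreover have "param_image I \<phi> (orthant_slice (B m) p) \<subseteq> X"
      using X orthant_slice_subset[of "B m" p] unfolding param_image_def by blast
    then have "Z m \<subseteq> zariski I closure_of X" unfolding Z_def by (rule closure_of_mono)
    ultimately show "closedin (zariski I) (Z m) \<and> irreducible_in (zariski I) (Z m) \<and>
        Z m \<subseteq> zariski I closure_of X" by (simp add: Z_def)
  next
    fix m assume m: "m < card J"
    have "Z m \<subseteq> Z (Suc m)"
      unfolding Z_def param_image_def by (intro closure_of_mono image_mono sub)
    moreover have "Z m \<noteq> Z (Suc m)"
    proof
      assume eq: "Z m = Z (Suc m)"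
      have BS: "B (Suc m) \<subseteq> A - T" using m by (intro BA) simp
      obtain J' where J': "J' \<subseteq> I" "alg_independent (orthant_slice (B (Suc m)) p) \<phi> J'"
        "card (B (Suc m)) \<le> card J'"
      proof (rule rank_on_slice_ge[OF fin \<phi> p(1), of "B (Suc m)" T "\<lambda>b. fst (eC b)" "\<lambda>b. snd (eC b)"])
        fix b assume "b \<in> B (Suc m)"
        then have b: "b \<in> A - T" using BS by blast
        show "1 \<le> fst (eC b)" using bspec[OF eC b] by simp
        show "snd (eC b) (fst (eC b)) p \<noteq> 0" using p(2)[OF b] .
        show "snd (eC b) m \<in> generated (\<phi> ` I \<union> ?t ` T)" if "m \<le> fst (eC b)" for m
          using bspec[OF eC b] that by simp
        show "(\<Sum>m\<le>fst (eC b). snd (eC b) m w * w b ^ m) = 0" if "w \<in> positive_orthant" for w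
          using bspec[OF eC b] that by simp
      qed (use BS T in auto)
      have "alg_independent (param_image I \<phi> (orthant_slice (B (Suc m)) p)) (\<lambda>i x. x i) J'"
        using J'(2) alg_independent_param_image[OF J'(1)] by auto
      then have "alg_independent (Z (Suc m)) (\<lambda>i x. x i) J'"
        by (rule alg_independent_mono_set) (unfold Z_def, intro closure_of_subset, simp add: param_image_cspace)
      then have "alg_independent (Z m) (\<lambda>i x. x i) J'" using eq by simp
      then have "alg_independent (param_image I \<phi> (orthant_slice (B m) p)) (\<lambda>i x. x i) J'"
        unfolding Z_def by (intro alg_independent_closure[OF param_image_cspace J'(1)])
      then have "alg_independent (orthant_slice (B m) p) \<phi> J'"
        using alg_independent_param_image[OF J'(1)] by auto
      then have "card J' \<le> card (B m)"
        using BA[of m] m by (intro rank_on_slice_le[OF fin \<phi> p(1) _ J'(1)]) auto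
      with J'(3) show False using Bcard[of m] Bcard[of "Suc m"] m by simp
    qed
    ultimately show "Z m \<subset> Z (Suc m)" by blast
  qed
qed

text \<open>The set \<open>X\<close> may be larger than the parametrised set, as long as both have the same closure: tensors
  with positive parameters suffice for all tensors of bounded rank.\<close>

theorem zariski_dim_eq_coord_rank:
  assumes fin: "finite A" "finite I" and \<phi>: "\<phi> ` I \<subseteq> regular_funs A"
    and X: "param_image I \<phi> positive_orthant \<subseteq> X" "X \<subseteq> cspace I"
    and dense: "\<And>P x. P \<in> poly_funs I \<Longrightarrow> (\<And>\<theta>. \<theta> \<in> positive_orthant \<Longrightarrow> P (\<lambda>i. \<phi> i \<theta>) = 0) \<Longrightarrow> x \<in> X \<Longrightarrow> P x = 0"
  shows "zariski_dim I X = ereal (real (coord_rank I (param_image I \<phi> positive_orthant)))"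
proof (rule antisym)
  let ?Y = "param_image I \<phi> positive_orthant"
  have Y: "?Y \<noteq> {}" using one_in_positive_orthant by (auto simp: param_image_def)
  then have Xne: "X \<noteq> {}" using X by auto
  obtain J where J: "J \<subseteq> I" "alg_independent X (\<lambda>i x. x i) J" "card J = coord_rank I X"
    by (rule coord_rank_obtain[OF fin(2) Xne])
  have "alg_independent positive_orthant \<phi> J"
  proof (rule alg_independentI)
    fix P x assume P: "P \<in> poly_funs J" "\<And>w. w \<in> positive_orthant \<Longrightarrow> P (\<lambda>i. \<phi> i w) = 0"
    show "P x = 0"
      by (rule alg_independentD[OF J(2) P(1)], rule dense[OF poly_funs_mono[OF P(1) J(1)] P(2)])
  qed
  then have "card J \<le> coord_rank I ?Y"
    using alg_independent_param_image[OF J(1)] by (intro coord_rank_ge[OF fin(2) J(1)]) auto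
  then show "zariski_dim I X \<le> ereal (real (coord_rank I ?Y))"
    using zariski_dim_le_coord_rank[OF fin(2) X(2) Xne] J(3) by (simp add: order_trans)
  obtain J' where J': "J' \<subseteq> I" "alg_independent ?Y (\<lambda>i x. x i) J'" "card J' = coord_rank I ?Y"
    by (rule coord_rank_obtain[OF fin(2) Y])
  have "alg_independent positive_orthant \<phi> J'"
    using J'(2) alg_independent_param_image[OF J'(1)] by auto
  from zariski_dim_ge_independent[OF fin \<phi> J'(1) this X(1)] J'(3)
  show "ereal (real (coord_rank I ?Y)) \<le> zariski_dim I X" by simp
qed

section \<open>Hyperplane sections of cones\<close>

text \<open>Since \<open>F\<close> can be given any positive value while the \<open>p i\<close> are kept, a relation holds separately
  for each positive value substituted for \<open>F\<close>, and a univariate polynomial has finitely many roots.\<close>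

lemma adjoin_scale_independent:
  assumes ind: "alg_independent \<Omega> p J"
    and scale: "\<And>w s. w \<in> \<Omega> \<Longrightarrow> s \<in> positive_reals \<Longrightarrow> \<exists>w'\<in>\<Omega>. F w' = s \<and> (\<forall>i\<in>J. p i w' = p i w)"
  shows "alg_independent \<Omega> (case_option F p) (insert None (Some ` J))"
proof (rule alg_independentI)
  let ?u = "case_option F p"
  fix P and x :: "'b option \<Rightarrow> complex"
  assume P: "P \<in> poly_funs (insert None (Some ` J))" "\<And>w. w \<in> \<Omega> \<Longrightarrow> P (\<lambda>i. ?u i w) = 0"
  obtain q n where q: "\<And>m. (\<lambda>x. coeff (q x) m) \<in> poly_funs (Some ` J)" "\<And>x. degree (q x) \<le> n"
      "\<And>x. P x = poly (q x) (x None)" by (rule poly_funs_expand[OF P(1)]) rule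
  have "poly (q x) s = 0" if s: "s \<in> positive_reals" for s
  proof -
    have "(\<lambda>y. P (\<lambda>i. case_option s y i)) \<in> poly_funs J"
      by (rule poly_funs_subst[OF P(1)]) (auto intro: poly_funs.intros)
    then have H: "(\<lambda>y. P (case_option s y)) \<in> poly_funs J" by simp
    have "P (case_option s (\<lambda>i. x (Some i))) = 0"
    proof (rule alg_independentD[OF ind H])
      fix w assume w: "w \<in> \<Omega>"
      from scale[OF w s] obtain w' where w': "w' \<in> \<Omega>" "F w' = s" "\<And>i. i \<in> J \<Longrightarrow> p i w' = p i w" by blast
      have "P (case_option s (\<lambda>i. p i w)) = P (\<lambda>i. ?u i w')"
        using w' by (intro poly_funs_cong[OF P(1)]) auto
      then show "P (case_option s (\<lambda>i. p i w)) = 0" using P(2)[OF w'(1)] by simp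
    qed
    moreover have "q (case_option s (\<lambda>i. x (Some i))) = q x"
      by (rule poly_eqI, rule poly_funs_cong[OF q(1)]) auto
    ultimately show ?thesis using q(3)[of "case_option s (\<lambda>i. x (Some i))"] by simp
  qed
  then have "positive_reals \<subseteq> {s. poly (q x) s = 0}" by auto
  then have "q x = 0" using infinite_positive_reals poly_roots_finite finite_subset by metis
  then show "P x = 0" by (simp add: q(3))
qed

text \<open>The \<open>f i\<close> are homogeneous coordinates on a cone, with sum \<open>F\<close>, and the \<open>p i\<close> the coordinates
  after normalisation. Both ranks are compared with that of the family formed by \<open>F\<close> and the \<open>p i\<close>:
  it is one more than the rank of the \<open>p i\<close>, and it is the rank of the \<open>f i\<close>, because each of the two
  families is algebraic over the other.\<close>

lemma coord_rank_normalize: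
  assumes fin: "finite A" "finite I" and f: "f ` I \<subseteq> regular_funs A" and p: "p ` I \<subseteq> regular_funs A"
    and F: "F \<in> regular_funs A"
    and rel: "\<And>\<theta> i. \<theta> \<in> positive_orthant \<Longrightarrow> i \<in> I \<Longrightarrow> f i \<theta> = F \<theta> * p i \<theta>"
    and F_sum: "\<And>\<theta>. \<theta> \<in> positive_orthant \<Longrightarrow> F \<theta> = (\<Sum>i\<in>I. f i \<theta>)"
    and scale: "\<And>\<theta> s. \<theta> \<in> positive_orthant \<Longrightarrow> s \<in> positive_reals \<Longrightarrow>
      \<exists>\<theta>'\<in>positive_orthant. F \<theta>' = s \<and> (\<forall>i\<in>I. p i \<theta>' = p i \<theta>)"
  shows "coord_rank I (param_image I f positive_orthant) = Suc (coord_rank I (param_image I p positive_orthant))"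
    (is "?b = Suc ?a")
proof -
  interpret function_domain positive_orthant "regular_funs A" by (rule function_domain_orthant)
  let ?O = "positive_orthant :: ('a \<Rightarrow> complex) set"
  let ?u = "case_option F p"
  have ne: "param_image I h ?O \<noteq> {}" for h using nonempty by (simp add: param_image_def)
  obtain \<theta>1 where \<theta>1: "\<theta>1 \<in> ?O" "F \<theta>1 = 1"
    using scale[OF one_in_positive_orthant positive_reals_one] by blast
  obtain J where J: "J \<subseteq> I" "alg_independent (param_image I p ?O) (\<lambda>i x. x i) J" "card J = ?a"
    by (rule coord_rank_obtain[OF fin(2) ne])
  have Jp: "alg_independent ?O p J" using J(2) alg_independent_param_image[OF J(1)] by auto
  have finJ: "finite J" using J(1) fin(2) by (rule finite_subset)
  have uJ: "alg_independent ?O ?u (insert None (Some ` J))"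
    using scale J(1) by (intro adjoin_scale_independent[OF Jp]) blast
  have cardJ: "card (insert None (Some ` J)) = Suc ?a" using finJ J(3) by (simp add: card_image)
  have uI: "?u ` insert None (Some ` I) = insert F (p ` I)" by (simp add: image_image)
  have gr_u: "growth (Suc ?a) (insert F (p ` I))"
    unfolding cardJ[symmetric] uI[symmetric]
  proof (rule max_independent_growth[OF _ _ uJ])
    show "insert None (Some ` J) \<subseteq> insert None (Some ` I)" using J(1) by auto
    show "?u ` insert None (Some ` I) \<subseteq> regular_funs A" unfolding uI using F p by simp
    fix o' assume "o' \<in> insert None (Some ` I) - insert None (Some ` J)"
    then obtain i where i: "o' = Some i" "i \<in> I" "i \<notin> J" by auto
    show "\<not> alg_independent ?O ?u (insert o' (insert None (Some ` J)))"
    proof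
      assume "alg_independent ?O ?u (insert o' (insert None (Some ` J)))"
      then have "alg_independent ?O ?u (Some ` insert i J)"
        by (rule alg_independent_mono) (auto simp: i)
      then have "alg_independent ?O p (the ` Some ` insert i J)"
        by (rule alg_independent_reindex[rotated 2]) (auto simp: inj_on_def)
      then have "alg_independent ?O p (insert i J)" by (simp add: image_image)
      then have "card (insert i J) \<le> ?a"
        using i J(1) by (intro coord_rank_ge fin) (auto simp: alg_independent_param_image)
      with i finJ J(3) show False by simp
    qed
  qed (use fin in simp)
  have "growth (Suc ?a) (insert F (p ` I) \<union> f ` I)"
  proof (rule growth_algebraic[OF _ gr_u])
    fix h assume "h \<in> f ` I"
    then obtain i where i: "i \<in> I" "h = f i" by auto
    show "algebraic_over ?O (insert F (p ` I)) h"
      unfolding i(2)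
      by (rule algebraic_over_generated[OF nonempty generated_mult[OF generated_gen generated_gen] rel[OF _ i(1)]])
        (use i in auto)
  qed (use fin F f p in simp_all)
  moreover obtain J' where J': "J' \<subseteq> I" "alg_independent (param_image I f ?O) (\<lambda>i x. x i) J'" "card J' = ?b"
    by (rule coord_rank_obtain[OF fin(2) ne])
  moreover have "alg_independent ?O f J'" using J'(2) alg_independent_param_image[OF J'(1)] by auto
  ultimately have "card J' \<le> Suc ?a"
    using finite_subset[OF J'(1) fin(2)] image_mono[OF J'(1), of f] F f p
    by (intro growth_independent_card_le[where u = f and B = J' and U = "insert F (p ` I) \<union> f ` I"]) auto
  then have le: "?b \<le> Suc ?a" using J'(3) by simp
  have "growth ?b (f ` I)" by (rule growth_coord_rank[OF fin(2) f])
  then have "growth ?b (insert F (f ` I))"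
  proof (rule growth_insert_algebraic[OF _ f])
    show "algebraic_over ?O (f ` I) F"
      by (rule algebraic_over_generated[OF nonempty generated_sum[OF fin(2) generated_gen] F_sum]) auto
  qed
  then have "growth ?b (insert F (f ` I) \<union> p ` I)"
  proof (rule growth_algebraic[rotated])
    fix h assume "h \<in> p ` I"
    then obtain i where i: "i \<in> I" "h = p i" by auto
    show "algebraic_over ?O (insert F (f ` I)) h"
      unfolding i(2)
      by (rule algebraic_over_quotient[of "f i" _ F \<theta>1])
        (use i \<theta>1 rel in \<open>auto intro: generated_gen\<close>)
  qed (use fin F f p in simp_all)
  then have "card (insert None (Some ` J)) \<le> ?b"
  proof (rule growth_independent_card_le[OF _ _ _ _ uJ])
    show "?u ` insert None (Some ` J) \<subseteq> insert F (f ` I) \<union> p ` I"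
      using J(1) by (auto simp: image_image)
  qed (use finJ F f p in simp_all)
  with le cardJ show ?thesis by simp
qed

section \<open>Powers of a parametrised set\<close>

lemma alg_independent_productD:
  fixes \<sigma> :: "'i \<Rightarrow> 's" and \<xi> :: "'i \<Rightarrow> 'x" and g :: "'x \<Rightarrow> ('a \<Rightarrow> complex) \<Rightarrow> complex"
  assumes inj: "inj_on (\<lambda>i. (\<sigma> i, \<xi> i)) K"
    and ind: "alg_independent positive_orthant (\<lambda>i \<theta>. g (\<xi> i) (\<lambda>a. \<theta> (\<sigma> i, a))) K"
  shows "alg_independent positive_orthant g (\<xi> ` {i \<in> K. \<sigma> i = s})"
proof -
  let ?K = "{i \<in> K. \<sigma> i = s}"
  have "alg_independent positive_orthant (\<lambda>i \<theta>. g (\<xi> i) (\<lambda>a. \<theta> (\<sigma> i, a))) ?K"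
    by (rule alg_independent_mono[OF ind]) auto
  then have *: "alg_independent positive_orthant (\<lambda>t (\<theta> :: 's \<times> 'a \<Rightarrow> complex). g t (\<lambda>a. \<theta> (s, a))) (\<xi> ` ?K)"
    by (rule alg_independent_reindex[rotated 2]) (use inj in \<open>auto simp: inj_on_def\<close>)
  show ?thesis
  proof (rule alg_independentI)
    fix P x assume P: "P \<in> poly_funs (\<xi> ` ?K)" "\<And>w. w \<in> positive_orthant \<Longrightarrow> P (\<lambda>i. g i w) = 0"
    show "P x = 0"
      by (rule alg_independentD[OF * P(1)], rule P(2)) (simp add: positive_orthant_def)
  qed
qed

text \<open>A relation that holds at all points of the power is freed of one slice after the other: if the
  coordinates in the other slices are held fixed, it is a relation between the \<open>g t\<close>, so it holds
  for arbitrary values of the coordinates in this slice.\<close>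

lemma alg_independent_productI:
  fixes \<sigma> :: "'i \<Rightarrow> 's" and \<xi> :: "'i \<Rightarrow> 'x" and g :: "'x \<Rightarrow> ('a \<Rightarrow> complex) \<Rightarrow> complex"
  assumes inj: "inj_on (\<lambda>i. (\<sigma> i, \<xi> i)) K" and fin: "finite K"
    and ind: "\<And>s. alg_independent positive_orthant g (\<xi> ` {i \<in> K. \<sigma> i = s})"
  shows "alg_independent positive_orthant (\<lambda>i \<theta>. g (\<xi> i) (\<lambda>a. \<theta> (\<sigma> i, a))) K"
proof (rule alg_independentI)
  fix P and x :: "'i \<Rightarrow> complex"
  assume P: "P \<in> poly_funs K"
    and van: "\<And>w. w \<in> positive_orthant \<Longrightarrow> P (\<lambda>i. g (\<xi> i) (\<lambda>a. w (\<sigma> i, a))) = 0"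
  have "P (\<lambda>i. if \<sigma> i \<in> S then x i else g (\<xi> i) (\<lambda>a. \<theta> (\<sigma> i, a))) = 0"
    if "finite S" "\<theta> \<in> positive_orthant" for S \<theta>
    using that
  proof (induction S arbitrary: \<theta> rule: finite_induct)
    case empty
    then show ?case using van by simp
  next
    case (insert s S)
    let ?K = "{i \<in> K. \<sigma> i = s}"
    define h where "h i z = (if \<sigma> i \<in> S then x i else if \<sigma> i = s then z (\<xi> i)
        else g (\<xi> i) (\<lambda>a. \<theta> (\<sigma> i, a)))" for i z
    have "h i \<in> poly_funs (\<xi> ` ?K)" if "i \<in> K" for i
    proof -
      consider "\<sigma> i \<in> S" | "\<sigma> i \<notin> S" "\<sigma> i = s" | "\<sigma> i \<notin> S" "\<sigma> i \<noteq> s" by blast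
      then show ?thesis
        by cases (use that in \<open>auto simp: h_def[abs_def] intro!: poly_funs.const poly_funs.coord\<close>)
    qed
    then have H: "(\<lambda>z. P (\<lambda>i. h i z)) \<in> poly_funs (\<xi> ` ?K)" by (rule poly_funs_subst[OF P])
    define z where "z t = x (the_inv_into K (\<lambda>i. (\<sigma> i, \<xi> i)) (s, t))" for t
    have z: "z (\<xi> i) = x i" if "i \<in> K" "\<sigma> i = s" for i
      using the_inv_into_f_f[OF inj that(1)] that(2) by (simp add: z_def)
    have "P (\<lambda>i. h i z) = 0"
    proof (rule alg_independentD[OF ind H])
      fix w :: "'a \<Rightarrow> complex" assume w: "w \<in> positive_orthant"
      let ?\<theta> = "\<lambda>(s', a). if s' = s then w a else \<theta> (s', a)"
      have "?\<theta> \<in> positive_orthant" using w insert.prems by (auto simp: positive_orthant_def)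
      from insert.IH[OF this]
      have "P (\<lambda>i. if \<sigma> i \<in> S then x i else g (\<xi> i) (\<lambda>a. ?\<theta> (\<sigma> i, a))) = 0" .
      moreover have "(\<lambda>i. if \<sigma> i \<in> S then x i else g (\<xi> i) (\<lambda>a. ?\<theta> (\<sigma> i, a))) = (\<lambda>i. h i (\<lambda>t. g t w))"
        by (auto simp: h_def fun_eq_iff)
      ultimately show "P (\<lambda>i. h i (\<lambda>t. g t w)) = 0" by simp
    qed
    moreover have "P (\<lambda>i. if \<sigma> i \<in> insert s S then x i else g (\<xi> i) (\<lambda>a. \<theta> (\<sigma> i, a))) = P (\<lambda>i. h i z)"
      using z by (intro poly_funs_cong[OF P]) (auto simp: h_def)
    ultimately show ?case by simp
  qed
  from this[of "\<sigma> ` K", OF _ one_in_positive_orthant] fin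
  have "P (\<lambda>i. if \<sigma> i \<in> \<sigma> ` K then x i else g (\<xi> i) (\<lambda>a. 1)) = 0" by simp
  moreover have "P x = P (\<lambda>i. if \<sigma> i \<in> \<sigma> ` K then x i else g (\<xi> i) (\<lambda>a. 1))"
    by (intro poly_funs_cong[OF P]) auto
  ultimately show "P x = 0" by simp
qed

text \<open>The parametrised set is the power, with one factor for each element of \<open>S\<close>, of the set
  parametrised by \<open>g\<close>; a coordinate \<open>i\<close> corresponds to the coordinate \<open>\<xi> i\<close> in the factor \<open>\<sigma> i\<close>.
  The two maps \<open>\<sigma>\<close> and \<open>\<xi>\<close> let joint states of a graph serve as coordinates of a power directly.\<close>

lemma coord_rank_product:
  fixes \<sigma> :: "'i \<Rightarrow> 's" and \<xi> :: "'i \<Rightarrow> 'x" and g :: "'x \<Rightarrow> ('a \<Rightarrow> complex) \<Rightarrow> complex"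
  assumes bij: "bij_betw (\<lambda>i. (\<sigma> i, \<xi> i)) I (S \<times> T)" and fin: "finite I" "finite S" "finite T"
  shows "coord_rank I (param_image I (\<lambda>i \<theta>. g (\<xi> i) (\<lambda>a. \<theta> (\<sigma> i, a))) positive_orthant) =
    card S * coord_rank T (param_image T g positive_orthant)" (is "?l = card S * ?r")
proof (rule antisym)
  let ?f = "\<lambda>i (\<theta> :: 's \<times> 'a \<Rightarrow> complex). g (\<xi> i) (\<lambda>a. \<theta> (\<sigma> i, a))"
  have inj: "inj_on (\<lambda>i. (\<sigma> i, \<xi> i)) I" and im: "(\<lambda>i. (\<sigma> i, \<xi> i)) ` I = S \<times> T"
    using bij by (auto simp: bij_betw_def)
  have ne: "param_image X h positive_orthant \<noteq> {}" for X h
    using one_in_positive_orthant by (auto simp: param_image_def)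
  obtain J where J: "J \<subseteq> I" "alg_independent (param_image I ?f positive_orthant) (\<lambda>i x. x i) J" "card J = ?l"
    by (rule coord_rank_obtain[OF fin(1) ne])
  have Jf: "alg_independent positive_orthant ?f J" using J(2) alg_independent_param_image[OF J(1)] by auto
  have injJ: "inj_on (\<lambda>i. (\<sigma> i, \<xi> i)) J" using inj J(1) by (rule inj_on_subset)
  have slice: "card {i \<in> J. \<sigma> i = s} \<le> ?r" for s
  proof -
    have "inj_on \<xi> {i \<in> J. \<sigma> i = s}" using injJ by (auto simp: inj_on_def)
    then have "card {i \<in> J. \<sigma> i = s} = card (\<xi> ` {i \<in> J. \<sigma> i = s})" by (simp add: card_image)
    also have "\<dots> \<le> ?r"
    proof (rule coord_rank_ge[OF fin(3)])
      show sub: "\<xi> ` {i \<in> J. \<sigma> i = s} \<subseteq> T" using J(1) im by auto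
      show "alg_independent (param_image T g positive_orthant) (\<lambda>i x. x i) (\<xi> ` {i \<in> J. \<sigma> i = s})"
        using alg_independent_productD[OF injJ Jf] alg_independent_param_image[OF sub] by auto
    qed
    finally show ?thesis .
  qed
  have "J = (\<Union>s\<in>S. {i \<in> J. \<sigma> i = s})" using J(1) im by auto
  then have "card J = card (\<Union>s\<in>S. {i \<in> J. \<sigma> i = s})" by simp
  also have "\<dots> \<le> (\<Sum>s\<in>S. card {i \<in> J. \<sigma> i = s})" using fin(2) by (rule card_UN_le)
  also have "\<dots> \<le> (\<Sum>s\<in>S. ?r)" by (intro sum_mono slice)
  finally show "?l \<le> card S * ?r" using J(3) by simp
  obtain J' where J': "J' \<subseteq> T" "alg_independent (param_image T g positive_orthant) (\<lambda>i x. x i) J'" "card J' = ?r"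
    by (rule coord_rank_obtain[OF fin(3) ne])
  have J'g: "alg_independent positive_orthant g J'" using J'(2) alg_independent_param_image[OF J'(1)] by auto
  define L where "L = {i \<in> I. \<xi> i \<in> J'}"
  have LI: "L \<subseteq> I" by (auto simp: L_def)
  have "alg_independent positive_orthant ?f L"
  proof (rule alg_independent_productI)
    show "inj_on (\<lambda>i. (\<sigma> i, \<xi> i)) L" using inj LI by (rule inj_on_subset)
    show "finite L" using LI fin(1) by (rule finite_subset)
    show "alg_independent positive_orthant g (\<xi> ` {i \<in> L. \<sigma> i = s})" for s
      by (rule alg_independent_mono[OF J'g]) (auto simp: L_def)
  qed
  then have "card L \<le> ?l"
    using alg_independent_param_image[OF LI] by (intro coord_rank_ge[OF fin(1) LI]) auto
  moreover have "(\<lambda>i. (\<sigma> i, \<xi> i)) ` L = S \<times> J'"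
  proof (intro equalityI subsetI)
    fix z assume "z \<in> S \<times> J'"
    moreover from this J'(1) have "z \<in> (\<lambda>i. (\<sigma> i, \<xi> i)) ` I" unfolding im by auto
    ultimately show "z \<in> (\<lambda>i. (\<sigma> i, \<xi> i)) ` L" by (auto simp: L_def)
  next
    fix z assume "z \<in> (\<lambda>i. (\<sigma> i, \<xi> i)) ` L"
    then obtain i where "i \<in> I" "\<xi> i \<in> J'" "z = (\<sigma> i, \<xi> i)" by (auto simp: L_def)
    moreover from this have "(\<sigma> i, \<xi> i) \<in> S \<times> T" unfolding im[symmetric] by auto
    ultimately show "z \<in> S \<times> J'" by auto
  qed
  then have "card L = card (S \<times> J')" using card_image[OF inj_on_subset[OF inj LI]] by simp
  ultimately show "card S * ?r \<le> ?l" using J'(3) by (simp add: card_cartesian_product)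
qed

section \<open>Tensors of bounded rank\<close>

definition rank_sum :: "nat \<Rightarrow> nat \<Rightarrow> (nat \<Rightarrow> nat) \<Rightarrow> (nat \<times> nat \<times> nat \<Rightarrow> complex) \<Rightarrow> complex" where
  "rank_sum r k x \<tau> = (\<Sum>l=1..r. \<Prod>j=1..k. \<tau> (l, j, x j))"

definition rank_params :: "nat \<Rightarrow> nat \<Rightarrow> (nat \<Rightarrow> nat) \<Rightarrow> (nat \<times> nat \<times> nat) set" where
  "rank_params r k n = {1..r} \<times> (SIGMA j:{1..k}. {1..n j})"

lemma finite_rank_params: "finite (rank_params r k n)"
  by (auto simp: rank_params_def)

lemma finite_tensor_index: "finite (tensor_index k n)"
  by (auto simp: tensor_index_def intro: finite_PiE)

lemma rank_sum_poly_funs: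
  assumes "x \<in> tensor_index k n"
  shows "rank_sum r k x \<in> poly_funs (rank_params r k n)"
proof -
  have "(\<lambda>\<tau>. \<Sum>l=1..r. \<Prod>j=1..k. \<tau> (l, j, x j)) \<in> poly_funs (rank_params r k n)"
    using assms by (intro poly_funs_sum poly_funs_prod poly_funs.coord)
      (auto simp: rank_params_def tensor_index_def)
  then show ?thesis by (simp add: rank_sum_def[abs_def])
qed

definition has_decomposition :: "nat \<Rightarrow> (nat \<Rightarrow> nat) \<Rightarrow> nat \<Rightarrow> ((nat \<Rightarrow> nat) \<Rightarrow> complex) \<Rightarrow> bool" where
  "has_decomposition k n s T \<longleftrightarrow> (\<exists>a :: nat \<Rightarrow> nat \<Rightarrow> nat \<Rightarrow> complex.
     (\<forall>l\<in>{1..s}. \<forall>j\<in>{1..k}. a l j \<in> cspace {1..n j}) \<and>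
     T = (\<lambda>x\<in>tensor_index k n. \<Sum>l=1..s. outer_product k n (a l) x))"

lemma tensor_rank_eq_Least: "tensor_rank k n T = (LEAST s. has_decomposition k n s T)"
  by (simp add: tensor_rank_def has_decomposition_def)

lemma has_decomposition_iff:
  "has_decomposition k n s T \<longleftrightarrow> (\<exists>\<tau>. T = (\<lambda>x\<in>tensor_index k n. rank_sum s k x \<tau>))"
proof
  assume "has_decomposition k n s T"
  then obtain a where "T = (\<lambda>x\<in>tensor_index k n. \<Sum>l=1..s. outer_product k n (a l) x)"
    unfolding has_decomposition_def by blast
  then have "T = (\<lambda>x\<in>tensor_index k n. rank_sum s k x (\<lambda>(l, j, y). a l j y))"
    by (auto simp: fun_eq_iff outer_product_def rank_sum_def)
  then show "\<exists>\<tau>. T = (\<lambda>x\<in>tensor_index k n. rank_sum s k x \<tau>)" by blast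
next
  assume "\<exists>\<tau>. T = (\<lambda>x\<in>tensor_index k n. rank_sum s k x \<tau>)"
  then obtain \<tau> where \<tau>: "T = (\<lambda>x\<in>tensor_index k n. rank_sum s k x \<tau>)" by blast
  define a where "a l j = (\<lambda>y\<in>{1..n j}. \<tau> (l, j, y))" for l j
  have "T = (\<lambda>x\<in>tensor_index k n. \<Sum>l=1..s. outer_product k n (a l) x)"
    unfolding \<tau>
    by (intro restrict_ext) (auto simp: outer_product_def rank_sum_def a_def tensor_index_def intro!: sum.cong prod.cong)
  moreover have "\<forall>l\<in>{1..s}. \<forall>j\<in>{1..k}. a l j \<in> cspace {1..n j}" by (simp add: a_def cspace_def)
  ultimately show "has_decomposition k n s T" unfolding has_decomposition_def by blast
qed

text \<open>Every tensor is a sum of multiples of the standard basis tensors. The multiple is carried by the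
  factor with number one; here \<open>k \<ge> 1\<close> is used. Without this lemma, the least number of summands
  in the definition of the rank could not be evaluated.\<close>

lemma exists_decomposition:
  assumes k: "k \<ge> 1" and T: "T \<in> cspace (tensor_index k n)"
  shows "\<exists>s. has_decomposition k n s T"
proof -
  let ?I = "tensor_index k n"
  obtain e where e: "bij_betw e {1..card ?I} ?I"
    using ex_bij_betw_nat_finite_1[OF finite_tensor_index] by blast
  define \<tau> where "\<tau> = (\<lambda>(l, j, y). if e l j = y then (if j = 1 then T (e l) else 1) else 0)"
  have "T x = rank_sum (card ?I) k x \<tau>" if x: "x \<in> ?I" for x
  proof -
    have "(\<Prod>j=1..k. \<tau> (l, j, x j)) = (if e l = x then T x else 0)" if "l \<in> {1..card ?I}" for l
    proof (cases "e l = x")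
      case True
      have "(\<Prod>j=1..k. \<tau> (l, j, x j)) = (\<Prod>j=1..k. if j = 1 then T x else 1)"
        using True by (intro prod.cong) (auto simp: \<tau>_def)
      then show ?thesis using True k by simp
    next
      case False
      have "e l \<in> ?I" using e that by (auto simp: bij_betw_def)
      with x False obtain j where "j \<in> {1..k}" "e l j \<noteq> x j"
        unfolding tensor_index_def by (metis PiE_ext)
      then have "(\<Prod>j=1..k. \<tau> (l, j, x j)) = 0"
        by (intro prod_zero bexI[of _ j]) (auto simp: \<tau>_def)
      then show ?thesis using False by simp
    qed
    then have "rank_sum (card ?I) k x \<tau> = (\<Sum>l=1..card ?I. if e l = x then T x else 0)"
      by (simp add: rank_sum_def)
    also have "\<dots> = (\<Sum>y\<in>?I. if y = x then T x else 0)"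
      by (rule sum.reindex_bij_betw[OF e])
    also have "\<dots> = T x" using x finite_tensor_index by simp
    finally show ?thesis by simp
  qed
  moreover have "T x = undefined" if "x \<notin> ?I" for x
    using PiE_arb[OF T[unfolded cspace_def] that] .
  ultimately have "T = (\<lambda>x\<in>?I. rank_sum (card ?I) k x \<tau>)" by (intro ext) simp
  then show ?thesis unfolding has_decomposition_iff by (intro exI)
qed

text \<open>Pad with zero summands. A summand without factors would be \<open>1\<close> instead of \<open>0\<close>.\<close>

lemma has_decomposition_mono:
  assumes k: "k \<ge> 1" and "s \<le> r" "has_decomposition k n s T"
  shows "has_decomposition k n r T"
proof -
  from assms(3) obtain \<tau> where \<tau>: "T = (\<lambda>x\<in>tensor_index k n. rank_sum s k x \<tau>)"
    unfolding has_decomposition_iff by blast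
  define \<tau>' where "\<tau>' = (\<lambda>(l, j, y). if l \<le> s then \<tau> (l, j, y) else 0)"
  have "rank_sum r k x \<tau>' = rank_sum s k x \<tau>" for x
  proof -
    have "(\<Prod>j=1..k. \<tau>' (l, j, x j)) = 0" if "l \<in> {1..r} - {1..s}" for l
      using k that by (intro prod_zero) (auto simp: \<tau>'_def intro!: bexI[of _ 1])
    then have "rank_sum r k x \<tau>' = (\<Sum>l=1..s. \<Prod>j=1..k. \<tau>' (l, j, x j))"
      unfolding rank_sum_def using assms(2) by (intro sum.mono_neutral_right) auto
    then show ?thesis by (simp add: rank_sum_def \<tau>'_def)
  qed
  then show ?thesis unfolding has_decomposition_iff \<tau> by (intro exI[of _ \<tau>']) simp
qed

lemma tensors_rank_le_eq:
  assumes k: "k \<ge> 1"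
  shows "tensors_rank_le k n r = range (\<lambda>\<tau>. \<lambda>x\<in>tensor_index k n. rank_sum r k x \<tau>)"
proof (intro equalityI subsetI)
  fix T assume "T \<in> tensors_rank_le k n r"
  then have T: "T \<in> cspace (tensor_index k n)" "tensor_rank k n T \<le> r" by (auto simp: tensors_rank_le_def)
  have "has_decomposition k n (tensor_rank k n T) T"
    unfolding tensor_rank_eq_Least by (rule LeastI_ex[OF exists_decomposition[OF k T(1)]])
  then have "has_decomposition k n r T" by (rule has_decomposition_mono[OF k T(2)])
  then show "T \<in> range (\<lambda>\<tau>. \<lambda>x\<in>tensor_index k n. rank_sum r k x \<tau>)"
    unfolding has_decomposition_iff by auto
next
  fix T assume *: "T \<in> range (\<lambda>\<tau>. \<lambda>x\<in>tensor_index k n. rank_sum r k x \<tau>)"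
  then have "has_decomposition k n r T" unfolding has_decomposition_iff by auto
  then have "tensor_rank k n T \<le> r" unfolding tensor_rank_eq_Least by (rule Least_le)
  with * show "T \<in> tensors_rank_le k n r" by (auto simp: tensors_rank_le_def cspace_def)
qed

lemma zariski_dim_tensors_rank_le:
  assumes k: "k \<ge> 1"
  shows "zariski_dim (tensor_index k n) (tensors_rank_le k n r) =
    ereal (real (coord_rank (tensor_index k n) (param_image (tensor_index k n) (rank_sum r k) positive_orthant)))"
proof (rule zariski_dim_eq_coord_rank[OF finite_rank_params[of r k n] finite_tensor_index])
  show "rank_sum r k ` tensor_index k n \<subseteq> regular_funs (rank_params r k n)"
    using rank_sum_poly_funs by (auto intro: poly_funs_regular)
  show "param_image (tensor_index k n) (rank_sum r k) positive_orthant \<subseteq> tensors_rank_le k n r"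
    unfolding tensors_rank_le_eq[OF k] by (auto simp: param_image_def)
  show "tensors_rank_le k n r \<subseteq> cspace (tensor_index k n)" by (auto simp: tensors_rank_le_def)
  fix P T
  assume P: "P \<in> poly_funs (tensor_index k n)"
    "\<And>\<theta>. \<theta> \<in> positive_orthant \<Longrightarrow> P (\<lambda>i. rank_sum r k i \<theta>) = 0" and "T \<in> tensors_rank_le k n r"
  then obtain \<tau> where T: "T = (\<lambda>x\<in>tensor_index k n. rank_sum r k x \<tau>)"
    unfolding tensors_rank_le_eq[OF k] by blast
  have "(\<lambda>\<tau>. P (\<lambda>i. rank_sum r k i \<tau>)) \<in> poly_funs (rank_params r k n)"
    by (rule poly_funs_subst[OF P(1) rank_sum_poly_funs])
  from poly_funs_eq_0_on_positive_orthant[OF finite_rank_params this P(2)]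
  have "P (\<lambda>i. rank_sum r k i \<tau>) = 0" .
  moreover have "P T = P (\<lambda>i. rank_sum r k i \<tau>)"
    unfolding T by (intro poly_funs_cong[OF P(1)]) auto
  ultimately show "P T = 0" by simp
qed

section \<open>Clique stars and their mixture models\<close>

lemma finite_states: "finite A \<Longrightarrow> finite (states d A)"
  by (auto simp: states_def intro: finite_PiE)

lemma card_states: "finite A \<Longrightarrow> card (states d A) = num_states d A"
  by (simp add: states_def num_states_def card_PiE)

lemma restrict_states: "i \<in> states d V \<Longrightarrow> A \<subseteq> V \<Longrightarrow> restrict i A \<in> states d A"
  by (auto simp: states_def)

lemma in_open_simplex_iff:
  "p \<in> open_simplex I \<longleftrightarrow> p \<in> cspace I \<and> (\<forall>i\<in>I. p i \<in> positive_reals) \<and> (\<Sum>i\<in>I. p i) = 1"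
  by (auto simp: open_simplex_def positive_reals_def)

locale star_graph =
  fixes V :: "'v set" and E :: "'v set set" and d :: "'v \<Rightarrow> nat"
    and K :: "nat \<Rightarrow> 'v set" and S :: "'v set" and k :: nat
  assumes simple: "simple_graph V E" and d_pos: "\<forall>v\<in>V. d v \<ge> 1" and star: "clique_star V E k K S"
begin

lemma finite_V: "finite V"
  using simple by (simp add: simple_graph_def)

lemma K_bij: "bij_betw K {1..k} (maximal_cliques V E)"
  using star by (simp add: clique_star_def)

lemma clique_subset_K:
  assumes "clique V E L"
  shows "\<exists>j\<in>{1..k}. L \<subseteq> K j"
proof -
  let ?C = "{M. clique V E M}"
  have "?C \<subseteq> Pow V" by (auto simp: clique_def)
  then have "finite ?C" using finite_V by (rule finite_subset[OF _ finite_Pow_iff[THEN iffD2]])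
  then have "\<exists>M\<in>?C. L \<subseteq> M \<and> (\<forall>N\<in>?C. M \<subseteq> N \<longrightarrow> M = N)"
    using assms by (intro finite_has_maximal2) auto
  then obtain M where M: "clique V E M" "L \<subseteq> M" "\<And>N. clique V E N \<Longrightarrow> M \<subseteq> N \<Longrightarrow> M = N" by auto
  then have "M \<in> maximal_cliques V E" by (auto simp: maximal_cliques_def)
  then have "M \<in> K ` {1..k}" using K_bij by (simp add: bij_betw_def)
  then show ?thesis using M(2) by auto
qed

lemma k_ge_1: "k \<ge> 1"
  using clique_subset_K[of "{}"] by (auto simp: clique_def)

lemma K_maximal: "j \<in> {1..k} \<Longrightarrow> K j \<in> maximal_cliques V E"
  using K_bij by (auto simp: bij_betw_def)

lemma K_subset: "j \<in> {1..k} \<Longrightarrow> K j \<subseteq> V"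
  using K_maximal by (auto simp: maximal_cliques_def clique_def)

lemma K_inter: "i \<in> {1..k} \<Longrightarrow> j \<in> {1..k} \<Longrightarrow> i \<noteq> j \<Longrightarrow> K i \<inter> K j = S"
  using star by (simp add: clique_star_def)

lemma S_clique: "clique V E S"
  using star by (simp add: clique_star_def)

lemma S_subset: "S \<subseteq> V"
  using S_clique by (simp add: clique_def)

lemma S_subset_K:
  assumes "j \<in> {1..k}"
  shows "S \<subseteq> K j"
proof -
  obtain i where "i \<in> {1..k}" "S \<subseteq> K i" using clique_subset_K[OF S_clique] by blast
  then show ?thesis using K_inter[of i j] assms by (cases "i = j") auto
qed

lemma V_eq: "V = S \<union> (\<Union>j\<in>{1..k}. K j - S)"
proof (intro equalityI subsetI)
  fix v assume "v \<in> V"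
  then have "clique V E {v}" by (auto simp: clique_def)
  then show "v \<in> S \<union> (\<Union>j\<in>{1..k}. K j - S)" using clique_subset_K by blast
next
  fix v assume "v \<in> S \<union> (\<Union>j\<in>{1..k}. K j - S)"
  then show "v \<in> V" using S_subset K_subset by blast
qed

lemma arm_finite: "finite (K j - S)" if "j \<in> {1..k}"
  using K_subset[OF that] finite_V by (meson finite_Diff finite_subset)

definition arm_states :: "nat \<Rightarrow> nat" where
  "arm_states j = num_states d (K j - S)"

lemma num_states_V: "num_states d V = num_states d S * (\<Prod>j=1..k. arm_states j)"
proof -
  have fS: "finite S" using S_subset finite_V by (rule finite_subset)
  have "num_states d V = (\<Prod>v\<in>S \<union> (\<Union>j\<in>{1..k}. K j - S). d v)"
    unfolding num_states_def by (rule prod.cong[OF V_eq refl])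
  also have "\<dots> = (\<Prod>v\<in>S. d v) * (\<Prod>v\<in>(\<Union>j\<in>{1..k}. K j - S). d v)"
    using fS arm_finite by (intro prod.union_disjoint) auto
  also have "(\<Prod>v\<in>(\<Union>j\<in>{1..k}. K j - S). d v) = (\<Prod>j=1..k. \<Prod>v\<in>K j - S. d v)"
  proof (rule prod.UNION_disjoint)
    show "\<forall>i\<in>{1..k}. \<forall>j\<in>{1..k}. i \<noteq> j \<longrightarrow> (K i - S) \<inter> (K j - S) = {}"
      using K_inter by blast
  qed (use arm_finite in auto)
  finally show ?thesis by (simp add: num_states_def arm_states_def)
qed

text \<open>A numbering of the joint states of an arm, by which they become the values of one index of a
  tensor.\<close>

definition arm_label :: "nat \<Rightarrow> ('v \<Rightarrow> nat) \<Rightarrow> nat" where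
  "arm_label j = (SOME \<beta>. bij_betw \<beta> (states d (K j - S)) {1..arm_states j})"

lemma arm_label_bij:
  assumes "j \<in> {1..k}"
  shows "bij_betw (arm_label j) (states d (K j - S)) {1..arm_states j}"
proof -
  have "\<exists>\<beta>. bij_betw \<beta> (states d (K j - S)) {1..arm_states j}"
    using arm_finite[OF assms]
    by (intro finite_same_card_bij) (auto simp: finite_states card_states arm_states_def)
  then show ?thesis unfolding arm_label_def by (rule someI_ex)
qed

definition arm_index :: "('v \<Rightarrow> nat) \<Rightarrow> nat \<Rightarrow> nat" where
  "arm_index i = (\<lambda>j\<in>{1..k}. arm_label j (restrict i (K j - S)))"

lemma arm_index_mem: "i \<in> states d V \<Longrightarrow> arm_index i \<in> tensor_index k arm_states"
proof -
  assume i: "i \<in> states d V"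
  have "arm_label j (restrict i (K j - S)) \<in> {1..arm_states j}" if "j \<in> {1..k}" for j
  proof -
    have "restrict i (K j - S) \<in> states d (K j - S)" using K_subset[OF that] by (intro restrict_states[OF i]) auto
    then show ?thesis using arm_label_bij[OF that] by (auto simp: bij_betw_def)
  qed
  then show ?thesis by (simp add: arm_index_def tensor_index_def)
qed

text \<open>The centre and the arms partition the vertices. This gives injectivity, and equality of the
  cardinalities of both sides does the rest.\<close>

lemma states_bij:
  "bij_betw (\<lambda>i. (restrict i S, arm_index i)) (states d V) (states d S \<times> tensor_index k arm_states)"
proof -
  let ?h = "\<lambda>i. (restrict i S, arm_index i)"
  have fS: "finite S" using S_subset finite_V by (rule finite_subset)
  have inj: "inj_on ?h (states d V)"
  proof (rule inj_onI)
    fix i i' assume i: "i \<in> states d V" "i' \<in> states d V" and eq: "?h i = ?h i'"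
    show "i = i'"
    proof (rule PiE_ext[of i V "\<lambda>v. {1..d v}"])
      fix v assume "v \<in> V"
      then consider "v \<in> S" | j where "j \<in> {1..k}" "v \<in> K j - S" using V_eq by blast
      then show "i v = i' v"
      proof cases
        case 1
        from eq have "restrict i S = restrict i' S" by simp
        from fun_cong[OF this, of v] 1 show ?thesis by simp
      next
        case 2
        from eq have "arm_index i = arm_index i'" by simp
        from fun_cong[OF this, of j] 2(1)
        have "arm_label j (restrict i (K j - S)) = arm_label j (restrict i' (K j - S))"
          by (simp add: arm_index_def)
        moreover have "restrict i (K j - S) \<in> states d (K j - S)" "restrict i' (K j - S) \<in> states d (K j - S)"
          using i K_subset[OF 2(1)] by (auto intro!: restrict_states)
        ultimately have "restrict i (K j - S) = restrict i' (K j - S)"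
          using arm_label_bij[OF 2(1)] by (auto simp: bij_betw_def inj_on_def)
        from fun_cong[OF this, of v] 2(2) show ?thesis by simp
      qed
    qed (use i in \<open>auto simp: states_def\<close>)
  qed
  moreover have "?h ` states d V = states d S \<times> tensor_index k arm_states"
  proof (rule card_subset_eq)
    show "finite (states d S \<times> tensor_index k arm_states)" using fS by (auto simp: finite_states finite_tensor_index)
    show "?h ` states d V \<subseteq> states d S \<times> tensor_index k arm_states"
      using arm_index_mem restrict_states[OF _ S_subset] by auto
    have "card (tensor_index k arm_states) = (\<Prod>j=1..k. arm_states j)"
      by (simp add: tensor_index_def card_PiE)
    then show "card (?h ` states d V) = card (states d S \<times> tensor_index k arm_states)"
      using finite_V fS by (simp add: card_image[OF inj] card_states num_states_V card_cartesian_product)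
  qed
  ultimately show ?thesis by (simp add: bij_betw_def)
qed

lemma states_nonempty: "states d V \<noteq> {}"
  using d_pos by (auto simp: states_def PiE_eq_empty_iff)

text \<open>The \<open>l\<close>-th summand of an unnormalised mixture, with factor \<open>j\<close> depending on the state of the centre
  and on the state of arm \<open>j\<close>, that is, on the state of the clique \<open>K j\<close>.\<close>

definition component :: "nat \<Rightarrow> ('v \<Rightarrow> nat) \<Rightarrow> (('v \<Rightarrow> nat) \<times> nat \<times> nat \<times> nat \<Rightarrow> complex) \<Rightarrow> complex" where
  "component l i \<theta> = (\<Prod>j=1..k. \<theta> (restrict i S, l, j, arm_index i j))"

definition cone_point :: "nat \<Rightarrow> ('v \<Rightarrow> nat) \<Rightarrow> (('v \<Rightarrow> nat) \<times> nat \<times> nat \<times> nat \<Rightarrow> complex) \<Rightarrow> complex" where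
  "cone_point r i \<theta> = (\<Sum>l=1..r. component l i \<theta>)"

definition total_mass :: "nat \<Rightarrow> (('v \<Rightarrow> nat) \<times> nat \<times> nat \<times> nat \<Rightarrow> complex) \<Rightarrow> complex" where
  "total_mass r \<theta> = (\<Sum>i\<in>states d V. cone_point r i \<theta>)"

lemma cone_point_eq_rank_sum:
  "cone_point r i \<theta> = rank_sum r k (arm_index i) (\<lambda>a. \<theta> (restrict i S, a))"
  by (simp add: cone_point_def component_def rank_sum_def)

lemma component_positive: "\<theta> \<in> positive_orthant \<Longrightarrow> component l i \<theta> \<in> positive_reals"
  unfolding component_def by (intro positive_reals_prod) (auto simp: positive_orthant_def)

lemma cone_point_positive: "r \<ge> 1 \<Longrightarrow> \<theta> \<in> positive_orthant \<Longrightarrow> cone_point r i \<theta> \<in> positive_reals"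
  unfolding cone_point_def by (intro positive_reals_sum component_positive) auto

lemma total_mass_positive: "r \<ge> 1 \<Longrightarrow> \<theta> \<in> positive_orthant \<Longrightarrow> total_mass r \<theta> \<in> positive_reals"
  unfolding total_mass_def
  by (intro positive_reals_sum cone_point_positive finite_states finite_V states_nonempty)

lemma cone_point_poly_funs:
  assumes "i \<in> states d V"
  shows "cone_point r i \<in> poly_funs (states d S \<times> rank_params r k arm_states)"
proof -
  have "(\<lambda>\<theta>. \<Sum>l=1..r. \<Prod>j=1..k. \<theta> (restrict i S, l, j, arm_index i j)) \<in>
      poly_funs (states d S \<times> rank_params r k arm_states)"
    using arm_index_mem[OF assms] restrict_states[OF assms S_subset]
    by (intro poly_funs_sum poly_funs_prod poly_funs.coord)
      (auto simp: rank_params_def tensor_index_def)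
  then show ?thesis by (simp add: cone_point_def[abs_def] component_def)
qed

lemma total_mass_poly_funs: "total_mass r \<in> poly_funs (states d S \<times> rank_params r k arm_states)"
proof -
  have "(\<lambda>\<theta>. \<Sum>i\<in>states d V. cone_point r i \<theta>) \<in> poly_funs (states d S \<times> rank_params r k arm_states)"
    by (intro poly_funs_sum cone_point_poly_funs finite_states finite_V)
  then show ?thesis by (simp add: total_mass_def[abs_def])
qed

lemma product_rescale:
  fixes c :: complex
  shows "(\<Prod>j=1..k. (if j = 1 then c else 1) * h j) = c * (\<Prod>j=1..k. h j)"
proof -
  have "(\<Prod>j=1..k. if j = 1 then c else 1) = c" using k_ge_1 by simp
  then show ?thesis by (simp only: prod.distrib)
qed

text \<open>Scaling the factors with \<open>j = 1\<close> scales all summands, hence the whole point of the cone.\<close>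

lemma total_mass_rescale:
  assumes r: "r \<ge> 1" and \<theta>: "\<theta> \<in> positive_orthant" and s: "s \<in> positive_reals"
  obtains \<theta>' where "\<theta>' \<in> positive_orthant" "total_mass r \<theta>' = s"
    "\<And>i. cone_point r i \<theta>' / total_mass r \<theta>' = cone_point r i \<theta> / total_mass r \<theta>"
proof -
  define c where "c = s / total_mass r \<theta>"
  have m: "total_mass r \<theta> \<in> positive_reals" by (rule total_mass_positive[OF r \<theta>])
  have c: "c \<in> positive_reals" unfolding c_def by (intro positive_reals_divide s m)
  define \<theta>' where "\<theta>' = (\<lambda>(a, l, j, y). (if j = 1 then c else 1) * \<theta> (a, l, j, y))"
  have "component l i \<theta>' = c * component l i \<theta>" for l i
    unfolding component_def \<theta>'_def prod.case by (rule product_rescale)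
  then have cp: "cone_point r i \<theta>' = c * cone_point r i \<theta>" for i
    by (simp add: cone_point_def sum_distrib_left)
  then have tm: "total_mass r \<theta>' = c * total_mass r \<theta>"
    by (simp add: total_mass_def sum_distrib_left)
  show ?thesis
  proof
    show "\<theta>' \<in> positive_orthant"
      using \<theta> c by (auto simp: \<theta>'_def positive_orthant_def intro: positive_reals_mult)
    show "total_mass r \<theta>' = s" using positive_reals_nonzero[OF m] by (simp add: tm c_def)
    show "cone_point r i \<theta>' / total_mass r \<theta>' = cone_point r i \<theta> / total_mass r \<theta>" for i
      using positive_reals_nonzero[OF c] by (simp add: cp tm)
  qed
qed

lemma monomial_map_eq:
  assumes "i \<in> states d V"
  shows "monomial_map V E d \<eta> i = (\<Prod>j=1..k. \<eta> (K j, restrict i (K j)))"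
  using assms prod.reindex_bij_betw[OF K_bij, of "\<lambda>C. \<eta> (C, restrict i C)"]
  by (simp add: monomial_map_def)

text \<open>A maximal clique \<open>K j\<close> contains the centre, so its state determines both arguments of factor \<open>j\<close>.
  The normalising constant is put into the factor of \<open>K 1\<close>.\<close>

lemma normalized_component_in_model:
  assumes \<theta>: "\<theta> \<in> positive_orthant"
  shows "(\<lambda>i\<in>states d V. component l i \<theta> / (\<Sum>i\<in>states d V. component l i \<theta>)) \<in> graphical_model V E d"
proof -
  define c where "c = (\<Sum>i\<in>states d V. component l i \<theta>)"
  have c: "c \<in> positive_reals" unfolding c_def
    by (intro positive_reals_sum component_positive[OF \<theta>] finite_states finite_V states_nonempty)
  define pos where "pos = inv_into {1..k} K"
  define \<eta> where "\<eta> = (\<lambda>(C, i)\<in>param_index V E d. (if pos C = 1 then inverse c else 1) *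
      \<theta> (restrict i S, l, pos C, arm_label (pos C) (restrict i (C - S))))"
  have pos: "pos (K j) = j" if "j \<in> {1..k}" for j
    using K_bij that unfolding pos_def bij_betw_def by (simp add: inv_into_f_f)
  let ?p = "\<lambda>i\<in>states d V. component l i \<theta> / c"
  have "?p = monomial_map V E d \<eta>"
  proof
    fix i
    show "?p i = monomial_map V E d \<eta> i"
    proof (cases "i \<in> states d V")
      case True
      have "\<eta> (K j, restrict i (K j)) = (if j = 1 then inverse c else 1) * \<theta> (restrict i S, l, j, arm_index i j)"
        if j: "j \<in> {1..k}" for j
      proof -
        have "(K j, restrict i (K j)) \<in> param_index V E d"
          using K_maximal[OF j] restrict_states[OF True K_subset[OF j]] by (simp add: param_index_def)
        moreover have "restrict (restrict i (K j)) S = restrict i S"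
          using S_subset_K[OF j] by (simp add: restrict_restrict Int_absorb1)
        moreover have "restrict (restrict i (K j)) (K j - S) = restrict i (K j - S)"
          by (simp add: restrict_restrict Int_absorb1)
        ultimately show ?thesis using j by (simp add: \<eta>_def pos arm_index_def)
      qed
      then have "monomial_map V E d \<eta> i = inverse c * component l i \<theta>"
        unfolding monomial_map_eq[OF True] component_def product_rescale[symmetric] by (intro prod.cong) auto
      then show ?thesis using True by (simp add: divide_inverse mult.commute)
    qed (simp add: monomial_map_def)
  qed
  moreover have "\<eta> \<in> cspace (param_index V E d)" by (simp add: \<eta>_def cspace_def)
  moreover have "?p \<in> open_simplex (states d V)"
    unfolding in_open_simplex_iff
  proof (intro conjI ballI)
    show "?p \<in> cspace (states d V)" by (simp add: cspace_def)
    show "?p i \<in> positive_reals" if "i \<in> states d V" for i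
      using that by (simp add: positive_reals_divide component_positive[OF \<theta>] c)
    show "(\<Sum>i\<in>states d V. ?p i) = 1"
      using positive_reals_nonzero[OF c] by (simp add: sum_divide_distrib[symmetric] c_def)
  qed
  ultimately show ?thesis unfolding graphical_model_def c_def by blast
qed

text \<open>The weight of a summand is its share of the total mass.\<close>

lemma normalized_cone_point_in_mixture:
  assumes r: "r \<ge> 1" and \<theta>: "\<theta> \<in> positive_orthant"
  shows "(\<lambda>i\<in>states d V. cone_point r i \<theta> / total_mass r \<theta>) \<in> mixture r (states d V) (graphical_model V E d)"
proof -
  define c where "c l = (\<Sum>i\<in>states d V. component l i \<theta>)" for l
  have c: "c l \<in> positive_reals" for l unfolding c_def
    by (intro positive_reals_sum component_positive[OF \<theta>] finite_states finite_V states_nonempty)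
  have m: "total_mass r \<theta> \<in> positive_reals" by (rule total_mass_positive[OF r \<theta>])
  have m_sum: "total_mass r \<theta> = (\<Sum>l=1..r. c l)"
    unfolding total_mass_def cone_point_def c_def by (rule sum.swap)
  define \<pi> where "\<pi> = (\<lambda>l\<in>{1..r}. c l / total_mass r \<theta>)"
  define p where "p l = (\<lambda>i\<in>states d V. component l i \<theta> / c l)" for l
  have "\<pi> \<in> open_simplex {1..r}" unfolding in_open_simplex_iff
  proof (intro conjI ballI)
    show "\<pi> \<in> cspace {1..r}" by (simp add: cspace_def \<pi>_def)
    show "\<pi> l \<in> positive_reals" if "l \<in> {1..r}" for l
      using that by (simp add: \<pi>_def positive_reals_divide c m)
    show "(\<Sum>l\<in>{1..r}. \<pi> l) = 1"
      using positive_reals_nonzero[OF m] by (simp add: \<pi>_def sum_divide_distrib[symmetric] m_sum)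
  qed
  moreover have "\<forall>l\<in>{1..r}. p l \<in> graphical_model V E d"
    unfolding p_def c_def using normalized_component_in_model[OF \<theta>] by blast
  moreover have "(\<lambda>i\<in>states d V. cone_point r i \<theta> / total_mass r \<theta>) = (\<lambda>i\<in>states d V. \<Sum>l=1..r. \<pi> l * p l i)"
  proof (rule restrict_ext)
    fix i assume "i \<in> states d V"
    then have "\<pi> l * p l i = component l i \<theta> / total_mass r \<theta>" if "l \<in> {1..r}" for l
      using that positive_reals_nonzero[OF c, of l] by (simp add: \<pi>_def p_def)
    then show "cone_point r i \<theta> / total_mass r \<theta> = (\<Sum>l=1..r. \<pi> l * p l i)"
      by (simp add: cone_point_def sum_divide_distrib)
  qed
  ultimately show ?thesis unfolding mixture_def by blast
qed

text \<open>The parameters of a point of the graphical model are complex, but they may be replaced by their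
  absolute values, because the product of absolute values is the absolute value of a positive number.
  The mixture weights go into the factors with \<open>j = 1\<close>.\<close>

lemma mixture_is_normalized_cone_point:
  assumes r: "r \<ge> 1" and x: "x \<in> mixture r (states d V) (graphical_model V E d)"
  obtains \<theta> where "\<theta> \<in> positive_orthant" "\<And>i. i \<in> states d V \<Longrightarrow> x i = cone_point r i \<theta> / total_mass r \<theta>"
proof -
  from x obtain \<pi> p where x_eq: "x = (\<lambda>i\<in>states d V. \<Sum>l=1..r. \<pi> l * p l i)"
    and \<pi>: "\<pi> \<in> open_simplex {1..r}" and p: "\<And>l. l \<in> {1..r} \<Longrightarrow> p l \<in> graphical_model V E d"
    unfolding mixture_def by blast
  have "\<forall>l\<in>{1..r}. \<exists>\<eta>. p l = monomial_map V E d \<eta>" using p unfolding graphical_model_def by blast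
  from bchoice[OF this] obtain \<eta> where \<eta>: "\<And>l. l \<in> {1..r} \<Longrightarrow> p l = monomial_map V E d (\<eta> l)" by blast
  have p_simplex: "p l \<in> open_simplex (states d V)" if "l \<in> {1..r}" for l
    using p[OF that] by (simp add: graphical_model_def)
  \<comment> \<open>the state of the clique \<open>K j\<close> with given state of the centre and given label of the arm\<close>
  define glue where "glue a j y = (\<lambda>v\<in>K j. if v \<in> S then a v
      else inv_into (states d (K j - S)) (arm_label j) y v)" for a :: "'v \<Rightarrow> nat" and j y
  have glue: "glue (restrict i S) j (arm_index i j) = restrict i (K j)"
    if i: "i \<in> states d V" and j: "j \<in> {1..k}" for i j
  proof -
    have "restrict i (K j - S) \<in> states d (K j - S)" using K_subset[OF j] by (intro restrict_states[OF i]) auto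
    then have "inv_into (states d (K j - S)) (arm_label j) (arm_index i j) = restrict i (K j - S)"
      using arm_label_bij[OF j] j by (simp add: arm_index_def bij_betw_def)
    then show ?thesis unfolding glue_def by (auto simp: restrict_def)
  qed
  define w where "w a l j y = (if j = 1 then \<pi> l else 1) * complex_of_real (norm (\<eta> l (K j, glue a j y)))" for a l j y
  \<comment> \<open>the default \<open>1\<close> makes every parameter positive; it is used only where no state of the graph
    reads the parameter\<close>
  define \<theta> where "\<theta> = (\<lambda>(a, l, j, y). if w a l j y \<in> positive_reals then w a l j y else 1)"
  have \<theta>: "\<theta> \<in> positive_orthant" by (auto simp: positive_orthant_def \<theta>_def positive_reals_one)
  have \<pi>_pos: "\<pi> l \<in> positive_reals" if "l \<in> {1..r}" for l using \<pi> that by (simp add: in_open_simplex_iff)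
  have comp: "component l i \<theta> = \<pi> l * p l i" if l: "l \<in> {1..r}" and i: "i \<in> states d V" for l i
  proof -
    have pos: "p l i \<in> positive_reals" using p_simplex[OF l] i by (simp add: in_open_simplex_iff)
    have p_prod: "p l i = (\<Prod>j=1..k. \<eta> l (K j, restrict i (K j)))" using \<eta>[OF l] monomial_map_eq[OF i] by simp
    then have nz: "\<eta> l (K j, restrict i (K j)) \<noteq> 0" if "j \<in> {1..k}" for j
      using positive_reals_nonzero[OF pos] that by auto
    have "\<theta> (restrict i S, l, j, arm_index i j) =
        (if j = 1 then \<pi> l else 1) * complex_of_real (norm (\<eta> l (K j, restrict i (K j))))" if j: "j \<in> {1..k}" for j
    proof -
      have "(if j = 1 then \<pi> l else 1) * complex_of_real (norm (\<eta> l (K j, restrict i (K j)))) \<in> positive_reals"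
        using nz[OF j] \<pi>_pos[OF l]
        by (intro positive_reals_mult) (auto simp: positive_reals_one positive_reals_iff[of "complex_of_real _"])
      then show ?thesis by (simp add: \<theta>_def w_def glue[OF i j])
    qed
    then have "component l i \<theta> = (\<Prod>j=1..k. (if j = 1 then \<pi> l else 1) *
        complex_of_real (norm (\<eta> l (K j, restrict i (K j)))))"
      unfolding component_def by (intro prod.cong) auto
    also have "\<dots> = \<pi> l * complex_of_real (norm (p l i))"
      unfolding product_rescale p_prod by (simp flip: prod_norm)
    finally show ?thesis by (simp add: positive_reals_norm[OF pos])
  qed
  then have cp: "cone_point r i \<theta> = x i" if "i \<in> states d V" for i
    using that by (simp add: cone_point_def x_eq)
  have "total_mass r \<theta> = (\<Sum>i\<in>states d V. \<Sum>l=1..r. \<pi> l * p l i)"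
    unfolding total_mass_def by (intro sum.cong refl) (simp add: cp x_eq)
  also have "\<dots> = (\<Sum>l=1..r. \<Sum>i\<in>states d V. \<pi> l * p l i)" by (rule sum.swap)
  also have "\<dots> = (\<Sum>l=1..r. \<pi> l)"
    using p_simplex by (intro sum.cong) (simp_all add: sum_distrib_left[symmetric] in_open_simplex_iff)
  also have "\<dots> = 1" using \<pi> by (simp add: in_open_simplex_iff)
  finally have "total_mass r \<theta> = 1" .
  then show ?thesis using that[OF \<theta>] cp by simp
qed

text \<open>The dimension is computed through the normalised points of the cone, then through the cone,
  which is a power of the parametrised set of tensors.\<close>

lemma zariski_dim_mixture:
  assumes r: "r \<ge> 1"
  shows "zariski_dim (states d V) (mixture r (states d V) (graphical_model V E d)) + 1 =
    ereal (real (num_states d S)) *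
      zariski_dim (tensor_index k arm_states) (tensors_rank_le k arm_states r)"
proof -
  let ?A = "states d S \<times> rank_params r k arm_states" and ?I = "states d V"
  let ?p = "\<lambda>i \<theta>. cone_point r i \<theta> / total_mass r \<theta>"
  have finS: "finite S" using S_subset finite_V by (rule finite_subset)
  have finA: "finite ?A" using finS by (simp add: finite_states finite_rank_params)
  have finI: "finite ?I" by (simp add: finite_states finite_V)
  have m: "total_mass r \<theta> \<noteq> 0" if "\<theta> \<in> positive_orthant" for \<theta>
    using positive_reals_nonzero[OF total_mass_positive[OF r that]] .
  have reg: "?p i \<in> regular_funs ?A" if "i \<in> ?I" for i
    unfolding regular_funs_def mem_Collect_eq
    by (rule bexI[OF _ cone_point_poly_funs[OF that]], rule bexI[OF _ total_mass_poly_funs]) (simp add: m)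
  have "zariski_dim ?I (mixture r ?I (graphical_model V E d)) =
      ereal (real (coord_rank ?I (param_image ?I ?p positive_orthant)))"
  proof (rule zariski_dim_eq_coord_rank[OF finA finI])
    show "?p ` ?I \<subseteq> regular_funs ?A" using reg by blast
    show "param_image ?I ?p positive_orthant \<subseteq> mixture r ?I (graphical_model V E d)"
      using normalized_cone_point_in_mixture[OF r] by (auto simp: param_image_def)
    show "mixture r ?I (graphical_model V E d) \<subseteq> cspace ?I" by (auto simp: mixture_def cspace_def)
    fix P x
    assume P: "P \<in> poly_funs ?I" "\<And>\<theta>. \<theta> \<in> positive_orthant \<Longrightarrow> P (\<lambda>i. ?p i \<theta>) = 0"
      and x: "x \<in> mixture r ?I (graphical_model V E d)"
    obtain \<theta> where \<theta>: "\<theta> \<in> positive_orthant" "\<And>i. i \<in> ?I \<Longrightarrow> x i = ?p i \<theta>"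
      by (rule mixture_is_normalized_cone_point[OF r x]) rule
    have "P x = P (\<lambda>i. ?p i \<theta>)" by (rule poly_funs_cong[OF P(1) \<theta>(2)])
    then show "P x = 0" using P(2)[OF \<theta>(1)] by simp
  qed
  moreover have "coord_rank ?I (param_image ?I (cone_point r) positive_orthant) =
      Suc (coord_rank ?I (param_image ?I ?p positive_orthant))"
  proof (rule coord_rank_normalize[OF finA finI, where F = "total_mass r"])
    show "cone_point r ` ?I \<subseteq> regular_funs ?A" using cone_point_poly_funs by (auto intro: poly_funs_regular)
    show "?p ` ?I \<subseteq> regular_funs ?A" using reg by blast
    show "total_mass r \<in> regular_funs ?A" by (intro poly_funs_regular total_mass_poly_funs)
    show "cone_point r i \<theta> = total_mass r \<theta> * ?p i \<theta>" if "\<theta> \<in> positive_orthant" for \<theta> i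
      using m[OF that] by simp
    show "total_mass r \<theta> = (\<Sum>i\<in>?I. cone_point r i \<theta>)" for \<theta> by (simp add: total_mass_def)
    fix \<theta> :: "('v \<Rightarrow> nat) \<times> nat \<times> nat \<times> nat \<Rightarrow> complex" and s
    assume "\<theta> \<in> positive_orthant" "s \<in> positive_reals"
    from total_mass_rescale[OF r this] obtain \<theta>' where "\<theta>' \<in> positive_orthant" "total_mass r \<theta>' = s"
      "\<And>i. ?p i \<theta>' = ?p i \<theta>" by blast
    then show "\<exists>\<theta>'\<in>positive_orthant. total_mass r \<theta>' = s \<and> (\<forall>i\<in>?I. ?p i \<theta>' = ?p i \<theta>)" by blast
  qed
  moreover have "coord_rank ?I (param_image ?I (cone_point r) positive_orthant) =
      num_states d S * coord_rank (tensor_index k arm_states)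
        (param_image (tensor_index k arm_states) (rank_sum r k) positive_orthant)"
    using coord_rank_product[OF states_bij finI finite_states[OF finS] finite_tensor_index, of "rank_sum r k"]
    by (simp add: cone_point_eq_rank_sum[abs_def] card_states[OF finS])
  ultimately show ?thesis
    unfolding zariski_dim_tensors_rank_le[OF k_ge_1] by (simp add: add.commute flip: of_nat_mult of_nat_Suc)
qed

lemma num_states_times_dim_tensors_le:
  "ereal (real (num_states d S)) * zariski_dim (tensor_index k arm_states) (tensors_rank_le k arm_states r)
    \<le> ereal (real (num_states d V))"
proof -
  let ?T = "tensor_index k arm_states"
  let ?X = "param_image ?T (rank_sum r k) positive_orthant"
  have "?X \<noteq> {}" using one_in_positive_orthant by (auto simp: param_image_def)
  then obtain J where "J \<subseteq> ?T" "alg_independent ?X (\<lambda>i x. x i) J" "card J = coord_rank ?T ?X"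
    by (rule coord_rank_obtain[OF finite_tensor_index])
  then have "coord_rank ?T ?X \<le> card ?T" using card_mono[OF finite_tensor_index] by metis
  also have "card ?T = (\<Prod>j=1..k. arm_states j)" by (simp add: tensor_index_def card_PiE)
  finally have "num_states d S * coord_rank ?T ?X \<le> num_states d V" by (simp add: num_states_V)
  then show ?thesis
    unfolding zariski_dim_tensors_rank_le[OF k_ge_1] by (simp flip: of_nat_mult)
qed

end

section \<open>The dimension formula\<close>

theorem theorem3p3:
  fixes V :: "'v set" and E :: "'v set set" and d :: "'v \<Rightarrow> nat"
    and K :: "nat \<Rightarrow> 'v set" and S :: "'v set" and k r :: nat
  assumes "simple_graph V E"
    and "\<forall>v\<in>V. d v \<ge> 1"
    and "clique_star V E k K S"
    and "r \<ge> 1"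
  shows "zariski_dim (states d V) (mixture r (states d V) (graphical_model V E d)) =
    min (ereal (real (num_states d S)) *
           zariski_dim (tensor_index k (\<lambda>j. num_states d (K j - S)))
             (tensors_rank_le k (\<lambda>j. num_states d (K j - S)) r) - 1)
        (ereal (real (\<Prod>v\<in>V. d v)) - 1)"
proof -
  interpret star_graph V E d K S k by unfold_locales fact+
  let ?m = "zariski_dim (states d V) (mixture r (states d V) (graphical_model V E d))"
  let ?t = "ereal (real (num_states d S)) *
      zariski_dim (tensor_index k (\<lambda>j. num_states d (K j - S))) (tensors_rank_le k (\<lambda>j. num_states d (K j - S)) r)"
  have "?m + 1 = ?t" using zariski_dim_mixture[OF assms(4)] by (simp add: arm_states_def[abs_def])
  moreover have "x = x + 1 - 1" for x :: ereal by (cases x) (auto simp: one_ereal_def)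
  ultimately have "?m = ?t - 1" by metis
  moreover have "?t \<le> ereal (real (\<Prod>v\<in>V. d v))"
    using num_states_times_dim_tensors_le[of r] by (simp add: arm_states_def[abs_def] num_states_def)
  then have "?t - 1 \<le> ereal (real (\<Prod>v\<in>V. d v)) - 1" by (intro ereal_minus_mono) auto
  ultimately show ?thesis by (simp add: min_def)
qed


end
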